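(* Let $N\in\mathbb{N}$, $\alpha\in(0,2)$. Let $D_0,D_1\subset\mathbb{R}^N$ be bounded open strictly starshaped sets such that $0\in D_1$, $\overline{D}_1\subset D_0$, and $D_0\setminus\overline{D}_1$ satisfies a uniform exterior cone condition. Let $\beta\ge0$, $\gamma\in\mathbb{R}$, $p\ge1$, and let $f(x,u)=\beta u-\gamma u^p$ for $(x,u)\in(D_0\setminus\overline{D}_1)\times[0,1]$. Consider the problem $$(P)\qquad -(-\Delta)^{\alpha/2}u=f(x,u)\ \text{ in } D_0\setminus\overline{D}_1,\qquad u=0\ \text{ in }\mathbb{R}^N\setminus D_0,\qquad u=1\ \text{ in }\overline{D}_1 ,$$ and put $U(\ell)=\{x\in\mathbb{R}^N:u(x)\ge\ell\}$. Then: (i) Assume $\beta\ge\gamma$. If $u$ is a solution of $(P)$ such that $0<u<1$ on $D_0\setminus\overline{D}_1$, then the superlevel sets $U(\ell)$ are strictly starshaped for all $\ell\in(0,1)$. (ii) Assume $\beta\ge p\gamma$ and that $D_0\setminus\overline{D}_1$ is a $C^{1,1}$ domain. Then there exists a unique solution $u$ of $(P)$. It satisfies $0<u<1$ on $D_0\setminus\overline{D}_1$, and all superlevel sets $U(\ell)$, $\ell\in(0,1)$, are strictly starshaped.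
   Context: Let $\mathcal{L}^1_\alpha$ be the space of Borel functions $u:\mathbb{R}^N\to\mathbb{R}\cup\{\infty\}$ with $\int_{\mathbb{R}^N}\frac{|u(x)|}{(1+|x|)^{N+\alpha}}\,dx<\infty$. For $u\in\mathcal{L}^1_\alpha$ and $x\in\mathbb{R}^N$, the fractional Laplacian is $$(-\Delta)^{\alpha/2}u(x)=c_{N,\alpha}\lim_{\varepsilon\downarrow0}\int_{|x-y|>\varepsilon}\frac{u(x)-u(y)}{|x-y|^{N+\alpha}}\,dy$$ whenever the limit exists, with $c_{N,\alpha}=2^{\alpha-2}\pi^{-N/2}\alpha(2-\alpha)\Gamma(\frac{N+\alpha}{2})/\Gamma(2-\frac{\alpha}{2})$. It exists everywhere for functions in $C_c^2(\mathbb{R}^N)$. For $u\in\mathcal{L}^1_\alpha$ the distribution $(-\Delta)^{\alpha/2}u$ is defined by $\langle(-\Delta)^{\alpha/2}u,\varphi\rangle=\int_{\mathbb{R}^N}u\,(-\Delta)^{\alpha/2}\varphi\,dx$ for $\varphi\in C_c^\infty(\mathbb{R}^N)$. A solution of $(P)$ is a function $u$ that is continuous and bounded on $\mathbb{R}^N$, with $u=0$ in $\mathbb{R}^N\setminus D_0$, $u=1$ in $\overline{D}_1$, and $-(-\Delta)^{\alpha/2}u=f(x,u)$ as distributions in $D_0\setminus\overline{D}_1$, i.e. $\langle-(-\Delta)^{\alpha/2}u,\varphi\rangle=\int f(x,u(x))\varphi(x)\,dx$ for all $\varphi\in C_c^\infty(D_0\setminus\overline{D}_1)$. Since $f(x,\cdot)$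 is defined only on $[0,1]$, a solution is understood to take values in $[0,1]$. A set $A\subset\mathbb{R}^N$ is strictly starshaped if $0$ is in the interior of $A$ and any ray starting from $0$ intersects the boundary of $A$ in only one point. *)

theory Defs
  imports "HOL-Analysis.Analysis"
begin

section \<open>Starshaped sets and boundary regularity\<close>

definition ray :: "'a::real_vector \<Rightarrow> 'a set" where
  "ray v = {t *\<^sub>R v | t. 0 \<le> t}"

definition strictly_starshaped :: "'a::real_normed_vector set \<Rightarrow> bool" where
  "strictly_starshaped A \<longleftrightarrow>
     0 \<in> interior A \<and> (\<forall>v. v \<noteq> 0 \<longrightarrow> (\<exists>!x. x \<in> ray v \<inter> frontier A))"

text \<open>The closed finite right circular cone with vertex \<open>\<xi>\<close>, axis \<open>e\<close> (a unit vector),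
  half-opening angle \<open>\<theta>\<close> and height \<open>h\<close>.\<close>

definition finite_cone :: "real \<Rightarrow> real \<Rightarrow> 'a::euclidean_space \<Rightarrow> 'a \<Rightarrow> 'a set" where
  "finite_cone h \<theta> e \<xi> = {y. cos \<theta> * norm (y - \<xi>) \<le> (y - \<xi>) \<bullet> e \<and> (y - \<xi>) \<bullet> e \<le> h}"

text \<open>Uniformity: height and angle do not depend on the boundary point, so all the cones are
  congruent. Asking instead that the interior of the cone misses \<open>D\<close> gives the same condition,
  after shrinking \<open>\<theta>\<close> and \<open>h\<close>.\<close>

definition uniform_exterior_cone_condition :: "'a::euclidean_space set \<Rightarrow> bool" where
  "uniform_exterior_cone_condition D \<longleftrightarrow>
     (\<exists>h>0. \<exists>\<theta>\<in>{0<..<pi/2}. \<forall>\<xi>\<in>frontier D. \<exists>e. norm e = 1 \<and>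
        finite_cone h \<theta> e \<xi> \<inter> closure D = {\<xi>})"

text \<open>\<open>D\<close> is locally, in the orthonormal coordinates \<open>(x - (x \<bullet> \<nu>) \<nu>, x \<bullet> \<nu>)\<close>, the region above
  the graph of a function with Lipschitz gradient. The function \<open>\<phi>\<close> is taken on the whole space
  but evaluated on the hyperplane orthogonal to \<open>\<nu>\<close> only; nothing is lost, since a function on the
  hyperplane can be precomposed with the projection. No connectedness is required, so that rings in
  dimension one, which consist of two intervals, are covered; in higher dimension strictly
  starshaped rings are connected anyway. For bounded \<open>D\<close> the radius and the Lipschitz constant
  can be chosen uniformly by compactness of the boundary.\<close>

definition C11_domain :: "'a::euclidean_space set \<Rightarrow> bool" where
  "C11_domain D \<longleftrightarrow> open D \<and>
     (\<forall>\<xi>\<in>frontier D. \<exists>r>0. \<exists>\<nu> \<phi> G L. norm \<nu> = 1 \<and>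
        (\<forall>z. GDERIV \<phi> z :> G z) \<and> L-lipschitz_on UNIV G \<and>
        D \<inter> ball \<xi> r = {x \<in> ball \<xi> r. \<phi> (x - (x \<bullet> \<nu>) *\<^sub>R \<nu>) < x \<bullet> \<nu>})"

section \<open>Test functions\<close>

primrec Ck :: "nat \<Rightarrow> ('a::euclidean_space \<Rightarrow> real) \<Rightarrow> bool" where
  "Ck 0 f \<longleftrightarrow> continuous_on UNIV f"
| "Ck (Suc k) f \<longleftrightarrow>
     (\<forall>x. f differentiable (at x)) \<and> (\<forall>v. Ck k (\<lambda>x. frechet_derivative f (at x) v))"

definition test_functions :: "'a::euclidean_space set \<Rightarrow> ('a \<Rightarrow> real) set" where
  "test_functions \<Omega> =
     {\<phi>. (\<forall>k. Ck k \<phi>) \<and> compact (closure {x. \<phi> x \<noteq> 0}) \<and> closure {x. \<phi> x \<noteq> 0} \<subseteq> \<Omega>}"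

section \<open>The fractional Laplacian\<close>

definition frac_const :: "nat \<Rightarrow> real \<Rightarrow> real" where
  "frac_const N \<alpha> = 2 powr (\<alpha> - 2) * pi powr (- real N / 2) * \<alpha> * (2 - \<alpha>)
     * Gamma ((real N + \<alpha>) / 2) / Gamma (2 - \<alpha> / 2)"

text \<open>The value is meaningful only where the integrals and the limit exist, in particular everywhere
  for twice continuously differentiable functions with compact support; below it is applied to test
  functions only.\<close>

definition frac_laplacian :: "real \<Rightarrow> ('a::euclidean_space \<Rightarrow> real) \<Rightarrow> 'a \<Rightarrow> real" where
  "frac_laplacian \<alpha> u x = frac_const DIM('a) \<alpha> *
     Lim (at_right 0) (\<lambda>\<epsilon>. LINT y:{y. norm (x - y) > \<epsilon>}|lborel.
        (u x - u y) / norm (x - y) powr (real DIM('a) + \<alpha>))"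

text \<open>The pairing of the distributional fractional Laplacian of \<open>u\<close> with a test function. It is
  applied to bounded continuous \<open>u\<close>, which satisfy the integrability condition
  \<open>\<integral> \<bar>u x\<bar> / (1 + norm x) powr (N + \<alpha>) dx < \<infinity>\<close> automatically.\<close>

definition frac_laplacian_distr ::
    "real \<Rightarrow> ('a::euclidean_space \<Rightarrow> real) \<Rightarrow> ('a \<Rightarrow> real) \<Rightarrow> real" where
  "frac_laplacian_distr \<alpha> u \<phi> = (LINT x|lborel. u x * frac_laplacian \<alpha> \<phi> x)"

section \<open>The Dirichlet problem in a ring\<close>

text \<open>The nonlinearity \<open>f x s\<close> matters only for \<open>x\<close> in the ring and \<open>s \<in> {0..1}\<close>.\<close>

definition ring_solution ::
    "real \<Rightarrow> 'a::euclidean_space set \<Rightarrow> 'a set \<Rightarrow> ('a \<Rightarrow> real \<Rightarrow> real) \<Rightarrow> ('a \<Rightarrow> real) \<Rightarrow> bool" where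
  "ring_solution \<alpha> D0 D1 f u \<longleftrightarrow>
     continuous_on UNIV u \<and> bounded (range u) \<and> range u \<subseteq> {0..1} \<and>
     (\<forall>x. x \<notin> D0 \<longrightarrow> u x = 0) \<and> (\<forall>x\<in>closure D1. u x = 1) \<and>
     (\<forall>\<phi>\<in>test_functions (D0 - closure D1).
        - frac_laplacian_distr \<alpha> u \<phi> = (LINT x:D0 - closure D1|lborel. f x (u x) * \<phi> x))"

definition superlevel :: "('a \<Rightarrow> real) \<Rightarrow> real \<Rightarrow> 'a set" where
  "superlevel u l = {x. u x \<ge> l}"

end

theory Submission
  imports Defs "HOL-Computational_Algebra.Polynomial" "HOL-Complex_Analysis.Great_Picard"
begin

text \<open>Everything rests on a strong minimum principle for the weak equation: if \<open>v\<close> is continuous with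
  compact support, solves \<open>L v = g\<close> near a global minimum point \<open>x0\<close> and \<open>g x0 \<le> 0\<close>, then \<open>v\<close> is
  constant, since at its minimum a nonconstant function sees a strictly positive nonlocal term. For
  \<open>t > 1\<close> the dilation \<open>u (t x)\<close> solves the equation with right-hand side multiplied by
  \<open>t\<^bsup>\<alpha>\<^esup> > 1\<close>, and \<open>f \<ge> 0\<close> when \<open>\<beta> \<ge> \<gamma>\<close>. Decreasing \<open>t\<close> from infinity, a first contact of
  \<open>u (t x)\<close> with \<open>u\<close> would violate the principle, so \<open>u\<close> strictly decreases along rays where it
  lies between 0 and 1. When \<open>\<beta> \<ge> p \<gamma>\<close> the nonlinearity is nondecreasing and the principle also
  gives uniqueness.

  For existence the kernel is truncated at distance \<open>\<epsilon>\<close>; the resulting bounded operator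
  is treated by monotone iteration. Barriers built from the exterior cones control the solutions at
  the boundary uniformly in \<open>\<epsilon>\<close>, and since the equation is translation invariant the maximum
  principle, applied to the difference of a solution and a translate of it, carries this boundary
  modulus of continuity into the interior. A subsequence therefore converges to a continuous
  solution.\<close>

subsection \<open>Smooth bumps\<close>

text \<open>Solutions of the limit problem are merely continuous, so the operator is never evaluated
  on them. The minimum principle tests the equation against bumps only: translated bumps yield the
  mollification that makes the equation pointwise, and dilated bumps carry the equation over to
  \<open>u (t x)\<close>. The two conditions on the coefficients enter through the power alone: on
  [0,1] one has \<open>s powr p \<le> s\<close>, so \<gamma> \<le> \<beta> gives a nonnegative
  right-hand side, and p is the Lipschitz constant of the power there, so p \<gamma> \<le> \<beta>
  gives a nondecreasing one. The obstacle in the existence part is that the truncated operator has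
  no smoothing effect. Its solutions are bounded measurable functions that need not be continuous;
  suprema need not be attained, and a modulus of continuity can hold only up to an error of the size
  of the truncation length. This is why the maximum principle works at points of almost maximal
  value and why the summand \<open>4 * \<epsilon>\<^sup>2\<close> stays in the barrier and in the
  modulus until the limit is taken.\<close>

definition flat_exp :: "real poly \<Rightarrow> real \<Rightarrow> real" where
  "flat_exp P t = (if t > 0 then poly P (1 / t) * exp (- (1 / t)) else 0)"

lemma poly_exp_tendsto_0:
  fixes P :: "real poly"
  shows "((\<lambda>x. poly P x * exp (- x)) \<longlongrightarrow> 0) at_top"
proof -
  have "((\<lambda>x. \<Sum>i\<le>degree P. coeff P i * (x ^ i / exp x)) \<longlongrightarrow> (\<Sum>i\<le>degree P. coeff P i * 0)) at_top"
    by (intro tendsto_intros tendsto_power_div_exp_0)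
  moreover have "(\<lambda>x. \<Sum>i\<le>degree P. coeff P i * (x ^ i / exp x)) = (\<lambda>x. poly P x * exp (- x))"
    by (auto simp: poly_altdef sum_distrib_right exp_minus divide_inverse mult.assoc)
  ultimately show ?thesis by simp
qed

text \<open>Differentiating \<open>P(1/t) exp(-1/t)\<close> turns \<open>P\<close> into
  \<open>X^2 (P - P')\<close>. The family is thus closed under differentiation, and smoothness can
  be proved for all polynomials at once.\<close>

lemma flat_exp_has_derivative:
  "(flat_exp P has_real_derivative flat_exp ([:0, 0, 1:] * (P - pderiv P)) t) (at t)"
proof -
  consider "t > 0" | "t < 0" | "t = 0" by linarith
  then show ?thesis
  proof cases
    case 1
    have "((\<lambda>t. poly P (1 / t) * exp (- (1 / t))) has_real_derivative
        flat_exp ([:0, 0, 1:] * (P - pderiv P)) t) (at t)"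
    proof -
      have i: "((\<lambda>t. 1 / t) has_real_derivative (- (1 / t)\<^sup>2)) (at t)"
        using 1 by (auto intro!: derivative_eq_intros simp: power2_eq_square)
      have "((\<lambda>t. poly P (1 / t) * exp (- (1 / t))) has_real_derivative
          poly P (1 / t) * (exp (- (1 / t)) * (1 / t)\<^sup>2)
          + poly (pderiv P) (1 / t) * (- (1 / t)\<^sup>2) * exp (- (1 / t))) (at t)"
        using DERIV_mult'[OF DERIV_chain2[OF poly_DERIV i] DERIV_chain2[OF DERIV_exp DERIV_minus[OF i]], of P] by simp
      also have "poly P s * (E * s\<^sup>2) + poly (pderiv P) s * (- s\<^sup>2) * E
          = poly ([:0, 0, 1:] * (P - pderiv P)) s * E" for s E :: real
        by (simp add: power2_eq_square algebra_simps)
      finally show ?thesis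
        using 1 by (simp only: flat_exp_def if_True)
    qed
    moreover have "\<forall>\<^sub>F s in nhds t. poly P (1 / s) * exp (- (1 / s)) = flat_exp P s"
      using eventually_nhds_in_open[of "{0<..}" t] 1
      by (auto elim!: eventually_mono simp: flat_exp_def)
    ultimately show ?thesis
      by (rule DERIV_cong_ev[OF refl _ refl, THEN iffD1, rotated])
  next
    case 2
    have "((\<lambda>t. 0) has_real_derivative flat_exp ([:0, 0, 1:] * (P - pderiv P)) t) (at t)"
      using 2 by (auto simp: flat_exp_def)
    moreover have "\<forall>\<^sub>F s in nhds t. 0 = flat_exp P s"
      using eventually_nhds_in_open[of "{..<0}" t] 2
      by (auto elim!: eventually_mono simp: flat_exp_def)
    ultimately show ?thesis
      by (rule DERIV_cong_ev[OF refl _ refl, THEN iffD1, rotated])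
  next
    case 3
    have r: "((\<lambda>h. flat_exp P h / h) \<longlongrightarrow> 0) (at_right 0)"
    proof -
      \<comment> \<open>With \<open>s = 1/h\<close> the difference quotient at 0 is
        \<open>s P(s) exp(-s)\<close>, and \<open>pCons 0 P\<close> is the polynomial
        \<open>s P(s)\<close>.\<close>
      have "((\<lambda>h. poly (pCons 0 P) (inverse h) * exp (- inverse h)) \<longlongrightarrow> 0) (at_right (0::real))"
        using filterlim_compose[OF poly_exp_tendsto_0 filterlim_inverse_at_top_right] .
      then show ?thesis
        by (rule Lim_transform_eventually)
          (auto simp: eventually_at_filter flat_exp_def divide_inverse)
    qed
    have l: "((\<lambda>h. flat_exp P h / h) \<longlongrightarrow> 0) (at_left 0)"
      by (rule tendsto_eventually) (auto simp: eventually_at_filter flat_exp_def)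
    show ?thesis
      unfolding DERIV_def using 3 filterlim_split_at[OF l r] by (simp add: flat_exp_def)
  qed
qed

lemma Ck_Suc_imp_Ck: "Ck (Suc k) f \<Longrightarrow> Ck k f"
proof (induction k arbitrary: f)
  case 0
  then show ?case
    by (simp add: continuous_on_eq_continuous_at differentiable_imp_continuous_within)
next
  case (Suc k)
  then show ?case by (simp only: Ck.simps) blast
qed

lemma Ck_const: "Ck k (\<lambda>x. c)"
  by (induction k arbitrary: c) auto

lemma Ck_add: "Ck k f \<Longrightarrow> Ck k g \<Longrightarrow> Ck k (\<lambda>x. f x + g x)"
proof (induction k arbitrary: f g)
  case (Suc k)
  have "frechet_derivative (\<lambda>x. f x + g x) (at x) v
      = frechet_derivative f (at x) v + frechet_derivative g (at x) v" for x v
    using Suc.prems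
    by (subst frechet_derivative_at[symmetric, OF has_derivative_add]) (auto simp: frechet_derivative_works[symmetric])
  with Suc show ?case by (auto intro!: Suc.IH)
qed (auto intro: continuous_intros)

lemma Ck_mult: "Ck k f \<Longrightarrow> Ck k g \<Longrightarrow> Ck k (\<lambda>x. f x * g x)"
proof (induction k arbitrary: f g)
  case (Suc k)
  have "frechet_derivative (\<lambda>x. f x * g x) (at x) v
      = f x * frechet_derivative g (at x) v + frechet_derivative f (at x) v * g x" for x v
    using Suc.prems
    by (subst frechet_derivative_at[symmetric, OF has_derivative_mult]) (auto simp: frechet_derivative_works[symmetric])
  moreover have "Ck k (\<lambda>x. f x * frechet_derivative g (at x) v + frechet_derivative f (at x) v * g x)" for v
    using Suc.prems Ck_Suc_imp_Ck[OF Suc.prems(1)] Ck_Suc_imp_Ck[OF Suc.prems(2)]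
    by (intro Ck_add Suc.IH) simp_all
  ultimately show ?case using Suc.prems by simp
qed (auto intro: continuous_intros)

lemma Ck_inner: "Ck k (\<lambda>x. (x - a) \<bullet> v)"
proof (cases k)
  case (Suc j)
  have "((\<lambda>x. (x - a) \<bullet> v) has_derivative (\<lambda>h. h \<bullet> v)) (at x)" for x
    by (auto intro!: derivative_eq_intros)
  from this frechet_derivative_at[OF this]
  have "(\<lambda>x. (x - a) \<bullet> v) differentiable (at x)"
    "frechet_derivative (\<lambda>x. (x - a) \<bullet> v) (at x) = (\<lambda>h. h \<bullet> v)" for x
    by (auto simp: differentiable_def)
  then show ?thesis using Suc by (simp add: Ck_const)
qed (auto intro!: continuous_intros)

text \<open>The squared distance is a polynomial, hence smooth also at the centre. A derivative
  replaces \<open>P\<close> and adds an affine factor, so the induction leaves \<open>P\<close>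
  arbitrary.\<close>

lemma Ck_flat_exp_sphere:
  fixes a :: "'a::euclidean_space"
  shows "Ck k (\<lambda>x. flat_exp P (1 - ((x - a) \<bullet> (x - a)) / d\<^sup>2))"
proof (induction k arbitrary: P)
  have D: "((\<lambda>x. flat_exp P (1 - ((x - a) \<bullet> (x - a)) / d\<^sup>2)) has_derivative
      (\<lambda>v. flat_exp ([:0, 0, 1:] * (P - pderiv P)) (1 - ((x - a) \<bullet> (x - a)) / d\<^sup>2)
          * ((- 2 / d\<^sup>2) * ((x - a) \<bullet> v)))) (at x)" for x :: 'a and P
  proof -
    have "((\<lambda>x. 1 - ((x - a) \<bullet> (x - a)) / d\<^sup>2) has_derivative (\<lambda>v. (- 2 / d\<^sup>2) * ((x - a) \<bullet> v))) (at x)"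
    proof -
      have "((\<lambda>x. (x - a) \<bullet> (x - a)) has_derivative (\<lambda>v. 2 * ((x - a) \<bullet> v))) (at x)"
        by (auto intro!: derivative_eq_intros simp: inner_commute)
      from has_derivative_diff[OF has_derivative_const[of 1] has_derivative_mult_right[OF this, of "inverse (d\<^sup>2)"]]
      show ?thesis by (simp add: divide_inverse mult.commute mult.left_commute)
    qed
    from has_derivative_compose[OF this flat_exp_has_derivative[unfolded has_field_derivative_def]]
    show ?thesis .
  qed
  {
    case 0
    show ?case using D
      by (auto simp: continuous_on_eq_continuous_at intro!: has_derivative_continuous)
  next
    case (Suc k)
    have "Ck k (\<lambda>x. (- 2 / d\<^sup>2) * ((x - a) \<bullet> v))" for v
      by (intro Ck_mult Ck_const Ck_inner)
    from Ck_mult[OF Suc.IH this]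
    have "\<forall>v. Ck k (\<lambda>x. frechet_derivative (\<lambda>x. flat_exp P (1 - ((x - a) \<bullet> (x - a)) / d\<^sup>2)) (at x) v)"
      unfolding frechet_derivative_at[OF D, symmetric] by blast
    with D show ?case
      unfolding Ck.simps differentiable_def by blast
  }
qed

text \<open>Not normalised: all that matters is that the values lie in [0,1] and are positive
  exactly on the open ball. The profile depends on \<open>(x - a) / d\<close> only, which makes the
  family invariant under translations and dilations.\<close>

definition bump :: "'a::euclidean_space \<Rightarrow> real \<Rightarrow> 'a \<Rightarrow> real" where
  "bump a d x = flat_exp 1 (1 - ((x - a) \<bullet> (x - a)) / d\<^sup>2)"

lemma bump_nonneg: "0 \<le> bump a d x"
  by (simp add: bump_def flat_exp_def)

lemma bump_le_1: "bump a d x \<le> 1"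
  by (simp add: bump_def flat_exp_def)

lemma bump_pos_iff: "d > 0 \<Longrightarrow> 0 < bump a d x \<longleftrightarrow> dist x a < d"
proof -
  assume "d > 0"
  then have "(x - a) \<bullet> (x - a) < d\<^sup>2 \<longleftrightarrow> norm (x - a) < d"
    by (metis norm_ge_zero less_eq_real_def power2_less_imp_less power2_norm_eq_inner power_strict_mono zero_less_numeral)
  then show ?thesis using \<open>d > 0\<close>
    by (simp add: bump_def flat_exp_def dist_norm)
qed

lemma bump_eq_0_iff: "d > 0 \<Longrightarrow> bump a d x = 0 \<longleftrightarrow> d \<le> dist x a"
  using bump_pos_iff[of d a x] bump_nonneg[of a d x] by linarith

lemma bump_test_function:
  assumes "d > 0" "cball a d \<subseteq> \<Omega>"
  shows "bump a d \<in> test_functions \<Omega>"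
proof -
  have "{x. bump a d x \<noteq> 0} = ball a d"
    using assms by (auto simp: bump_eq_0_iff dist_commute)
  moreover have "Ck k (bump a d)" for k
    using Ck_flat_exp_sphere[of k 1 a d] by (simp add: bump_def[abs_def])
  ultimately show ?thesis
    using assms by (auto simp: test_functions_def)
qed

lemma bump_continuous: "continuous_on UNIV (bump a d)"
  using Ck_flat_exp_sphere[of 0 1 a d] by (simp add: bump_def[abs_def])

lemma bump_shift: "bump (a + z) d x = bump a d (x - z)"
  by (simp add: bump_def algebra_simps)

lemma bump_scale: "t > 0 \<Longrightarrow> bump (t *\<^sub>R a) (t * d) (t *\<^sub>R x) = bump a d x"
  by (simp add: bump_def power_mult_distrib scaleR_diff_right[symmetric] power2_eq_square)

subsection \<open>The kernel\<close>

text \<open>Since \<open>0 powr y = 0\<close>, the value at the singularity is 0.\<close>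

definition kern :: "real \<Rightarrow> 'a::euclidean_space \<Rightarrow> real" where
  "kern \<alpha> z = norm z powr - (real DIM('a) + \<alpha>)"

definition tkern :: "real \<Rightarrow> real \<Rightarrow> 'a::euclidean_space \<Rightarrow> real" where
  "tkern \<alpha> \<epsilon> z = indicator {z. \<epsilon> < norm z} z * kern \<alpha> z"

lemma kern_nonneg: "0 \<le> kern \<alpha> z"
  by (simp add: kern_def)

lemma kern_minus: "kern \<alpha> (- z) = kern \<alpha> z"
  by (simp add: kern_def)

lemma kern_measurable [measurable]: "kern \<alpha> \<in> borel_measurable borel"
  unfolding kern_def[abs_def] by measurable

lemma tkern_nonneg: "0 \<le> tkern \<alpha> \<epsilon> z"
  by (simp add: tkern_def kern_nonneg)

lemma tkern_minus: "tkern \<alpha> \<epsilon> (- z) = tkern \<alpha> \<epsilon> z"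
  by (simp add: tkern_def kern_minus indicator_def)

lemma tkern_measurable [measurable]: "tkern \<alpha> \<epsilon> \<in> borel_measurable borel"
  unfolding tkern_def[abs_def] by measurable

text \<open>A substitute for polar coordinates: the function is bounded on dyadic shells, and each
  shell is enlarged to a ball, whose volume is known, at the price of a constant factor.\<close>

lemma nn_integral_le_cball_sum:
  fixes f :: "'a::euclidean_space \<Rightarrow> ennreal"
  assumes c: "\<And>k::nat. 0 \<le> c k" and r: "\<And>k. 0 \<le> r k"
    and f: "\<And>z. \<exists>k. f z \<le> ennreal (c k) * indicator (cball 0 (r k)) z"
    and s: "summable (\<lambda>k. c k * r k ^ DIM('a))"
  shows "(\<integral>\<^sup>+z. f z \<partial>lborel) \<le> ennreal (unit_ball_vol DIM('a) * (\<Sum>k. c k * r k ^ DIM('a)))"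
proof -
  have [measurable]: "cball (0::'a) (r k) \<in> sets borel" for k
    by simp
  have "(\<integral>\<^sup>+z. f z \<partial>lborel) \<le> (\<integral>\<^sup>+z. (\<Sum>k. ennreal (c k) * indicator (cball 0 (r k)) (z::'a)) \<partial>lborel)"
  proof (intro nn_integral_mono)
    fix z
    obtain k where "f z \<le> ennreal (c k) * indicator (cball 0 (r k)) z" using f by blast
    also have "\<dots> = (\<Sum>k\<in>{k}. ennreal (c k) * indicator (cball 0 (r k)) z)"
      by (rule trans[OF _ sum.insert[symmetric]]) simp_all
    also have "\<dots> \<le> (\<Sum>k. ennreal (c k) * indicator (cball 0 (r k)) z)"
      by (intro sum_le_suminf) auto
    finally show "f z \<le> (\<Sum>k. ennreal (c k) * indicator (cball 0 (r k)) z)" .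
  qed
  also have "\<dots> = (\<Sum>k. \<integral>\<^sup>+z. ennreal (c k) * indicator (cball 0 (r k)) (z::'a) \<partial>lborel)"
    by (rule nn_integral_suminf) measurable
  also have "\<dots> = (\<Sum>k. ennreal (unit_ball_vol DIM('a) * (c k * r k ^ DIM('a))))"
    using c r by (intro suminf_cong, subst nn_integral_cmult_indicator)
      (auto simp: emeasure_cball ennreal_mult'[symmetric] mult.left_commute)
  also have "\<dots> = ennreal (\<Sum>k. unit_ball_vol DIM('a) * (c k * r k ^ DIM('a)))"
    using c r s by (intro suminf_ennreal2) (auto intro!: mult_nonneg_nonneg summable_mult)
  also have "(\<Sum>k. unit_ball_vol DIM('a) * (c k * r k ^ DIM('a)))
      = unit_ball_vol DIM('a) * (\<Sum>k. c k * r k ^ DIM('a))"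
    using s by (rule suminf_mult)
  finally show ?thesis .
qed

lemma ex_dyadic:
  fixes y :: real
  assumes "1 \<le> y"
  shows "\<exists>k. 2 ^ k \<le> y \<and> y \<le> 2 ^ Suc k"
proof -
  define n where "n = (LEAST n. y < 2 ^ n)"
  have "\<exists>n. y < 2 ^ n" using real_arch_pow[of 2 y] by simp
  from LeastI_ex[OF this] have n: "y < 2 ^ n" unfolding n_def .
  have "n \<noteq> 0"
  proof
    assume "n = 0"
    then show False using n assms by simp
  qed
  then obtain k where k: "n = Suc k" using not0_implies_Suc by blast
  then have "\<not> y < 2 ^ k" using not_less_Least[of k "\<lambda>n. y < 2 ^ n"] by (simp add: n_def[symmetric] k)
  then show ?thesis using n k by (intro exI[of _ k]) simp
qed

lemma integrable_integral_leI:
  assumes [measurable]: "f \<in> borel_measurable M" and "\<And>x. 0 \<le> f x" "0 \<le> c"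
    and "(\<integral>\<^sup>+x. ennreal (f x) \<partial>M) \<le> ennreal c"
  shows "integrable M f \<and> integral\<^sup>L M f \<le> c"
proof
  show "integrable M f" using assms
    by (intro integrableI_nonneg) (auto intro: le_less_trans)
  then show "integral\<^sup>L M f \<le> c" using assms
    by (subst (asm) nn_integral_eq_integral) auto
qed

text \<open>The shells between \<open>2^k R\<close> and \<open>2^(k+1) R\<close> contribute a
  geometric series with ratio \<open>2 powr (\<tau> - \<alpha>) < 1\<close>. The case \<tau> = 0
  gives the finite mass of the truncated kernel; positive \<tau> admits growing functions such as
  the barrier.\<close>

lemma kern_outer:
  assumes "0 \<le> \<tau>" "\<tau> < \<alpha>"
  shows "\<exists>C\<ge>0. \<forall>R>0. integrable lborel (\<lambda>z::'a::euclidean_space. indicator {z. R < norm z} z * norm z powr \<tau> * kern \<alpha> z)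
    \<and> (LINT z::'a|lborel. indicator {z. R < norm z} z * norm z powr \<tau> * kern \<alpha> z) \<le> C * R powr (\<tau> - \<alpha>)"
proof -
  let ?N = "DIM('a)" and ?p = "real DIM('a) + \<alpha> - \<tau>" and ?b = "2 powr (\<tau> - \<alpha>) :: real"
  have b: "0 < ?b" "?b < 1" using assms powr_less_mono[of "\<tau> - \<alpha>" 0 2] by auto
  define C where "C = unit_ball_vol ?N * 2 ^ ?N * (1 / (1 - ?b))"
  have "integrable lborel (\<lambda>z::'a. indicator {z. R < norm z} z * norm z powr \<tau> * kern \<alpha> z)
    \<and> (LINT z::'a|lborel. indicator {z. R < norm z} z * norm z powr \<tau> * kern \<alpha> z) \<le> C * R powr (\<tau> - \<alpha>)"
    if R: "R > 0" for R
  proof (rule integrable_integral_leI)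
    define c where "c k = (2 ^ k * R) powr - ?p" for k
    define r where "r k = 2 ^ Suc k * R" for k
    have eq: "c k * r k ^ ?N = 2 ^ ?N * R powr (\<tau> - \<alpha>) * ?b ^ k" for k
    proof -
      have "(2 ^ k * R) powr - ?p * (2 ^ k * R) ^ ?N = (2 ^ k * R) powr (\<tau> - \<alpha>)"
        using R by (subst powr_realpow[symmetric]) (auto simp: powr_add[symmetric])
      also have "\<dots> = (2 ^ k) powr (\<tau> - \<alpha>) * R powr (\<tau> - \<alpha>)"
        using R by (simp add: powr_mult)
      also have "(2 ^ k :: real) powr (\<tau> - \<alpha>) = ?b ^ k"
        by (simp add: powr_realpow[symmetric] powr_powr mult.commute)
      finally show ?thesis
        by (simp add: c_def r_def power_mult_distrib mult.assoc mult.left_commute mult.commute)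
    qed
    have s: "summable (\<lambda>k. c k * r k ^ ?N)" using b
      by (simp add: eq summable_mult summable_geometric)
    have "(\<integral>\<^sup>+z. ennreal (indicator {z. R < norm z} z * norm z powr \<tau> * kern \<alpha> (z::'a)) \<partial>lborel)
       \<le> ennreal (unit_ball_vol ?N * (\<Sum>k. c k * r k ^ ?N))"
    proof (rule nn_integral_le_cball_sum[OF _ _ _ s])
      fix z :: 'a
      show "\<exists>k. ennreal (indicator {z. R < norm z} z * norm z powr \<tau> * kern \<alpha> z)
          \<le> ennreal (c k) * indicator (cball 0 (r k)) z"
      proof (cases "R < norm z")
        case True
        then obtain k where k: "2 ^ k \<le> norm z / R" "norm z / R \<le> 2 ^ Suc k"
          using ex_dyadic[of "norm z / R"] R by (auto simp: field_simps)
        then have k: "2 ^ k * R \<le> norm z" "norm z \<le> r k"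
          using R by (auto simp: field_simps r_def)
        have "norm z powr \<tau> * kern \<alpha> z = norm z powr - ?p"
          by (simp add: kern_def powr_add[symmetric] algebra_simps)
        also have "\<dots> \<le> c k"
          unfolding c_def using R k assms by (intro powr_mono2') auto
        finally show ?thesis using True k
          by (intro exI[of _ k]) (auto simp: indicator_def intro!: ennreal_leI)
      qed auto
    qed (use R in \<open>auto simp: c_def r_def\<close>)
    also have "(\<Sum>k. c k * r k ^ ?N) = 2 ^ ?N * R powr (\<tau> - \<alpha>) * (1 / (1 - ?b))"
      using b by (simp add: eq suminf_mult suminf_geometric summable_geometric)
    finally show "(\<integral>\<^sup>+z. ennreal (indicator {z. R < norm z} z * norm z powr \<tau> * kern \<alpha> (z::'a)) \<partial>lborel)
       \<le> ennreal (C * R powr (\<tau> - \<alpha>))"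
      by (simp add: C_def mult_ac)
  qed (use b in \<open>auto simp: kern_nonneg C_def\<close>)
  moreover have "C \<ge> 0" using b by (auto simp: C_def)
  ultimately show ?thesis by blast
qed

text \<open>The shells now shrink towards the origin and the ratio is
  \<open>(1/2) powr (2 - \<alpha>)\<close>. This is where \<alpha> < 2 makes a quadratic bound
  strong enough against the singularity.\<close>

lemma kern_inner:
  assumes "0 < \<alpha>" "\<alpha> < 2"
  shows "\<exists>C\<ge>0. \<forall>R>0. integrable lborel (\<lambda>z::'a::euclidean_space. indicator {z. norm z \<le> R} z * (norm z)\<^sup>2 * kern \<alpha> z)
    \<and> (LINT z::'a|lborel. indicator {z. norm z \<le> R} z * (norm z)\<^sup>2 * kern \<alpha> z) \<le> C * R powr (2 - \<alpha>)"
proof -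
  let ?N = "DIM('a)" and ?p = "real DIM('a) + \<alpha>" and ?b = "(1/2) powr (2 - \<alpha>) :: real"
  have b: "0 < ?b" "?b < 1" using assms powr_less_mono2[of "2 - \<alpha>" "1/2" 1] by auto
  define C where "C = unit_ball_vol ?N * 2 powr ?p * (1 / (1 - ?b))"
  have "integrable lborel (\<lambda>z::'a. indicator {z. norm z \<le> R} z * (norm z)\<^sup>2 * kern \<alpha> z)
    \<and> (LINT z::'a|lborel. indicator {z. norm z \<le> R} z * (norm z)\<^sup>2 * kern \<alpha> z) \<le> C * R powr (2 - \<alpha>)"
    if R: "R > 0" for R
  proof (rule integrable_integral_leI)
    define r where "r k = (1/2) ^ k * R" for k
    define c where "c k = (r k)\<^sup>2 * (r k / 2) powr - ?p" for k
    have rpos: "r k > 0" for k using R by (simp add: r_def)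
    have eq: "c k * r k ^ ?N = 2 powr ?p * R powr (2 - \<alpha>) * ?b ^ k" for k
    proof -
      have "(r k)\<^sup>2 * r k powr - ?p * r k ^ ?N = r k powr (2 - \<alpha>)"
        using rpos[of k] by (simp add: powr_realpow[symmetric] powr_add[symmetric] del: powr_numeral)
      also have "\<dots> = ((1/2) ^ k) powr (2 - \<alpha>) * R powr (2 - \<alpha>)"
        using R by (simp add: powr_mult r_def)
      also have "((1/2) ^ k :: real) powr (2 - \<alpha>) = ?b ^ k"
        by (simp add: powr_realpow[symmetric] powr_powr mult.commute)
      finally have "(r k)\<^sup>2 * r k powr - ?p * r k ^ ?N = ?b ^ k * R powr (2 - \<alpha>)" .
      moreover have "(r k / 2) powr - ?p = r k powr - ?p * 2 powr ?p"
        using rpos[of k] powr_minus[of 2 ?p]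
        by (subst powr_divide) (simp only: divide_inverse inverse_inverse_eq)
      \<comment> \<open>A mere rearrangement of factors, stated for variables so that the powers
        stay opaque.\<close>
      moreover have "A * H * D = P * X * Y" if "A * B * D = Y * X" "H = B * P" for A B D H P X Y :: real
        using that by algebra
      ultimately show ?thesis
        unfolding c_def by blast
    qed
    have s: "summable (\<lambda>k. c k * r k ^ ?N)" using b
      by (simp add: eq summable_mult summable_geometric)
    have "(\<integral>\<^sup>+z. ennreal (indicator {z. norm z \<le> R} z * (norm z)\<^sup>2 * kern \<alpha> (z::'a)) \<partial>lborel)
       \<le> ennreal (unit_ball_vol ?N * (\<Sum>k. c k * r k ^ ?N))"
    proof (rule nn_integral_le_cball_sum[OF _ _ _ s])
      fix z :: 'a
      show "\<exists>k. ennreal (indicator {z. norm z \<le> R} z * (norm z)\<^sup>2 * kern \<alpha> z)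
          \<le> ennreal (c k) * indicator (cball 0 (r k)) z"
      proof (cases "norm z \<le> R \<and> z \<noteq> 0")
        case True
        then obtain k where k: "2 ^ k \<le> R / norm z" "R / norm z \<le> 2 ^ Suc k"
          using ex_dyadic[of "R / norm z"] R by (auto simp: field_simps)
        then have k: "norm z \<le> r k" "r k / 2 \<le> norm z"
          using R True by (auto simp: field_simps r_def power_one_over)
        have "(norm z)\<^sup>2 * kern \<alpha> z \<le> c k"
          unfolding c_def kern_def using rpos[of k] k assms
          by (intro mult_mono powr_mono2' power_mono) auto
        then show ?thesis using True k
          by (intro exI[of _ k]) (auto simp: indicator_def intro!: ennreal_leI)
      qed auto
    qed (use rpos less_imp_le in \<open>auto simp: c_def\<close>)
    also have "(\<Sum>k. c k * r k ^ ?N) = 2 powr ?p * R powr (2 - \<alpha>) * (1 / (1 - ?b))"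
      using b by (simp add: eq suminf_mult suminf_geometric summable_geometric)
    finally show "(\<integral>\<^sup>+z. ennreal (indicator {z. norm z \<le> R} z * (norm z)\<^sup>2 * kern \<alpha> (z::'a)) \<partial>lborel)
       \<le> ennreal (C * R powr (2 - \<alpha>))"
      by (simp add: C_def mult_ac)
  qed (use b in \<open>auto simp: kern_nonneg C_def\<close>)
  moreover have "C \<ge> 0" using b by (auto simp: C_def)
  ultimately show ?thesis by blast
qed

lemma tkern_integrable:
  assumes "0 < \<alpha>" "0 < \<epsilon>"
  shows "integrable lborel (tkern \<alpha> \<epsilon> :: 'a::euclidean_space \<Rightarrow> real)"
proof -
  have "integrable lborel (\<lambda>z::'a. indicator {z. \<epsilon> < norm z} z * norm z powr 0 * kern \<alpha> z)"
    using kern_outer[of 0 \<alpha>] assms by blast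
  also have "(\<lambda>z::'a. indicator {z. \<epsilon> < norm z} z * norm z powr 0 * kern \<alpha> z) = tkern \<alpha> \<epsilon>"
    using assms by (auto simp: tkern_def fun_eq_iff indicator_def)
  finally show ?thesis .
qed

subsection \<open>Truncated and full fractional Laplacians\<close>

lemma lborel_affine_integrable:
  fixes f :: "'a::euclidean_space \<Rightarrow> real"
  assumes c: "c \<noteq> 0" and f: "integrable lborel f"
  shows "integrable lborel (\<lambda>x. f (t + c *\<^sub>R x))"
proof -
  have [measurable]: "f \<in> borel_measurable borel" using f by auto
  have "integrable (density (distr lborel borel (\<lambda>x. t + c *\<^sub>R x)) (\<lambda>_. \<bar>c\<bar> ^ DIM('a))) f"
    using f by (subst lborel_affine[OF c, symmetric])
  then have "integrable lborel (\<lambda>x. \<bar>c\<bar> ^ DIM('a) * f (t + c *\<^sub>R x))"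
    by (subst (asm) integrable_density) (auto simp: integrable_distr_eq)
  then show ?thesis using c by simp
qed

lemma lborel_affine_integral:
  fixes f :: "'a::euclidean_space \<Rightarrow> real"
  assumes c: "c \<noteq> 0" and [measurable]: "f \<in> borel_measurable borel"
  shows "(LINT x|lborel. f x) = \<bar>c\<bar> ^ DIM('a) * (LINT x|lborel. f (t + c *\<^sub>R x))"
  by (subst lborel_affine[OF c, of t]) (auto simp: integral_density integral_distr)

lemmas lborel_shift_integral = lborel_affine_integral[of 1, simplified]

lemma lborel_reflect_integral:
  fixes f :: "'a::euclidean_space \<Rightarrow> real"
  assumes "f \<in> borel_measurable borel"
  shows "(LINT x|lborel. f x) = (LINT x|lborel. f (- x))"
  using lborel_affine_integral[of "-1" f 0] assms by simp

abbreviation second_diff :: "('a::euclidean_space \<Rightarrow> real) \<Rightarrow> 'a \<Rightarrow> 'a \<Rightarrow> real" where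
  "second_diff u x z \<equiv> u (x + z) + u (x - z) - 2 * u x"

text \<open>The sign is that of the Laplacian, so the value at a minimum is nonnegative. The factor
  \<open>frac_const\<close> is omitted and reappears as a divisor in \<open>F\<close>.\<close>

definition trunc_lap :: "real \<Rightarrow> real \<Rightarrow> ('a::euclidean_space \<Rightarrow> real) \<Rightarrow> 'a \<Rightarrow> real" where
  "trunc_lap \<alpha> \<epsilon> u x = (LINT z|lborel. (u (x + z) - u x) * tkern \<alpha> \<epsilon> z)"

text \<open>Averaging over z and -z cancels the first-order term: if second differences are
  quadratically small, the integral converges absolutely and no principal value is needed.\<close>

definition lap :: "real \<Rightarrow> ('a::euclidean_space \<Rightarrow> real) \<Rightarrow> 'a \<Rightarrow> real" where
  "lap \<alpha> u x = (LINT z|lborel. second_diff u x z * kern \<alpha> z) / 2"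

lemma integrable_bounded_times_tkern:
  fixes g :: "'a::euclidean_space \<Rightarrow> real"
  assumes "0 < \<alpha>" "0 < \<epsilon>" and [measurable]: "g \<in> borel_measurable borel" and "\<And>z. \<bar>g z\<bar> \<le> B"
  shows "integrable lborel (\<lambda>z. g z * tkern \<alpha> \<epsilon> z)"
proof (rule Bochner_Integration.integrable_bound)
  show "integrable lborel (\<lambda>z::'a. B * tkern \<alpha> \<epsilon> z)"
    using tkern_integrable assms by (intro integrable_mult_right) auto
  have "B \<ge> 0" using assms(4)[of 0] by linarith
  then show "AE z in lborel. norm (g z * tkern \<alpha> \<epsilon> z) \<le> norm (B * tkern \<alpha> \<epsilon> z)"
    using assms by (auto simp: abs_mult tkern_nonneg intro!: mult_right_mono)
qed measurable

lemma trunc_lap_integrable: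
  fixes u :: "'a::euclidean_space \<Rightarrow> real"
  assumes "0 < \<alpha>" "0 < \<epsilon>" and [measurable]: "u \<in> borel_measurable borel" and B: "\<And>z. \<bar>u z\<bar> \<le> B"
  shows "integrable lborel (\<lambda>z. (u (x + z) - u x) * tkern \<alpha> \<epsilon> z)"
proof (rule integrable_bounded_times_tkern[OF assms(1,2)])
  show "\<bar>u (x + z) - u x\<bar> \<le> 2 * B" for z
    using B[of x] B[of "x + z"] by linarith
qed measurable

lemma trunc_lap_diff:
  fixes u v :: "'a::euclidean_space \<Rightarrow> real"
  assumes "0 < \<alpha>" "0 < \<epsilon>" "u \<in> borel_measurable borel" "\<And>z. \<bar>u z\<bar> \<le> B"
    "v \<in> borel_measurable borel" "\<And>z. \<bar>v z\<bar> \<le> C"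
  shows "trunc_lap \<alpha> \<epsilon> (\<lambda>x. u x - v x) x = trunc_lap \<alpha> \<epsilon> u x - trunc_lap \<alpha> \<epsilon> v x"
  unfolding trunc_lap_def
  using trunc_lap_integrable[OF assms(1-4), of x] trunc_lap_integrable[OF assms(1,2,5,6), of x]
  by (subst Bochner_Integration.integral_diff[symmetric]) (auto simp: algebra_simps)

lemma trunc_lap_mult: "trunc_lap \<alpha> \<epsilon> (\<lambda>x. c * u x) x = c * trunc_lap \<alpha> \<epsilon> u x"
  unfolding trunc_lap_def by (simp add: right_diff_distrib[symmetric] mult.assoc)

lemma trunc_lap_measurable [measurable]:
  fixes u :: "'a::euclidean_space \<Rightarrow> real"
  assumes [measurable]: "u \<in> borel_measurable borel"
  shows "trunc_lap \<alpha> \<epsilon> u \<in> borel_measurable borel"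
  unfolding trunc_lap_def[abs_def] by measurable

lemma lap_measurable [measurable]:
  fixes u :: "'a::euclidean_space \<Rightarrow> real"
  assumes [measurable]: "u \<in> borel_measurable borel"
  shows "lap \<alpha> u \<in> borel_measurable borel"
  unfolding lap_def[abs_def] by measurable

lemma trunc_lap_symmetrize:
  fixes u :: "'a::euclidean_space \<Rightarrow> real"
  assumes "0 < \<alpha>" "0 < \<epsilon>" and [measurable]: "u \<in> borel_measurable borel" and B: "\<And>z. \<bar>u z\<bar> \<le> B"
  shows "integrable lborel (\<lambda>z. second_diff u x z * tkern \<alpha> \<epsilon> z)"
    and "trunc_lap \<alpha> \<epsilon> u x = (LINT z|lborel. second_diff u x z * tkern \<alpha> \<epsilon> z) / 2"
proof -
  note i = trunc_lap_integrable[OF assms, of x]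
  have i': "integrable lborel (\<lambda>z. (u (x - z) - u x) * tkern \<alpha> \<epsilon> z)"
    using lborel_affine_integrable[of "-1", OF _ i, of 0] by (simp add: tkern_minus)
  have e: "(LINT z|lborel. (u (x - z) - u x) * tkern \<alpha> \<epsilon> z) = trunc_lap \<alpha> \<epsilon> u x"
    unfolding trunc_lap_def by (subst lborel_reflect_integral) (simp_all add: tkern_minus)
  have s: "(\<lambda>z. second_diff u x z * tkern \<alpha> \<epsilon> z)
      = (\<lambda>z. (u (x + z) - u x) * tkern \<alpha> \<epsilon> z + (u (x - z) - u x) * tkern \<alpha> \<epsilon> z)"
    by (auto simp: fun_eq_iff algebra_simps)
  show "integrable lborel (\<lambda>z. second_diff u x z * tkern \<alpha> \<epsilon> z)"
    unfolding s using i i' by simp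
  show "trunc_lap \<alpha> \<epsilon> u x = (LINT z|lborel. second_diff u x z * tkern \<alpha> \<epsilon> z) / 2"
    unfolding s using i i' e by (simp add: trunc_lap_def)
qed

text \<open>The two operators differ by half the integral of the second difference over
  \<open>norm z \<le> \<epsilon>\<close>, which \<open>kern_inner\<close> estimates. Uniformity in x
  is what allows integration against arbitrary integrable functions later.\<close>

lemma trunc_lap_near_lap:
  fixes u :: "'a::euclidean_space \<Rightarrow> real"
  assumes \<alpha>: "0 < \<alpha>" "\<alpha> < 2" and [measurable]: "u \<in> borel_measurable borel" and B: "\<And>z. \<bar>u z\<bar> \<le> B"
    and K: "\<And>x z. \<bar>second_diff u x z\<bar> \<le> K * (norm z)\<^sup>2"
  shows "\<exists>C\<ge>0. \<forall>\<epsilon>>0. \<forall>x. \<bar>trunc_lap \<alpha> \<epsilon> u x - lap \<alpha> u x\<bar> \<le> C * \<epsilon> powr (2 - \<alpha>)"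
proof -
  obtain A where A: "A \<ge> 0" "\<And>R. R > 0 \<Longrightarrow> integrable lborel (\<lambda>z::'a. indicator {z. norm z \<le> R} z * (norm z)\<^sup>2 * kern \<alpha> z)"
    "\<And>R. R > 0 \<Longrightarrow> (LINT z::'a|lborel. indicator {z. norm z \<le> R} z * (norm z)\<^sup>2 * kern \<alpha> z) \<le> A * R powr (2 - \<alpha>)"
    using kern_inner[OF \<alpha>, where 'a='a] by blast
  \<comment> \<open>A unit vector in the quadratic bound shows that \<open>K\<close> is nonnegative,
    which is not assumed.\<close>
  obtain b :: 'a where "b \<in> Basis" using nonempty_Basis by blast
  then have "0 \<le> K" using K[of 0 b] by simp
  have "\<bar>trunc_lap \<alpha> \<epsilon> u x - lap \<alpha> u x\<bar> \<le> (K * A) * \<epsilon> powr (2 - \<alpha>)" if e: "\<epsilon> > 0" for \<epsilon> x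
  proof -
    let ?s = "\<lambda>z. u (x + z) + u (x - z) - 2 * u x"
    let ?i = "\<lambda>z. ?s z * (indicator {z. norm z \<le> \<epsilon>} z * kern \<alpha> z)"
    note i1 = trunc_lap_symmetrize[OF \<alpha>(1) e \<open>u \<in> _\<close> B, of x]
    have bd: "\<bar>?i z\<bar> \<le> K * (indicator {z. norm z \<le> \<epsilon>} z * (norm z)\<^sup>2 * kern \<alpha> z)" for z
      using mult_right_mono[OF K[of x z], of "indicator {z. norm z \<le> \<epsilon>} z * kern \<alpha> z"]
      by (simp add: abs_mult kern_nonneg mult_ac)
    have Ki: "integrable lborel (\<lambda>z::'a. K * (indicator {z. norm z \<le> \<epsilon>} z * (norm z)\<^sup>2 * kern \<alpha> z))"
      using A(2)[OF e] by (intro integrable_mult_right)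
    have i2: "integrable lborel ?i"
      by (rule Bochner_Integration.integrable_bound[OF Ki])
        (use bd \<open>0 \<le> K\<close> in \<open>auto simp: kern_nonneg abs_mult\<close>)
    have s: "(\<lambda>z. ?s z * kern \<alpha> z) = (\<lambda>z. ?s z * tkern \<alpha> \<epsilon> z + ?i z)"
      by (auto simp: fun_eq_iff tkern_def indicator_def)
    have "lap \<alpha> u x = trunc_lap \<alpha> \<epsilon> u x + integral\<^sup>L lborel ?i / 2"
      unfolding lap_def s i1(2) Bochner_Integration.integral_add[OF i1(1) i2] by (rule add_divide_distrib)
    moreover have "\<bar>integral\<^sup>L lborel ?i\<bar> \<le> (LINT z::'a|lborel. K * (indicator {z. norm z \<le> \<epsilon>} z * (norm z)\<^sup>2 * kern \<alpha> z))"
      using integral_abs_bound[of lborel ?i] integral_mono[OF integrable_abs[OF i2] Ki bd] by linarith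
    moreover have "\<dots> \<le> K * (A * \<epsilon> powr (2 - \<alpha>))"
      using A(3)[OF e] \<open>0 \<le> K\<close> by (simp add: mult_left_mono)
    moreover have "K * (A * \<epsilon> powr (2 - \<alpha>)) \<ge> 0" using A \<open>0 \<le> K\<close> by simp
    ultimately show ?thesis by (simp add: abs_le_iff)
  qed
  moreover have "K * A \<ge> 0" using A \<open>0 \<le> K\<close> by simp
  ultimately show ?thesis by blast
qed

lemma trunc_lap_tendsto_lap:
  fixes u :: "'a::euclidean_space \<Rightarrow> real"
  assumes \<alpha>: "0 < \<alpha>" "\<alpha> < 2" and "u \<in> borel_measurable borel" and "\<And>z. \<bar>u z\<bar> \<le> B"
    and "\<And>x z. \<bar>second_diff u x z\<bar> \<le> K * (norm z)\<^sup>2"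
  shows "((\<lambda>\<epsilon>. trunc_lap \<alpha> \<epsilon> u x) \<longlongrightarrow> lap \<alpha> u x) (at_right 0)"
proof -
  obtain C where C: "\<And>\<epsilon>. \<epsilon> > 0 \<Longrightarrow> \<bar>trunc_lap \<alpha> \<epsilon> u x - lap \<alpha> u x\<bar> \<le> C * \<epsilon> powr (2 - \<alpha>)"
    using trunc_lap_near_lap[OF assms] by metis
  have "((\<lambda>\<epsilon>. C * \<epsilon> powr (2 - \<alpha>)) \<longlongrightarrow> 0) (at_right 0)"
    using \<alpha> by (intro tendsto_mult_right_zero tendsto_zero_powrI[of _ _ _ "2 - \<alpha>"])
      (auto simp: eventually_at_filter intro!: tendsto_ident_at)
  then have "((\<lambda>\<epsilon>. trunc_lap \<alpha> \<epsilon> u x - lap \<alpha> u x) \<longlongrightarrow> 0) (at_right 0)"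
    by (rule Lim_null_comparison[rotated])
      (rule eventually_mono[OF eventually_at_right_less[of 0]], simp add: C)
  then show ?thesis by (simp add: LIM_zero_iff)
qed

text \<open>At truncation length 1 the finite mass of the kernel gives a bound;
  \<open>trunc_lap_near_lap\<close> transfers it to \<open>lap\<close> and from there back to all
  smaller truncation lengths.\<close>

lemma lap_bounded:
  fixes u :: "'a::euclidean_space \<Rightarrow> real"
  assumes \<alpha>: "0 < \<alpha>" "\<alpha> < 2" and [measurable]: "u \<in> borel_measurable borel" and B: "\<And>z. \<bar>u z\<bar> \<le> B"
    and K: "\<And>x z. \<bar>second_diff u x z\<bar> \<le> K * (norm z)\<^sup>2"
  shows "\<exists>C\<ge>0. (\<forall>x. \<bar>lap \<alpha> u x\<bar> \<le> C) \<and> (\<forall>\<epsilon>\<in>{0<..1}. \<forall>x. \<bar>trunc_lap \<alpha> \<epsilon> u x\<bar> \<le> C)"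
proof -
  obtain C where C: "C \<ge> 0" "\<And>\<epsilon> x. \<epsilon> > 0 \<Longrightarrow> \<bar>trunc_lap \<alpha> \<epsilon> u x - lap \<alpha> u x\<bar> \<le> C * \<epsilon> powr (2 - \<alpha>)"
    using trunc_lap_near_lap[OF assms] by metis
  let ?T = "LINT z::'a|lborel. 2 * B * tkern \<alpha> 1 z"
  have t1: "\<bar>trunc_lap \<alpha> 1 u x\<bar> \<le> ?T" for x
  proof -
    note i = trunc_lap_integrable[OF \<alpha>(1) _ \<open>u \<in> _\<close> B, of 1 x, simplified]
    have "\<bar>trunc_lap \<alpha> 1 u x\<bar> \<le> (LINT z|lborel. \<bar>(u (x + z) - u x) * tkern \<alpha> 1 z\<bar>)"
      unfolding trunc_lap_def by (rule integral_abs_bound)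
    also have "\<dots> \<le> ?T"
    proof (rule integral_mono)
      show "\<bar>(u (x + z) - u x) * tkern \<alpha> 1 z\<bar> \<le> 2 * B * tkern \<alpha> 1 z" for z
        using B[of x] B[of "x + z"] by (auto simp: abs_mult tkern_nonneg intro!: mult_right_mono)
    qed (use i tkern_integrable[OF \<alpha>(1), of 1, where 'a='a] in auto)
    finally show ?thesis .
  qed
  have t2: "\<bar>trunc_lap \<alpha> 1 u x - lap \<alpha> u x\<bar> \<le> C" for x using C(2)[of 1 x] by simp
  have l: "\<bar>lap \<alpha> u x\<bar> \<le> ?T + C" for x
    using t1[of x] t2[of x] by linarith
  have "\<bar>trunc_lap \<alpha> \<epsilon> u x\<bar> \<le> ?T + C + C" if "\<epsilon> \<in> {0<..1}" for \<epsilon> x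
  proof -
    have "\<epsilon> powr (2 - \<alpha>) \<le> 1" using that \<alpha> by (auto intro!: powr_le1)
    then have "C * \<epsilon> powr (2 - \<alpha>) \<le> C" using C(1) by (simp add: mult_left_le)
    then show ?thesis using C(2)[of \<epsilon> x] l[of x] that by auto
  qed
  moreover have "\<bar>lap \<alpha> u x\<bar> \<le> ?T + C + C" for x using l[of x] C(1) by linarith
  moreover have "?T + C + C \<ge> 0" using calculation(2)[of 0] by linarith
  ultimately show ?thesis by blast
qed

text \<open>The substitution \<open>y = x + z\<close> identifies the truncated integrals with
  \<open>- trunc_lap\<close>. As these converge, \<open>Lim\<close> denotes a genuine limit
  here.\<close>

lemma frac_laplacian_eq_lap:
  fixes u :: "'a::euclidean_space \<Rightarrow> real"
  assumes \<alpha>: "0 < \<alpha>" "\<alpha> < 2" and [measurable]: "u \<in> borel_measurable borel" and B: "\<And>z. \<bar>u z\<bar> \<le> B"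
    and K: "\<And>x z. \<bar>second_diff u x z\<bar> \<le> K * (norm z)\<^sup>2"
  shows "frac_laplacian \<alpha> u x = - frac_const DIM('a) \<alpha> * lap \<alpha> u x"
proof -
  have "(LINT y:{y. norm (x - y) > \<epsilon>}|lborel. (u x - u y) / norm (x - y) powr (real DIM('a) + \<alpha>))
      = - trunc_lap \<alpha> \<epsilon> u x" for \<epsilon>
  proof -
    define h where "h y = indicator {y. norm (x - y) > \<epsilon>} y
        *\<^sub>R ((u x - u y) / norm (x - y) powr (real DIM('a) + \<alpha>))" for y
    have [measurable]: "h \<in> borel_measurable borel" unfolding h_def[abs_def] by measurable
    have h: "h (x + z) = - ((u (x + z) - u x) * tkern \<alpha> \<epsilon> z)" for z
      unfolding h_def tkern_def kern_def powr_minus by (auto simp: indicator_def divide_inverse algebra_simps)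
    have "integral\<^sup>L lborel h = (LINT z|lborel. h (x + z))"
      by (rule lborel_shift_integral) measurable
    also have "\<dots> = - trunc_lap \<alpha> \<epsilon> u x" unfolding h trunc_lap_def by simp
    finally show ?thesis
      by (simp add: set_lebesgue_integral_def h_def[abs_def])
  qed
  then have "((\<lambda>\<epsilon>. LINT y:{y. norm (x - y) > \<epsilon>}|lborel. (u x - u y) / norm (x - y) powr (real DIM('a) + \<alpha>))
      \<longlongrightarrow> - lap \<alpha> u x) (at_right 0)"
    using tendsto_minus[OF trunc_lap_tendsto_lap[OF assms, of x]] by simp
  then show ?thesis
    unfolding frac_laplacian_def by (subst tendsto_Lim) auto
qed

lemma frac_const_pos:
  assumes "0 < \<alpha>" "\<alpha> < 2"
  shows "0 < frac_const N \<alpha>"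
proof -
  have "Gamma ((real N + \<alpha>) / 2) > 0" "Gamma (2 - \<alpha> / 2) > 0"
    using assms by (auto intro!: Gamma_real_pos)
  then show ?thesis using assms by (simp add: frac_const_def)
qed

subsection \<open>Second differences of test functions\<close>

lemma frechet_derivative_eq_0_outside:
  fixes g :: "'a::euclidean_space \<Rightarrow> real"
  assumes "closed K" "\<And>x. x \<notin> K \<Longrightarrow> g x = 0" "x \<notin> K"
  shows "frechet_derivative g (at x) = (\<lambda>v. 0)"
proof -
  have "(g has_derivative (\<lambda>v. 0)) (at x)"
    by (rule has_derivative_transform_within_open[of "\<lambda>_. 0" _ _ _ "- K"]) (use assms in auto)
  then show ?thesis using frechet_derivative_at by metis
qed

lemma continuous_outside_bounded:
  fixes g :: "'a::euclidean_space \<Rightarrow> real"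
  assumes "compact K" "\<And>x. x \<notin> K \<Longrightarrow> g x = 0" "continuous_on UNIV g"
  shows "\<exists>B\<ge>0. \<forall>x. \<bar>g x\<bar> \<le> B"
proof -
  have "bounded (g ` K)"
    using assms by (intro compact_imp_bounded compact_continuous_image) (auto intro: continuous_on_subset)
  then obtain B where "\<And>x. x \<in> K \<Longrightarrow> \<bar>g x\<bar> \<le> B" by (auto simp: bounded_iff)
  then have "\<bar>g x\<bar> \<le> max B 0" for x using assms(2)[of x] by (cases "x \<in> K") (auto simp: le_max_iff_disj)
  then show ?thesis by (intro exI[of _ "max B 0"]) auto
qed

text \<open>\<open>Ck\<close> controls one direction at a time; summing over the basis gives a bound
  uniform in the direction.\<close>

lemma linear_bound_Basis:
  fixes D :: "'a::euclidean_space \<Rightarrow> real"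
  assumes "linear D" "\<And>b. b \<in> Basis \<Longrightarrow> \<bar>D b\<bar> \<le> M b"
  shows "\<bar>D h\<bar> \<le> (\<Sum>b\<in>Basis. M b) * norm h"
proof -
  have "D h = D (\<Sum>b\<in>Basis. (h \<bullet> b) *\<^sub>R b)" by (simp add: euclidean_representation)
  also have "\<dots> = (\<Sum>b\<in>Basis. (h \<bullet> b) * D b)"
    using assms(1) by (simp add: linear_sum linear_scale)
  also have "\<bar>\<dots>\<bar> \<le> (\<Sum>b\<in>Basis. \<bar>(h \<bullet> b) * D b\<bar>)" by (rule sum_abs)
  also have "\<dots> \<le> (\<Sum>b\<in>Basis. norm h * M b)"
    using assms(2) Basis_le_norm by (intro sum_mono) (auto simp: abs_mult intro!: mult_mono)
  finally show ?thesis by (simp add: sum_distrib_left mult.commute)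
qed

lemma Ck1_Lipschitz:
  fixes g :: "'a::euclidean_space \<Rightarrow> real"
  assumes K: "compact K" "\<And>x. x \<notin> K \<Longrightarrow> g x = 0" and g: "Ck 1 g"
  shows "\<exists>L\<ge>0. \<forall>x y. \<bar>g x - g y\<bar> \<le> L * norm (x - y)"
proof -
  have "\<exists>B\<ge>0. \<forall>x. \<bar>frechet_derivative g (at x) v\<bar> \<le> B" for v
    using g frechet_derivative_eq_0_outside[OF compact_imp_closed[OF K(1)] K(2)]
    by (intro continuous_outside_bounded[OF K(1)]) auto
  then obtain M where M: "\<And>v. M v \<ge> 0" "\<And>v x. \<bar>frechet_derivative g (at x) v\<bar> \<le> M v" by metis
  have D: "(g has_derivative frechet_derivative g (at x)) (at x)" for x
    using g by (simp add: frechet_derivative_works[symmetric])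
  have "\<bar>g x - g y\<bar> \<le> (\<Sum>b\<in>Basis. M b) * norm (x - y)" for x y
  proof -
    have "norm (g x - g y) \<le> (\<Sum>b\<in>Basis. M b) * norm (x - y)"
    proof (rule differentiable_bound[of UNIV g "\<lambda>x. frechet_derivative g (at x)"])
      show "onorm (frechet_derivative g (at x)) \<le> (\<Sum>b\<in>Basis. M b)" for x
        using linear_bound_Basis[OF has_derivative_linear[OF D[of x]] M(2)] by (intro onorm_le) auto
    qed (use D in auto)
    then show ?thesis by simp
  qed
  then show ?thesis using M by (intro exI[of _ "\<Sum>b\<in>Basis. M b"]) (auto intro: sum_nonneg)
qed

text \<open>The mean value theorem for \<open>g (x + t z) + g (x - t z)\<close> as a function of t:
  its derivative compares first derivatives at two points that are \<open>2 t |z|\<close> apart, and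
  these are Lipschitz.\<close>

lemma Ck2_second_difference:
  fixes g :: "'a::euclidean_space \<Rightarrow> real"
  assumes K: "compact K" "\<And>x. x \<notin> K \<Longrightarrow> g x = 0" and g: "Ck 2 g"
  shows "\<exists>C. \<forall>x z. \<bar>second_diff g x z\<bar> \<le> C * (norm z)\<^sup>2"
proof -
  let ?D = "\<lambda>x. frechet_derivative g (at x)"
  have g': "\<And>x. g differentiable (at x)" "\<And>v. Ck 1 (\<lambda>x. ?D x v)"
    using g by (auto simp: numeral_2_eq_2)
  have D: "(g has_derivative ?D x) (at x)" for x
    using g'(1) by (simp add: frechet_derivative_works[symmetric])
  have "\<exists>L\<ge>0. \<forall>x y. \<bar>?D x v - ?D y v\<bar> \<le> L * norm (x - y)" for v
    by (rule Ck1_Lipschitz[OF K(1) _ g'(2)])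
      (simp add: frechet_derivative_eq_0_outside[OF compact_imp_closed[OF K(1)] K(2)])
  then obtain L where L: "\<And>v. L v \<ge> 0" "\<And>v x y. \<bar>?D x v - ?D y v\<bar> \<le> L v * norm (x - y)" by metis
  let ?C = "2 * (\<Sum>b\<in>Basis. L b)"
  have "\<bar>second_diff g x z\<bar> \<le> ?C * (norm z)\<^sup>2" for x z
  proof -
    let ?F = "\<lambda>t::real. g (x + t *\<^sub>R z) + g (x - t *\<^sub>R z)"
    have F': "(?F has_real_derivative (?D (x + t *\<^sub>R z) z - ?D (x - t *\<^sub>R z) z)) (at t)" for t
    proof -
      have "((\<lambda>t. x + t *\<^sub>R z) has_derivative (\<lambda>h. h *\<^sub>R z)) (at t)"
        "((\<lambda>t. x - t *\<^sub>R z) has_derivative (\<lambda>h. - h *\<^sub>R z)) (at t)"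
        by (auto intro!: derivative_eq_intros)
      note F = has_derivative_add[OF has_derivative_compose[OF this(1) D] has_derivative_compose[OF this(2) D]]
      have "?D y (h *\<^sub>R z) = h * ?D y z" for y h
        using has_derivative_linear[OF D[of y]] by (simp add: linear_scale)
      with F have "(?F has_derivative (\<lambda>h. h * ?D (x + t *\<^sub>R z) z + - h * ?D (x - t *\<^sub>R z) z)) (at t)"
        by (simp only:)
      also have "(\<lambda>h. h * ?D (x + t *\<^sub>R z) z + - h * ?D (x - t *\<^sub>R z) z)
          = (*) (?D (x + t *\<^sub>R z) z - ?D (x - t *\<^sub>R z) z)"
        by (auto simp: fun_eq_iff algebra_simps)
      finally show ?thesis
        unfolding has_field_derivative_def .
    qed
    obtain t where t: "0 < t" "t < 1" "?F 1 - ?F 0 = (1 - 0) * (?D (x + t *\<^sub>R z) z - ?D (x - t *\<^sub>R z) z)"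
      using MVT2[of 0 1 ?F, OF _ F'] by auto
    have lin: "linear (\<lambda>v. ?D (x + t *\<^sub>R z) v - ?D (x - t *\<^sub>R z) v)"
      using has_derivative_linear[OF D] by (intro linear_compose_sub) auto
    have "\<bar>?D (x + t *\<^sub>R z) z - ?D (x - t *\<^sub>R z) z\<bar>
        \<le> (\<Sum>b\<in>Basis. L b * norm ((x + t *\<^sub>R z) - (x - t *\<^sub>R z))) * norm z"
      by (rule linear_bound_Basis[OF lin L(2)])
    also have "(x + t *\<^sub>R z) - (x - t *\<^sub>R z) = (2 * t) *\<^sub>R z" using scaleR_add_left[of t t z] unfolding mult_2 by (simp only:) simp
    also have "(\<Sum>b\<in>Basis. L b * norm ((2 * t) *\<^sub>R z)) * norm z = t * (?C * (norm z)\<^sup>2)"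
      unfolding sum_distrib_right[symmetric] using t by (simp add: power2_eq_square)
    also have "\<dots> \<le> 1 * (?C * (norm z)\<^sup>2)"
      using t L(1) by (intro mult_right_mono) (auto intro!: mult_nonneg_nonneg sum_nonneg)
    finally show ?thesis using t(3) by simp
  qed
  then show ?thesis by blast
qed

lemma test_function_bounds:
  fixes \<phi> :: "'a::euclidean_space \<Rightarrow> real"
  assumes "\<phi> \<in> test_functions \<Omega>"
  obtains B K where "continuous_on UNIV \<phi>" "\<phi> \<in> borel_measurable borel" "\<And>x. \<bar>\<phi> x\<bar> \<le> B"
    "\<And>x z. \<bar>second_diff \<phi> x z\<bar> \<le> K * (norm z)\<^sup>2"
    "integrable lborel \<phi>"
proof -
  let ?K = "closure {x. \<phi> x \<noteq> 0}"
  have K: "compact ?K" and C: "\<And>k. Ck k \<phi>"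
    using assms by (auto simp: test_functions_def)
  have K: "compact ?K" "\<And>x. x \<notin> ?K \<Longrightarrow> \<phi> x = 0"
    using K closure_subset[of "{x. \<phi> x \<noteq> 0}"] by auto
  have c: "continuous_on UNIV \<phi>" using C[of 0] by simp
  moreover obtain B where "\<And>x. \<bar>\<phi> x\<bar> \<le> B" using continuous_outside_bounded[OF K c] by blast
  moreover obtain C where "\<And>x z. \<bar>second_diff \<phi> x z\<bar> \<le> C * (norm z)\<^sup>2"
    using Ck2_second_difference[OF K C[of 2]] by blast
  moreover have "integrable lborel \<phi>"
  proof -
    have "integrable lborel (\<lambda>x. indicator ?K x *\<^sub>R \<phi> x)"
      by (rule borel_integrable_compact[OF K(1) continuous_on_subset[OF c]]) simp
    also have "(\<lambda>x. indicator ?K x *\<^sub>R \<phi> x) = \<phi>"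
    proof
      show "indicator ?K x *\<^sub>R \<phi> x = \<phi> x" for x
      proof (cases "x \<in> ?K")
        case False
        from K(2)[OF this] show ?thesis by (simp only: scaleR_zero_right)
      qed (simp only: indicator_simps scaleR_one)
    qed
    finally show ?thesis .
  qed
  ultimately show ?thesis
    using that[OF c borel_measurable_continuous_onI[OF c]] by blast
qed

subsection \<open>Duality\<close>

lemma integrable_pair_bound:
  fixes f :: "'a::euclidean_space \<times> 'b::euclidean_space \<Rightarrow> real"
  assumes [measurable]: "f \<in> borel_measurable (lborel \<Otimes>\<^sub>M lborel)"
    and g: "integrable lborel g" and k: "integrable lborel k"
    and b: "\<And>x y. \<bar>f (x, y)\<bar> \<le> g x * k y"
  shows "integrable (lborel \<Otimes>\<^sub>M lborel) f"
proof (rule Bochner_Integration.integrable_bound)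
  have [measurable]: "g \<in> borel_measurable borel" "k \<in> borel_measurable borel" using g k by auto
  show "integrable (lborel \<Otimes>\<^sub>M lborel) (\<lambda>(x, y). g x * k y)"
    using g k by (intro lborel_pair.Fubini_integrable) (auto simp: abs_mult integrable_abs integrable_mult_left)
  have "0 \<le> g x * k y" for x y using b[of x y] by linarith
  then show "AE p in lborel \<Otimes>\<^sub>M lborel. norm (f p) \<le> norm (case p of (x, y) \<Rightarrow> g x * k y)"
    using b by (auto simp: split_beta)
qed measurable

lemma integrable_times_bounded:
  fixes v \<phi> :: "'a::euclidean_space \<Rightarrow> real"
  assumes v: "integrable lborel v" and [measurable]: "\<phi> \<in> borel_measurable borel" and B: "\<And>x. \<bar>\<phi> x\<bar> \<le> B"
  shows "integrable lborel (\<lambda>x. v x * \<phi> x)"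
proof (rule Bochner_Integration.integrable_bound[of _ "\<lambda>x. v x * B"])
  have [measurable]: "v \<in> borel_measurable borel" using v by auto
  show "(\<lambda>x. v x * \<phi> x) \<in> borel_measurable lborel" by measurable
  have "0 \<le> B" using B[of 0] by linarith
  then show "AE x in lborel. norm (v x * \<phi> x) \<le> norm (v x * B)"
    using B by (auto simp: abs_mult intro!: mult_left_mono)
qed (use v in auto)

text \<open>The truncated kernel is integrable, so Fubini applies to the double integral. This one
  identity yields both the symmetry of the operator and its action on mollified functions.\<close>

lemma trunc_lap_Fubini:
  fixes v \<phi> :: "'a::euclidean_space \<Rightarrow> real"
  assumes \<alpha>: "0 < \<alpha>" and e: "0 < \<epsilon>" and v: "integrable lborel v"
    and \<phi>[measurable]: "\<phi> \<in> borel_measurable borel" and B: "\<And>x. \<bar>\<phi> x\<bar> \<le> B"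
  shows "(LINT z|lborel. ((LINT y|lborel. v y * \<phi> (y - z)) - (LINT y|lborel. v y * \<phi> y)) * tkern \<alpha> \<epsilon> z)
    = (LINT y|lborel. v y * trunc_lap \<alpha> \<epsilon> \<phi> y)"
proof -
  have [measurable]: "v \<in> borel_measurable borel" using v by auto
  let ?h = "\<lambda>y z. v y * (\<phi> (y - z) - \<phi> y) * tkern \<alpha> \<epsilon> z"
  have "\<bar>\<phi> (y - z) - \<phi> y\<bar> \<le> 2 * B" for y z using B[of "y - z"] B[of y] by linarith
  then have b: "\<bar>?h y z\<bar> \<le> (\<bar>v y\<bar> * (2 * B)) * tkern \<alpha> \<epsilon> z" for y z
    by (auto simp: abs_mult tkern_nonneg intro!: mult_left_mono mult_right_mono)
  have i: "integrable (lborel \<Otimes>\<^sub>M lborel) (case_prod ?h)"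
  proof (rule integrable_pair_bound[of _ "\<lambda>y. \<bar>v y\<bar> * (2 * B)" "tkern \<alpha> \<epsilon>"])
    show "case_prod ?h \<in> borel_measurable (lborel \<Otimes>\<^sub>M lborel)" by measurable
    show "integrable lborel (\<lambda>y. \<bar>v y\<bar> * (2 * B))" using v by (intro integrable_mult_left integrable_abs)
  qed (use b tkern_integrable[OF \<alpha> e] in auto)
  have f1: "(LINT y|lborel. ?h y z) = ((LINT y|lborel. v y * \<phi> (y - z)) - (LINT y|lborel. v y * \<phi> y)) * tkern \<alpha> \<epsilon> z" for z
  proof -
    have "integrable lborel (\<lambda>y. v y * \<phi> (y - z))" "integrable lborel (\<lambda>y. v y * \<phi> y)"
      using B by (auto intro!: integrable_times_bounded[OF v])
    then show ?thesis by (simp add: right_diff_distrib)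
  qed
  have f2: "(LINT z|lborel. ?h y z) = v y * trunc_lap \<alpha> \<epsilon> \<phi> y" for y
  proof -
    have "(LINT z|lborel. ?h y z) = v y * (LINT z|lborel. (\<phi> (y - z) - \<phi> y) * tkern \<alpha> \<epsilon> z)"
      by (simp add: mult.assoc)
    also have "(LINT z|lborel. (\<phi> (y - z) - \<phi> y) * tkern \<alpha> \<epsilon> z) = trunc_lap \<alpha> \<epsilon> \<phi> y"
      unfolding trunc_lap_def by (subst lborel_reflect_integral) (simp_all add: tkern_minus)
    finally show ?thesis .
  qed
  show ?thesis
    using lborel_pair.Fubini_integral[OF i] by (simp only: f1 f2)
qed

text \<open>Correlating \<open>u\<close> with the translate of \<open>\<phi>\<close> by z is
  correlating \<open>\<phi>\<close> with the translate of \<open>u\<close> by -z, and the kernel is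
  even.\<close>

lemma trunc_lap_symmetric:
  fixes u \<phi> :: "'a::euclidean_space \<Rightarrow> real"
  assumes \<alpha>: "0 < \<alpha>" and e: "0 < \<epsilon>" and u: "integrable lborel u" "\<And>x. \<bar>u x\<bar> \<le> A"
    and \<phi>: "integrable lborel \<phi>" "\<And>x. \<bar>\<phi> x\<bar> \<le> B"
  shows "(LINT x|lborel. u x * trunc_lap \<alpha> \<epsilon> \<phi> x) = (LINT x|lborel. \<phi> x * trunc_lap \<alpha> \<epsilon> u x)"
proof -
  have m[measurable]: "u \<in> borel_measurable borel" "\<phi> \<in> borel_measurable borel" using u \<phi> by auto
  let ?P = "\<lambda>z. ((LINT y|lborel. u y * \<phi> (y - z)) - (LINT y|lborel. u y * \<phi> y)) * tkern \<alpha> \<epsilon> z"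
  let ?Q = "\<lambda>z. ((LINT y|lborel. \<phi> y * u (y - z)) - (LINT y|lborel. \<phi> y * u y)) * tkern \<alpha> \<epsilon> z"
  have "(LINT y|lborel. u y * \<phi> (y - z)) = (LINT y|lborel. \<phi> y * u (y - (- z)))" for z
    by (subst lborel_shift_integral[of _ z]) (simp_all add: add.commute mult.commute)
  then have "?P z = ?Q (- z)" for z by (simp add: tkern_minus mult.commute)
  then have "(LINT z|lborel. ?P z) = (LINT z|lborel. ?Q (- z))" by simp
  also have "\<dots> = (LINT z|lborel. ?Q z)"
    by (rule lborel_reflect_integral[symmetric]) measurable
  finally show ?thesis
    using trunc_lap_Fubini[OF \<alpha> e u(1) m(2) \<phi>(2)] trunc_lap_Fubini[OF \<alpha> e \<phi>(1) m(1) u(2)] by simp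
qed

text \<open>The constant depends on \<open>\<phi>\<close> but not on \<open>v\<close>. This order of
  quantifiers is essential for the limit, where the function changes together with
  \<epsilon>.\<close>

lemma weak_trunc_lap_near_lap:
  fixes \<phi> :: "'a::euclidean_space \<Rightarrow> real"
  assumes \<alpha>: "0 < \<alpha>" "\<alpha> < 2"
    and \<phi>[measurable]: "\<phi> \<in> borel_measurable borel" and B: "\<And>x. \<bar>\<phi> x\<bar> \<le> B"
    and K: "\<And>x z. \<bar>second_diff \<phi> x z\<bar> \<le> K * (norm z)\<^sup>2"
  shows "\<exists>C\<ge>0. \<forall>v \<epsilon>. integrable lborel v \<longrightarrow> 0 < \<epsilon> \<longrightarrow> \<epsilon> \<le> 1 \<longrightarrow>
    \<bar>(LINT x|lborel. v x * trunc_lap \<alpha> \<epsilon> \<phi> x) - (LINT x|lborel. v x * lap \<alpha> \<phi> x)\<bar>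
      \<le> C * \<epsilon> powr (2 - \<alpha>) * (LINT x|lborel. \<bar>v x\<bar>)"
proof -
  obtain D where D: "\<And>x. \<bar>lap \<alpha> \<phi> x\<bar> \<le> D" "\<And>\<epsilon> x. \<epsilon> \<in> {0<..1} \<Longrightarrow> \<bar>trunc_lap \<alpha> \<epsilon> \<phi> x\<bar> \<le> D"
    using lap_bounded[OF \<alpha> \<phi> B K] by blast
  obtain C where C: "C \<ge> 0" "\<And>\<epsilon> x. \<epsilon> > 0 \<Longrightarrow> \<bar>trunc_lap \<alpha> \<epsilon> \<phi> x - lap \<alpha> \<phi> x\<bar> \<le> C * \<epsilon> powr (2 - \<alpha>)"
    using trunc_lap_near_lap[OF \<alpha> \<phi> B K] by metis
  have "\<bar>(LINT x|lborel. v x * trunc_lap \<alpha> \<epsilon> \<phi> x) - (LINT x|lborel. v x * lap \<alpha> \<phi> x)\<bar>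
      \<le> C * \<epsilon> powr (2 - \<alpha>) * (LINT x|lborel. \<bar>v x\<bar>)"
    if v: "integrable lborel v" and e: "0 < \<epsilon>" "\<epsilon> \<le> 1" for v :: "'a \<Rightarrow> real" and \<epsilon>
  proof -
    have i: "integrable lborel (\<lambda>x. v x * trunc_lap \<alpha> \<epsilon> \<phi> x)" "integrable lborel (\<lambda>x. v x * lap \<alpha> \<phi> x)"
      using D e by (auto intro!: integrable_times_bounded[OF v])
    have i': "integrable lborel (\<lambda>x. C * \<epsilon> powr (2 - \<alpha>) * \<bar>v x\<bar>)"
      using v by (intro integrable_mult_right integrable_abs)
    have "\<bar>(LINT x|lborel. v x * trunc_lap \<alpha> \<epsilon> \<phi> x) - (LINT x|lborel. v x * lap \<alpha> \<phi> x)\<bar>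
        = \<bar>LINT x|lborel. v x * trunc_lap \<alpha> \<epsilon> \<phi> x - v x * lap \<alpha> \<phi> x\<bar>"
      using i by simp
    also have "\<dots> \<le> (LINT x|lborel. \<bar>v x * trunc_lap \<alpha> \<epsilon> \<phi> x - v x * lap \<alpha> \<phi> x\<bar>)"
      by (rule integral_abs_bound)
    also have "\<dots> \<le> (LINT x|lborel. C * \<epsilon> powr (2 - \<alpha>) * \<bar>v x\<bar>)"
    proof (rule integral_mono[OF integrable_abs[OF Bochner_Integration.integrable_diff[OF i]] i'])
      show "\<bar>v x * trunc_lap \<alpha> \<epsilon> \<phi> x - v x * lap \<alpha> \<phi> x\<bar> \<le> C * \<epsilon> powr (2 - \<alpha>) * \<bar>v x\<bar>" for x
        using mult_right_mono[OF C(2)[OF e(1), of x] abs_ge_zero[of "v x"]]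
        by (simp add: abs_mult[symmetric] right_diff_distrib mult.commute)
    qed
    finally show ?thesis by simp
  qed
  with C(1) show ?thesis by blast
qed

subsection \<open>Mollification\<close>

text \<open>Convolution with a normalised bump. As the bump is even, it can be centred at x and read
  as a test function.\<close>

definition mollify :: "('a::euclidean_space \<Rightarrow> real) \<Rightarrow> real \<Rightarrow> 'a \<Rightarrow> real" where
  "mollify v d x = (LINT y|lborel. v y * bump x d y) / (LINT y::'a|lborel. bump 0 d y)"

lemma bump_measurable [measurable]: "bump a d \<in> borel_measurable borel"
  using bump_continuous by (rule borel_measurable_continuous_onI)

lemma bump_abs_le_1: "\<bar>bump a d x\<bar> \<le> 1"
  using bump_nonneg[of a d x] bump_le_1[of a d x] by simp

lemma bump_integrable: "0 < d \<Longrightarrow> integrable lborel (bump a d)"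
  using test_function_bounds[OF bump_test_function[of d a UNIV]] by auto

lemma bump_integral_shift:
  fixes a :: "'a::euclidean_space"
  shows "(LINT y|lborel. bump a d y) = (LINT y::'a|lborel. bump 0 d y)"
proof -
  have "bump a d (a + y) = bump 0 d y" for y by (simp add: bump_def)
  then show ?thesis using lborel_shift_integral[OF bump_measurable, of a d a] by simp
qed

lemma bump_integral_pos:
  assumes "0 < d"
  shows "0 < (LINT y::'a::euclidean_space|lborel. bump 0 d y)"
proof (rule ccontr)
  assume "\<not> ?thesis"
  moreover have "0 \<le> (LINT y::'a|lborel. bump 0 d y)"
    by (intro integral_nonneg_AE) (simp add: bump_nonneg)
  ultimately have "(LINT y::'a|lborel. bump 0 d y) = 0" by linarith
  then have "AE y::'a in lborel. bump 0 d y = 0"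
    using bump_integrable[OF assms] by (subst (asm) integral_nonneg_eq_0_iff_AE) (auto simp: bump_nonneg)
  moreover have "{y::'a. bump 0 d y \<noteq> 0} = ball 0 d"
    using assms by (auto simp: bump_eq_0_iff)
  ultimately have "emeasure lborel (ball (0::'a) d) = 0"
    by (subst (asm) AE_iff_measurable[OF _ refl]) auto
  then show False
    using assms unit_ball_vol_pos[of "DIM('a)"] by (simp add: emeasure_ball)
qed

lemma mollify_eq_shift:
  fixes v :: "'a::euclidean_space \<Rightarrow> real"
  assumes [measurable]: "v \<in> borel_measurable borel"
  shows "mollify v d x = (LINT y|lborel. v (x + y) * bump 0 d y) / (LINT y::'a|lborel. bump 0 d y)"
proof -
  have "bump x d (x + y) = bump 0 d y" for y by (simp add: bump_def)
  then have "(LINT y|lborel. v y * bump x d y) = (LINT y|lborel. v (x + y) * bump 0 d y)"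
    by (subst lborel_shift_integral[of _ x]) simp_all
  then show ?thesis by (simp add: mollify_def)
qed

lemma bump_average_le:
  fixes h :: "'a::euclidean_space \<Rightarrow> real"
  assumes d: "0 < d" and [measurable]: "h \<in> borel_measurable borel" and B: "\<And>x. \<bar>h x\<bar> \<le> B"
    and c: "\<And>z. dist z a < d \<Longrightarrow> h z \<le> c"
  shows "(LINT y|lborel. h y * bump a d y) \<le> c * (LINT y::'a|lborel. bump 0 d y)"
proof -
  have "(LINT y|lborel. h y * bump a d y) \<le> (LINT y|lborel. c * bump a d y)"
  proof (rule integral_mono)
    show "integrable lborel (\<lambda>y. h y * bump a d y)"
      using integrable_times_bounded[OF bump_integrable[OF d, of a], of h B] B by (simp add: mult.commute)
    show "integrable lborel (\<lambda>y. c * bump a d y)"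
      using bump_integrable[OF d, of a] by simp
    show "h y * bump a d y \<le> c * bump a d y" for y
      using c[of y] bump_eq_0_iff[OF d, of a y] bump_nonneg[of a d y]
      by (cases "dist y a < d") (auto intro: mult_right_mono)
  qed
  also have "\<dots> = c * (LINT y::'a|lborel. bump 0 d y)" by (simp add: bump_integral_shift[of a d])
  finally show ?thesis .
qed

lemma bump_average_abs_le:
  fixes h :: "'a::euclidean_space \<Rightarrow> real"
  assumes d: "0 < d" and [measurable]: "h \<in> borel_measurable borel" and B: "\<And>x. \<bar>h x\<bar> \<le> B"
    and c: "\<And>z. dist z a < d \<Longrightarrow> \<bar>h z\<bar> \<le> c"
  shows "\<bar>LINT y|lborel. h y * bump a d y\<bar> \<le> c * (LINT y::'a|lborel. bump 0 d y)"
proof -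
  have 1: "(LINT y|lborel. h y * bump a d y) \<le> c * (LINT y::'a|lborel. bump 0 d y)"
    using c by (intro bump_average_le[OF d _ B]) (auto simp: abs_le_iff)
  have "(LINT y|lborel. - h y * bump a d y) \<le> c * (LINT y::'a|lborel. bump 0 d y)"
    using c B by (intro bump_average_le[OF d]) (auto simp: abs_le_iff)
  with 1 show ?thesis by (simp add: abs_le_iff)
qed

text \<open>After a shift the dependence on the point sits in \<open>v\<close> alone, so a modulus
  of continuity is inherited without differentiating the bump.\<close>

lemma mollify_diff_le:
  fixes v :: "'a::euclidean_space \<Rightarrow> real"
  assumes d: "0 < d" and [measurable]: "v \<in> borel_measurable borel" and B: "\<And>x. \<bar>v x\<bar> \<le> B"
    and c: "\<And>z. \<bar>v (x + z) - v (y + z)\<bar> \<le> c"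
  shows "\<bar>mollify v d x - mollify v d y\<bar> \<le> c"
proof -
  let ?I = "LINT y::'a|lborel. bump 0 d y"
  have i: "integrable lborel (\<lambda>z. v (x + z) * bump 0 d z)" for x
    using integrable_times_bounded[OF bump_integrable[OF d, of 0], of "\<lambda>z. v (x + z)" B] B
    by (simp add: mult.commute)
  have "\<bar>LINT z|lborel. (v (x + z) - v (y + z)) * bump 0 d z\<bar> \<le> c * ?I"
    by (rule bump_average_abs_le[OF d _ c c]) measurable
  then have "\<bar>(LINT z|lborel. v (x + z) * bump 0 d z) - (LINT z|lborel. v (y + z) * bump 0 d z)\<bar> \<le> c * ?I"
    using i by (simp add: left_diff_distrib)
  then show ?thesis
    using bump_integral_pos[OF d, where 'a='a]
    by (simp add: mollify_eq_shift diff_divide_distrib[symmetric] abs_divide pos_divide_le_eq)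
qed

lemma mollify_near:
  fixes v :: "'a::euclidean_space \<Rightarrow> real"
  assumes d: "0 < d" and [measurable]: "v \<in> borel_measurable borel" and B: "\<And>x. \<bar>v x\<bar> \<le> B"
    and c: "\<And>z. dist z x < d \<Longrightarrow> \<bar>v z - a\<bar> \<le> c"
  shows "\<bar>mollify v d x - a\<bar> \<le> c"
proof -
  let ?I = "LINT y::'a|lborel. bump 0 d y"
  have i: "integrable lborel (\<lambda>z. v z * bump x d z)"
    using integrable_times_bounded[OF bump_integrable[OF d, of x], of v B] B
    by (simp add: mult.commute)
  have B': "\<bar>v y - a\<bar> \<le> B + \<bar>a\<bar>" for y using B[of y] by linarith
  have "\<bar>LINT z|lborel. (v z - a) * bump x d z\<bar> \<le> c * ?I"
    by (rule bump_average_abs_le[OF d _ B' c]) auto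
  then have "\<bar>(LINT z|lborel. v z * bump x d z) - a * ?I\<bar> \<le> c * ?I"
    using i bump_integrable[OF d, of x] by (simp add: left_diff_distrib bump_integral_shift[of x d])
  moreover have "mollify v d x - a = ((LINT z|lborel. v z * bump x d z) - a * ?I) / ?I"
    using bump_integral_pos[OF d, where 'a='a] by (simp add: mollify_def field_simps)
  ultimately show ?thesis
    using bump_integral_pos[OF d, where 'a='a] by (simp add: abs_divide pos_divide_le_eq)
qed

text \<open>The right-hand side is a truncated weak form tested with \<open>bump x d\<close>.
  Letting \<epsilon> tend to 0 therefore turns the weak equation for \<open>v\<close> into pointwise
  information on its mollification.\<close>

lemma trunc_lap_mollify:
  fixes v :: "'a::euclidean_space \<Rightarrow> real"
  assumes \<alpha>: "0 < \<alpha>" and e: "0 < \<epsilon>" and v: "integrable lborel v"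
  shows "trunc_lap \<alpha> \<epsilon> (mollify v d) x
    = (LINT y|lborel. v y * trunc_lap \<alpha> \<epsilon> (bump x d) y) / (LINT y::'a|lborel. bump 0 d y)"
proof -
  have "trunc_lap \<alpha> \<epsilon> (mollify v d) x
    = (LINT z|lborel. ((LINT y|lborel. v y * bump x d (y - z)) - (LINT y|lborel. v y * bump x d y))
        * tkern \<alpha> \<epsilon> z / (LINT y::'a|lborel. bump 0 d y))"
    by (simp only: trunc_lap_def mollify_def bump_shift diff_divide_distrib[symmetric] times_divide_eq_left)
  also have "\<dots> = (LINT y|lborel. v y * trunc_lap \<alpha> \<epsilon> (bump x d) y) / (LINT y::'a|lborel. bump 0 d y)"
    using trunc_lap_Fubini[OF \<alpha> e v bump_measurable bump_abs_le_1] by simp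
  finally show ?thesis .
qed

subsection \<open>A strong minimum principle for the weak equation\<close>

text \<open>On a ball beyond the truncation length the kernel is at least its value at the largest
  distance \<open>R\<close>.\<close>

lemma integral_tkern_ball_ge:
  fixes a x :: "'a::euclidean_space"
  assumes \<alpha>: "0 < \<alpha>" and e: "0 < \<epsilon>" and r: "\<And>y. y \<in> ball a r \<Longrightarrow> \<epsilon> < norm (y - x) \<and> norm (y - x) \<le> R"
  shows "measure lborel (ball a r) * R powr - (real DIM('a) + \<alpha>)
    \<le> (LINT z|lborel. indicator (ball a r) (x + z) * tkern \<alpha> \<epsilon> z)"
proof -
  let ?c = "R powr - (real DIM('a) + \<alpha>)"
  have m[measurable]: "ball a r \<in> sets borel" by simp
  have i0: "integrable lborel (\<lambda>y. indicator (ball a r) y * ?c)"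
    by (intro integrable_mult_left integrable_real_indicator) (simp_all add: emeasure_lborel_ball_finite[unfolded infinity_ennreal_def])
  from lborel_affine_integrable[OF _ i0, of 1 x]
  have i: "integrable lborel (\<lambda>z. indicator (ball a r) (x + z) * ?c)" by simp
  have "(LINT y|lborel. indicator (ball a r) y * ?c) = (LINT z|lborel. indicator (ball a r) (x + z) * ?c)"
    by (subst lborel_shift_integral[of _ x]) simp_all
  then have "measure lborel (ball a r) * ?c = (LINT z|lborel. indicator (ball a r) (x + z) * ?c)"
    by simp
  also have "\<dots> \<le> (LINT z|lborel. indicator (ball a r) (x + z) * tkern \<alpha> \<epsilon> z)"
  proof (rule integral_mono[OF i])
    show "integrable lborel (\<lambda>z. indicator (ball a r) (x + z) * tkern \<alpha> \<epsilon> z)"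
      by (rule integrable_bounded_times_tkern[OF \<alpha> e, of _ 1]) auto
    show "indicator (ball a r) (x + z) * ?c \<le> indicator (ball a r) (x + z) * tkern \<alpha> \<epsilon> z" for z
    proof (cases "x + z \<in> ball a r")
      case True
      with r[of "x + z"] e \<alpha> have "?c \<le> norm z powr - (real DIM('a) + \<alpha>)"
        by (intro powr_mono2') auto
      with True r[of "x + z"] show ?thesis by (simp add: tkern_def kern_def)
    qed simp
  qed
  finally show ?thesis .
qed

lemma weak_trunc_lap_tendsto:
  fixes v \<phi> :: "'a::euclidean_space \<Rightarrow> real"
  assumes \<alpha>: "0 < \<alpha>" "\<alpha> < 2" and v: "integrable lborel v"
    and \<phi>: "\<phi> \<in> borel_measurable borel" "\<And>x. \<bar>\<phi> x\<bar> \<le> B"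
    "\<And>x z. \<bar>second_diff \<phi> x z\<bar> \<le> K * (norm z)\<^sup>2"
  shows "((\<lambda>\<epsilon>. LINT x|lborel. v x * trunc_lap \<alpha> \<epsilon> \<phi> x) \<longlongrightarrow> (LINT x|lborel. v x * lap \<alpha> \<phi> x)) (at_right 0)"
proof -
  let ?V = "LINT x|lborel. \<bar>v x\<bar>"
  obtain C where C: "\<And>\<epsilon>. 0 < \<epsilon> \<Longrightarrow> \<epsilon> \<le> 1 \<Longrightarrow>
    \<bar>(LINT x|lborel. v x * trunc_lap \<alpha> \<epsilon> \<phi> x) - (LINT x|lborel. v x * lap \<alpha> \<phi> x)\<bar> \<le> C * \<epsilon> powr (2 - \<alpha>) * ?V"
    using weak_trunc_lap_near_lap[OF \<alpha> \<phi>] v by blast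
  have "((\<lambda>\<epsilon>. C * \<epsilon> powr (2 - \<alpha>) * ?V) \<longlongrightarrow> 0) (at_right 0)"
    using \<alpha> by (intro tendsto_mult_left_zero tendsto_mult_right_zero tendsto_zero_powrI[of _ _ _ "2 - \<alpha>"])
      (auto simp: eventually_at_filter intro!: tendsto_ident_at)
  moreover have "\<forall>\<^sub>F \<epsilon> in at_right 0. norm ((LINT x|lborel. v x * trunc_lap \<alpha> \<epsilon> \<phi> x) - (LINT x|lborel. v x * lap \<alpha> \<phi> x))
      \<le> C * \<epsilon> powr (2 - \<alpha>) * ?V"
    unfolding eventually_at_right_field
    by (intro exI[of _ 1]) (auto intro!: C)
  ultimately have "((\<lambda>\<epsilon>. (LINT x|lborel. v x * trunc_lap \<alpha> \<epsilon> \<phi> x) - (LINT x|lborel. v x * lap \<alpha> \<phi> x)) \<longlongrightarrow> 0) (at_right 0)"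
    by (rule Lim_null_comparison[rotated])
  then show ?thesis by (simp add: LIM_zero_iff)
qed

text \<open>At a global minimum every increment is nonnegative, so all of the integral except the
  part over the ball can be discarded.\<close>

lemma trunc_lap_ge_ball:
  fixes F :: "'a::euclidean_space \<Rightarrow> real"
  assumes \<alpha>: "0 < \<alpha>" and e: "0 < \<epsilon>" and F: "F \<in> borel_measurable borel" "\<And>y. \<bar>F y\<bar> \<le> B"
    and min: "\<And>y. F x \<le> F y" and m: "0 \<le> m" "\<And>y. y \<in> ball a r \<Longrightarrow> F x + m \<le> F y"
    and r: "\<And>y. y \<in> ball a r \<Longrightarrow> \<epsilon> < norm (y - x) \<and> norm (y - x) \<le> R"
  shows "m * (measure lborel (ball a r) * R powr - (real DIM('a) + \<alpha>)) \<le> trunc_lap \<alpha> \<epsilon> F x"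
proof -
  have [measurable]: "ball a r \<in> sets borel" by simp
  have "m * (measure lborel (ball a r) * R powr - (real DIM('a) + \<alpha>))
      \<le> m * (LINT z|lborel. indicator (ball a r) (x + z) * tkern \<alpha> \<epsilon> z)"
    using integral_tkern_ball_ge[OF \<alpha> e r] m(1) by (rule mult_left_mono)
  also have "\<dots> = (LINT z|lborel. m * (indicator (ball a r) (x + z) * tkern \<alpha> \<epsilon> z))" by simp
  also have "\<dots> \<le> trunc_lap \<alpha> \<epsilon> F x"
    unfolding trunc_lap_def
  proof (rule integral_mono)
    have "integrable lborel (\<lambda>z. indicator (ball a r) (x + z) * tkern \<alpha> \<epsilon> z)"
      by (rule integrable_bounded_times_tkern[OF \<alpha> e, of _ 1]) auto
    then show "integrable lborel (\<lambda>z. m * (indicator (ball a r) (x + z) * tkern \<alpha> \<epsilon> z))" by simp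
    show "integrable lborel (\<lambda>z. (F (x + z) - F x) * tkern \<alpha> \<epsilon> z)"
      by (rule trunc_lap_integrable[OF \<alpha> e F])
    fix z
    have "m * indicator (ball a r) (x + z) \<le> F (x + z) - F x"
      using m(2)[of "x + z"] min[of "x + z"] by (auto simp: indicator_def)
    from mult_right_mono[OF this tkern_nonneg]
    show "m * (indicator (ball a r) (x + z) * tkern \<alpha> \<epsilon> z) \<le> (F (x + z) - F x) * tkern \<alpha> \<epsilon> z"
      by (simp add: mult.assoc)
  qed
  finally show ?thesis .
qed

lemma compact_support_integrable:
  fixes v :: "'a::euclidean_space \<Rightarrow> real"
  assumes v: "continuous_on UNIV v" and K: "compact K" "\<And>x. x \<notin> K \<Longrightarrow> v x = 0"
  shows "integrable lborel v"
proof -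
  have "integrable lborel (\<lambda>x. indicator K x *\<^sub>R v x)"
    by (rule borel_integrable_compact[OF K(1) continuous_on_subset[OF v]]) simp
  also have "(\<lambda>x. indicator K x *\<^sub>R v x) = v" using K(2) by (auto simp: indicator_def fun_eq_iff)
  finally show ?thesis .
qed

lemma compact_support_uniform:
  fixes v :: "'a::euclidean_space \<Rightarrow> real"
  assumes v: "continuous_on UNIV v" and K: "compact K" "\<And>x. x \<notin> K \<Longrightarrow> v x = 0" and e: "0 < e"
  shows "\<exists>d>0. \<forall>x y. dist x y < d \<longrightarrow> \<bar>v x - v y\<bar> < e"
proof -
  obtain R where R: "\<And>x. x \<in> K \<Longrightarrow> norm x \<le> R" using compact_imp_bounded[OF K(1)] by (auto simp: bounded_iff)
  \<comment> \<open>The margin 1 places both points in this ball as soon as one of them is in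
    \<open>K\<close> and their distance is below 1.\<close>
  have "uniformly_continuous_on (cball 0 (R + 1)) v"
    using v by (intro compact_uniformly_continuous) (auto intro: continuous_on_subset)
  then obtain d where d: "d > 0" "\<And>x y. x \<in> cball 0 (R + 1) \<Longrightarrow> y \<in> cball 0 (R + 1) \<Longrightarrow> dist x y < d \<Longrightarrow> \<bar>v x - v y\<bar> < e"
    using e unfolding uniformly_continuous_on_def dist_real_def by (meson dist_commute_lessI)
  have "\<bar>v x - v y\<bar> < e" if "dist x y < min d 1" for x y
  proof (cases "x \<in> K \<or> y \<in> K")
    case True
    moreover have "norm x \<le> norm y + dist x y" "norm y \<le> norm x + dist x y"
      using norm_triangle_sub[of x y] norm_triangle_sub[of y x] by (simp_all add: dist_norm norm_minus_commute)
    ultimately show ?thesis using that R[of x] R[of y] by (intro d(2)) auto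
  next
    case False
    then show ?thesis using K(2) e by simp
  qed
  with d(1) show ?thesis by (intro exI[of _ "min d 1"]) auto
qed

text \<open>Mollification makes the equation pointwise; a small bump at the minimum point moves the
  minimum of the mollified function into the region where the equation is available.\<close>

lemma strong_min_principle:
  fixes v g :: "'a::euclidean_space \<Rightarrow> real"
  assumes \<alpha>: "0 < \<alpha>" "\<alpha> < 2"
    and v: "continuous_on UNIV v" and K: "compact K" "\<And>x. x \<notin> K \<Longrightarrow> v x = 0"
    and g: "continuous_on UNIV g"
    and U: "open U" "x0 \<in> U"
    and min: "\<And>x. v x0 \<le> v x" and g0: "g x0 \<le> 0"
    and weak: "\<And>a d. 0 < d \<Longrightarrow> cball a d \<subseteq> U \<Longrightarrow>
      (LINT x|lborel. v x * lap \<alpha> (bump a d) x) = (LINT x|lborel. g x * bump a d x)"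
  shows "v x = v x0"
proof (rule ccontr)
  assume "v x \<noteq> v x0"
  define x1 where "x1 = x"
  define m where "m = v x1 - v x0"
  have m: "m > 0" using min[of x] \<open>v x \<noteq> v x0\<close> by (simp add: m_def x1_def)
  define D where "D = dist x0 x1"
  have D: "D > 0" using m by (auto simp: D_def m_def)
  have vm[measurable]: "v \<in> borel_measurable borel" using v by (rule borel_measurable_continuous_onI)
  obtain B where B: "\<And>x. \<bar>v x\<bar> \<le> B" using continuous_outside_bounded[OF K v] by blast
  have vi: "integrable lborel v" using compact_support_integrable[OF v K] .
  obtain d1 where d1: "d1 > 0" "\<And>y. dist y x1 < d1 \<Longrightarrow> \<bar>v y - v x1\<bar> < m / 4"
    using compact_support_uniform[OF v K, of "m / 4"] m by auto
  define r1 where "r1 = min d1 (D / 4)"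
  have r1: "r1 > 0" "r1 \<le> D / 4" using d1 D by (auto simp: r1_def)
  have vS: "v x0 + 3 * m / 4 \<le> v y" if "y \<in> ball x1 r1" for y
  proof -
    have "\<bar>v y - v x1\<bar> < m / 4" using that by (intro d1(2)) (auto simp: r1_def dist_commute)
    moreover have "v x1 = v x0 + m" by (simp add: m_def)
    ultimately show ?thesis by linarith
  qed
  \<comment> \<open>What the ball around \<open>x1\<close> contributes to the operator per unit of
    height; \<open>2 * D\<close> bounds its distance from every point near
    \<open>x0\<close>.\<close>
  define cS where "cS = measure lborel (ball x1 r1) * (2 * D) powr - (real DIM('a) + \<alpha>)"
  have "0 < measure lborel (ball x1 r1)" using r1 content_ball_pos by blast
  then have cS: "cS > 0" using D by (auto simp: cS_def)
  \<comment> \<open>The argument ends with \<open>7/16\<close> of \<open>m * cS\<close> being at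
    most \<open>\<eta>\<close>; the denominators 16 here and in \<open>\<tau>\<close> make this
    absurd.\<close>
  define \<eta> where "\<eta> = m * cS / 16"
  have \<eta>: "\<eta> > 0" using m cS by (simp add: \<eta>_def)
  obtain r2 where r2: "r2 > 0" "\<And>y. dist y x0 < r2 \<Longrightarrow> \<bar>g y - g x0\<bar> < \<eta>"
    using g \<eta> unfolding continuous_on_iff by (metis UNIV_I dist_real_def)
  obtain r3 where r3: "r3 > 0" "ball x0 r3 \<subseteq> U" using U openE by blast
  define r where "r = min (D / 4) (min r2 r3 / 3)"
  have r: "r > 0" "r \<le> D / 4" "2 * r < r2" "2 * r < r3"
    using D r2 r3 by (auto simp: r_def)
  define b where "b = bump x0 r"
  have b0: "b x0 > 0" using r by (simp add: b_def bump_pos_iff)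
  have bz: "b y = 0" if "r \<le> dist y x0" for y using that r by (simp add: b_def bump_eq_0_iff)
  obtain Bb where Bb: "Bb \<ge> 0" "\<And>\<epsilon> x. \<epsilon> \<in> {0<..1} \<Longrightarrow> \<bar>trunc_lap \<alpha> \<epsilon> b x\<bar> \<le> Bb"
  proof -
    obtain B K where "b \<in> borel_measurable borel" "\<And>x. \<bar>b x\<bar> \<le> B"
      "\<And>x z. \<bar>second_diff b x z\<bar> \<le> K * (norm z)\<^sup>2"
      unfolding b_def by (rule test_function_bounds[OF bump_test_function[OF r(1) subset_UNIV[of "cball x0 r"]]]) blast
    from lap_bounded[OF \<alpha> this] show ?thesis using that by blast
  qed
  \<comment> \<open>The height of the subtracted bump: it may change the operator by at most
    \<open>m * cS / 16\<close>. The summand 1 avoids division by 0.\<close>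
  define \<tau> where "\<tau> = m * cS / (16 * (Bb + 1))"
  have \<tau>: "\<tau> > 0" "\<tau> * Bb \<le> m * cS / 16"
    using m cS Bb(1) by (auto simp: \<tau>_def field_simps)
  \<comment> \<open>The mollification error has to be small both against the dip
    \<open>\<tau> * b x0\<close> and against \<open>m\<close>.\<close>
  define \<omega> where "\<omega> = min (\<tau> * b x0 / 4) (m / 8)"
  have \<omega>: "\<omega> > 0" "\<omega> \<le> \<tau> * b x0 / 4" "\<omega> \<le> m / 8" using \<tau> b0 m by (auto simp: \<omega>_def)
  obtain d2 where d2: "d2 > 0" "\<And>x y. dist x y < d2 \<Longrightarrow> \<bar>v x - v y\<bar> < \<omega>"
    using compact_support_uniform[OF v K \<omega>(1)] by blast
  define \<delta> where "\<delta> = min d2 r"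
  have \<delta>: "\<delta> > 0" "\<delta> \<le> d2" "\<delta> \<le> r" using d2 r by (auto simp: \<delta>_def)
  define w where "w = mollify v \<delta>"
  have wv: "\<bar>w x - v x\<bar> \<le> \<omega>" for x
    unfolding w_def using d2(2) \<delta> by (intro mollify_near[OF \<delta>(1) vm B]) (auto intro!: less_imp_le)
  have wB: "\<bar>w x\<bar> \<le> B + \<omega>" for x using wv[of x] B[of x] by linarith
  have wc: "continuous_on UNIV w"
    unfolding continuous_on_iff
  proof safe
    fix x :: 'a and e :: real assume "0 < e"
    then obtain d where d: "d > 0" "\<And>x y. dist x y < d \<Longrightarrow> \<bar>v x - v y\<bar> < e / 2"
      using compact_support_uniform[OF v K, of "e / 2"] by auto
    have "dist (w y) (w x) < e" if "dist y x < d" for y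
    proof -
      have "\<bar>w y - w x\<bar> \<le> e / 2"
        unfolding w_def using d(2) that by (intro mollify_diff_le[OF \<delta>(1) vm B]) (auto intro!: less_imp_le)
      then show ?thesis using \<open>0 < e\<close> by (simp add: dist_real_def)
    qed
    with d(1) show "\<exists>d>0. \<forall>x'\<in>UNIV. dist x' x < d \<longrightarrow> dist (w x') (w x) < e" by blast
  qed
  define F where "F x = w x - \<tau> * b x" for x
  have bc: "continuous_on UNIV b" unfolding b_def by (rule bump_continuous)
  have "continuous_on (cball x0 r) F"
    unfolding F_def using wc bc by (auto intro!: continuous_intros intro: continuous_on_subset)
  then obtain xs where xs: "xs \<in> cball x0 r" "\<And>y. y \<in> cball x0 r \<Longrightarrow> F xs \<le> F y"
    using continuous_attains_inf[of "cball x0 r" F] r by auto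
  \<comment> \<open>At \<open>x0\<close> the value of \<open>F\<close> is at most
    \<open>v x0 + \<omega> - 4 * \<omega>\<close>, while off the support of the bump it is at least
    \<open>v x0 - \<omega>\<close>. Hence the minimum over the small ball is global.\<close>
  have Fxs: "F xs \<le> v x0 - \<omega>"
    using xs(2)[of x0] r wv[of x0] \<omega> b0 \<tau> by (auto simp: F_def)
  have Fmin: "F xs \<le> F y" for y
  proof (cases "y \<in> cball x0 r")
    case False
    then have "F y = w y" using bz[of y] by (simp add: F_def dist_commute)
    then show ?thesis using Fxs wv[of y] min[of y] by linarith
  qed (rule xs)
  have FS: "F xs + m / 2 \<le> F y" if y: "y \<in> ball x1 r1" for y
  proof -
    have "dist x0 x1 \<le> dist y x0 + dist y x1" by (metis dist_commute dist_triangle)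
    then have "F y = w y" using bz[of y] y r1 r D by (simp add: F_def dist_commute D_def)
    then show ?thesis using Fxs wv[of y] vS[OF y] \<omega> m by linarith
  qed
  have far: "D / 2 \<le> norm (y - xs) \<and> norm (y - xs) \<le> 2 * D" if y: "y \<in> ball x1 r1" for y
  proof -
    have "dist x0 x1 \<le> dist x0 xs + dist xs y + dist y x1"
      by (metis dist_triangle dist_commute add.assoc add_left_mono order_trans)
    moreover have "dist xs y \<le> dist xs x0 + dist x0 x1 + dist x1 y"
      by (metis dist_triangle dist_commute add.assoc add_left_mono order_trans)
    ultimately show ?thesis
      using y xs(1) r1 r D by (simp add: dist_norm[symmetric] dist_commute D_def)
  qed
  have lower: "m * cS * (7 / 16) \<le> trunc_lap \<alpha> \<epsilon> w xs" if e: "0 < \<epsilon>" "\<epsilon> < min 1 (D / 2)" for \<epsilon>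
  proof -
    have [measurable]: "F \<in> borel_measurable borel" "w \<in> borel_measurable borel" "b \<in> borel_measurable borel"
      using wc bc unfolding F_def by (auto intro!: borel_measurable_continuous_onI continuous_intros)
    have bb: "\<bar>\<tau> * b y\<bar> \<le> \<tau>" for y
      using bump_abs_le_1[of x0 r y] \<tau> by (simp add: b_def abs_mult mult_left_le)
    have FB: "\<bar>F y\<bar> \<le> B + \<omega> + \<tau>" for y using wB[of y] bb[of y] by (simp add: F_def)
    have "m / 2 * (measure lborel (ball x1 r1) * (2 * D) powr - (real DIM('a) + \<alpha>)) \<le> trunc_lap \<alpha> \<epsilon> F xs"
    proof (rule trunc_lap_ge_ball[where F = F and B = "B + \<omega> + \<tau>", OF \<alpha>(1) e(1) _ FB Fmin _ FS])
      show "\<epsilon> < norm (y - xs) \<and> norm (y - xs) \<le> 2 * D" if "y \<in> ball x1 r1" for y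
        using far[OF that] e by auto
    qed (use m in auto)
    also have "trunc_lap \<alpha> \<epsilon> F xs = trunc_lap \<alpha> \<epsilon> w xs - \<tau> * trunc_lap \<alpha> \<epsilon> b xs"
      unfolding F_def
      by (subst trunc_lap_diff[OF \<alpha>(1) e(1) _ wB _ bb]) (auto simp: trunc_lap_mult)
    finally have "m / 2 * cS + \<tau> * trunc_lap \<alpha> \<epsilon> b xs \<le> trunc_lap \<alpha> \<epsilon> w xs" by (simp add: cS_def)
    moreover have "- (\<tau> * Bb) \<le> \<tau> * trunc_lap \<alpha> \<epsilon> b xs"
      using mult_left_mono[of "- Bb" "trunc_lap \<alpha> \<epsilon> b xs" \<tau>] Bb(2)[of \<epsilon> xs] e \<tau> by (auto simp: abs_le_iff)
    ultimately show ?thesis using \<tau>(2) by (simp add: field_simps)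
  qed
  let ?I = "LINT y::'a|lborel. bump 0 \<delta> y"
  have I: "?I > 0" using bump_integral_pos[OF \<delta>(1)] .
  have "((\<lambda>\<epsilon>. trunc_lap \<alpha> \<epsilon> w xs) \<longlongrightarrow> (LINT y|lborel. v y * lap \<alpha> (bump xs \<delta>) y) / ?I) (at_right 0)"
  proof -
    obtain B' K' where "bump xs \<delta> \<in> borel_measurable borel" "\<And>x. \<bar>bump xs \<delta> x\<bar> \<le> B'"
      "\<And>x z. \<bar>second_diff (bump xs \<delta>) x z\<bar> \<le> K' * (norm z)\<^sup>2"
      by (rule test_function_bounds[OF bump_test_function[OF \<delta>(1) subset_UNIV[of "cball xs \<delta>"]]]) blast
    from weak_trunc_lap_tendsto[OF \<alpha> vi this]
    have "((\<lambda>\<epsilon>. (LINT y|lborel. v y * trunc_lap \<alpha> \<epsilon> (bump xs \<delta>) y) / ?I)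
        \<longlongrightarrow> (LINT y|lborel. v y * lap \<alpha> (bump xs \<delta>) y) / ?I) (at_right 0)"
      using I by (intro tendsto_divide tendsto_const) auto
    moreover have "\<forall>\<^sub>F \<epsilon> in at_right 0. (LINT y|lborel. v y * trunc_lap \<alpha> \<epsilon> (bump xs \<delta>) y) / ?I = trunc_lap \<alpha> \<epsilon> w xs"
      using eventually_at_right_less[of 0]
      by (rule eventually_mono) (simp add: w_def trunc_lap_mollify[OF \<alpha>(1) _ vi])
    ultimately show ?thesis by (rule Lim_transform_eventually)
  qed
  moreover have "\<forall>\<^sub>F \<epsilon> in at_right 0. m * cS * (7 / 16) \<le> trunc_lap \<alpha> \<epsilon> w xs"
    unfolding eventually_at_right_field using D
    by (intro exI[of _ "min 1 (D / 2)"] conjI allI impI lower) simp_all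
  ultimately have "m * cS * (7 / 16) \<le> (LINT y|lborel. v y * lap \<alpha> (bump xs \<delta>) y) / ?I"
    by (rule tendsto_lowerbound) simp
  also have "(LINT y|lborel. v y * lap \<alpha> (bump xs \<delta>) y) = (LINT y|lborel. g y * bump xs \<delta> y)"
  proof (rule weak[OF \<delta>(1)])
    have "cball xs \<delta> \<subseteq> ball x0 r3"
    proof
      fix y assume "y \<in> cball xs \<delta>"
      then have "dist x0 y \<le> r + \<delta>" using xs(1) dist_triangle[of x0 y xs] by auto
      then show "y \<in> ball x0 r3" using \<delta> r by auto
    qed
    then show "cball xs \<delta> \<subseteq> U" using r3(2) by blast
  qed
  also have "\<dots> \<le> \<eta> * ?I"
  proof -
    have hg: "g y \<le> \<eta>" if "dist y xs < \<delta>" for y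
    proof -
      have "dist y x0 \<le> dist y xs + dist xs x0" by (rule dist_triangle)
      then have "dist y x0 < r2" using that xs(1) \<delta> r by (simp add: dist_commute)
      from r2(2)[OF this] show ?thesis using g0 by linarith
    qed
    obtain Bg where Bg: "\<And>y. y \<in> cball xs \<delta> \<Longrightarrow> \<bar>g y\<bar> \<le> Bg"
    proof -
      have "bounded (g ` cball xs \<delta>)"
        by (intro compact_imp_bounded compact_continuous_image continuous_on_subset[OF g]) auto
      then obtain a where "\<forall>s\<in>g ` cball xs \<delta>. norm s \<le> a" unfolding bounded_iff by blast
      then have "\<And>y. y \<in> cball xs \<delta> \<Longrightarrow> \<bar>g y\<bar> \<le> a" by simp
      with that show ?thesis by blast
    qed
    \<comment> \<open>\<open>bump_average_le\<close> asks for a globally bounded function; cutting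
      \<open>g\<close> off outside the support of the bump does not change the integral.\<close>
    define k where "k y = indicator (cball xs \<delta>) y * g y" for y
    have [measurable]: "g \<in> borel_measurable borel" using g by (rule borel_measurable_continuous_onI)
    have [measurable]: "cball xs \<delta> \<in> sets borel" by simp
    have "(\<lambda>y. g y * bump xs \<delta> y) = (\<lambda>y. k y * bump xs \<delta> y)"
    proof
      show "g y * bump xs \<delta> y = k y * bump xs \<delta> y" for y
        using bump_eq_0_iff[OF \<delta>(1), of xs y]
        by (cases "y \<in> cball xs \<delta>") (simp_all add: k_def dist_commute)
    qed
    then have "(LINT y|lborel. g y * bump xs \<delta> y) = (LINT y|lborel. k y * bump xs \<delta> y)" by simp
    also have "\<dots> \<le> \<eta> * ?I"
    proof (rule bump_average_le[OF \<delta>(1)])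
      show "k \<in> borel_measurable borel" unfolding k_def[abs_def] by measurable
      have "0 \<le> Bg" using Bg[of xs] \<delta> by auto
      then show "\<bar>k y\<bar> \<le> Bg" for y using Bg[of y] by (auto simp: k_def indicator_def)
      show "k z \<le> \<eta>" if "dist z xs < \<delta>" for z using hg[OF that] \<eta> by (auto simp: k_def indicator_def)
    qed
    finally show ?thesis .
  qed
  finally have "m * cS * (7 / 16) \<le> \<eta>" using I by (simp add: divide_right_mono)
  then show False using m cS by (simp add: \<eta>_def)
qed

subsection \<open>Starshaped geometry\<close>

lemma segment_meets_frontier:
  fixes x y :: "'a::real_normed_vector"
  assumes "x \<in> S" "y \<notin> S"
  shows "\<exists>t\<in>{0..1}. x + t *\<^sub>R (y - x) \<in> frontier S"
proof -
  have "closed_segment x y \<inter> frontier S \<noteq> {}"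
    using assms by (intro connected_Int_frontier) auto
  then obtain z t where "z \<in> frontier S" "0 \<le> t" "t \<le> 1" "z = (1 - t) *\<^sub>R x + t *\<^sub>R y"
    unfolding disjoint_iff in_segment by blast
  moreover have "(1 - t) *\<^sub>R x + t *\<^sub>R y = x + t *\<^sub>R (y - x)" by (simp add: algebra_simps)
  ultimately show ?thesis by (intro bexI[of _ t]) simp_all
qed

text \<open>If \<open>s x\<close> were outside \<open>D\<close>, the segment from 0 to it would meet
  the frontier at a factor below 1. The ray also meets the frontier at a factor of at least 1: in x
  itself if x is not in \<open>D\<close>, and otherwise on the way out of the bounded set. Two
  frontier points on one ray are impossible.\<close>

lemma strictly_starshaped_scale_closure:
  fixes D :: "'a::euclidean_space set"
  assumes D: "strictly_starshaped D" "open D" "bounded D" and x: "x \<in> closure D" and s: "0 \<le> s" "s < 1"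
  shows "s *\<^sub>R x \<in> D"
proof (rule ccontr)
  assume n: "s *\<^sub>R x \<notin> D"
  have 0: "0 \<in> D" using D(1,2) by (simp add: strictly_starshaped_def interior_open)
  with n have x0: "x \<noteq> 0" by auto
  obtain t where t: "t \<in> {0..1}" "0 + t *\<^sub>R (s *\<^sub>R x - 0) \<in> frontier D"
    using segment_meets_frontier[OF 0 n] by blast
  have ts: "t * s < 1" "0 \<le> t * s" using t(1) s by (auto intro: le_less_trans[of _ s] simp: mult_left_le_one_le)
  have "\<exists>r\<ge>1. r *\<^sub>R x \<in> frontier D"
  proof (cases "x \<in> D")
    case True
    obtain R where R: "D \<subseteq> ball 0 R" using bounded_subset_ballD[OF D(3)] by blast
    define k where "k = max 1 (R / norm x)"
    have "R \<le> k * norm x" using x0 by (simp add: k_def max_def field_simps)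
    then have "k *\<^sub>R x \<notin> D" using R by (auto simp: k_def)
    from segment_meets_frontier[OF True this] obtain q where
      q: "q \<in> {0..1}" "x + q *\<^sub>R (k *\<^sub>R x - x) \<in> frontier D" by blast
    have "x + q *\<^sub>R (k *\<^sub>R x - x) = (1 + q * (k - 1)) *\<^sub>R x" by (simp add: algebra_simps)
    moreover have "1 \<le> 1 + q * (k - 1)" using q(1) by (simp add: k_def)
    ultimately show ?thesis using q(2) by metis
  next
    case False
    then have "x \<in> frontier D" using x D(2) by (simp add: frontier_def interior_open)
    then show ?thesis by (intro exI[of _ 1]) simp
  qed
  then obtain r where r: "r \<ge> 1" "r *\<^sub>R x \<in> frontier D" by blast
  have "r *\<^sub>R x \<in> ray x \<inter> frontier D" "(t * s) *\<^sub>R x \<in> ray x \<inter> frontier D"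
    using r t ts by (auto simp: ray_def)
  with D(1) x0 have "r *\<^sub>R x = (t * s) *\<^sub>R x" unfolding strictly_starshaped_def by blast
  then show False using x0 r ts by simp
qed

subsection \<open>Scaling of the weak equation\<close>

lemma kern_scale: "0 < t \<Longrightarrow> kern \<alpha> (t *\<^sub>R z) = t powr - (real DIM('a) + \<alpha>) * kern \<alpha> z"
  for z :: "'a::euclidean_space"
  by (simp add: kern_def powr_mult)

text \<open>The volume scales with \<open>t^N\<close> and the kernel with exponent
  \<open>-(N + \<alpha>)\<close>, so the operator is homogeneous of degree \<alpha>.\<close>

lemma lap_bump_scale:
  fixes a :: "'a::euclidean_space"
  assumes t: "0 < t"
  shows "lap \<alpha> (bump a d) x = t powr \<alpha> * lap \<alpha> (bump (t *\<^sub>R a) (t * d)) (t *\<^sub>R x)"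
proof -
  let ?b = "bump (t *\<^sub>R a) (t * d)"
  let ?h = "\<lambda>z. (?b (t *\<^sub>R x + z) + ?b (t *\<^sub>R x - z) - 2 * ?b (t *\<^sub>R x)) * kern \<alpha> z"
  have "?h (0 + t *\<^sub>R z) = t powr - (real DIM('a) + \<alpha>) * ((bump a d (x + z) + bump a d (x - z) - 2 * bump a d x) * kern \<alpha> z)" for z
    by (simp add: bump_scale[OF t] scaleR_add_right[symmetric] scaleR_diff_right[symmetric] kern_scale[OF t])
  moreover have "(LINT z|lborel. ?h z) = \<bar>t\<bar> ^ DIM('a) * (LINT z|lborel. ?h (0 + t *\<^sub>R z))"
    using t by (intro lborel_affine_integral) auto
  ultimately have "lap \<alpha> ?b (t *\<^sub>R x) = t ^ DIM('a) * (t powr - (real DIM('a) + \<alpha>) * lap \<alpha> (bump a d) x)"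
    using t by (simp add: lap_def)
  also have "\<dots> = (t powr real DIM('a) * t powr - (real DIM('a) + \<alpha>)) * lap \<alpha> (bump a d) x"
    using t by (simp add: powr_realpow)
  also have "t powr real DIM('a) * t powr - (real DIM('a) + \<alpha>) = t powr - \<alpha>"
    by (simp add: powr_add[symmetric])
  finally show ?thesis using t by (simp add: powr_minus field_simps)
qed

lemma weak_equation_diff:
  fixes u1 u2 g1 g2 :: "'a::euclidean_space \<Rightarrow> real"
  assumes \<alpha>: "0 < \<alpha>" "\<alpha> < 2" and d: "0 < d" and K: "compact K"
    and c: "continuous_on UNIV u1" "continuous_on UNIV u2" "continuous_on UNIV g1" "continuous_on UNIV g2"
    and z: "\<And>x. x \<notin> K \<Longrightarrow> u1 x = 0 \<and> u2 x = 0 \<and> g1 x = 0 \<and> g2 x = 0"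
    and w: "(LINT x|lborel. u1 x * lap \<alpha> (bump a d) x) = (LINT x|lborel. g1 x * bump a d x)"
      "(LINT x|lborel. u2 x * lap \<alpha> (bump a d) x) = (LINT x|lborel. g2 x * bump a d x)"
  shows "(LINT x|lborel. (u1 x - u2 x) * lap \<alpha> (bump a d) x) = (LINT x|lborel. (g1 x - g2 x) * bump a d x)"
proof -
  obtain B K' where b: "bump a d \<in> borel_measurable borel" "\<And>x. \<bar>bump a d x\<bar> \<le> B"
    "\<And>x z. \<bar>second_diff (bump a d) x z\<bar> \<le> K' * (norm z)\<^sup>2"
    by (rule test_function_bounds[OF bump_test_function[OF d subset_UNIV[of "cball a d"]]]) blast
  obtain L where "\<And>x. \<bar>lap \<alpha> (bump a d) x\<bar> \<le> L" using lap_bounded[OF \<alpha> b] by blast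
  note LB = lap_measurable[OF b(1), of \<alpha>] this
  have "integrable lborel u1" "integrable lborel u2" "integrable lborel g1" "integrable lborel g2"
    using z by (auto intro: compact_support_integrable[OF _ K] c)
  then show ?thesis
    unfolding left_diff_distrib
    using integrable_times_bounded[OF _ LB] integrable_times_bounded[OF _ b(1,2)] w by simp
qed

section \<open>The ring problem\<close>

locale ring_problem =
  fixes D0 D1 :: "'a::euclidean_space set" and \<alpha> \<beta> \<gamma> p :: real and f :: "'a \<Rightarrow> real \<Rightarrow> real"
  assumes \<alpha>: "0 < \<alpha>" "\<alpha> < 2"
    and D0: "bounded D0" "open D0" "strictly_starshaped D0"
    and D1: "bounded D1" "open D1" "strictly_starshaped D1"
    and zero: "0 \<in> D1" and sub: "closure D1 \<subseteq> D0"
    and \<beta>: "0 \<le> \<beta>" and p: "1 \<le> p"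
    and f: "\<And>x s. x \<in> D0 - closure D1 \<Longrightarrow> s \<in> {0..1} \<Longrightarrow> f x s = \<beta> * s - \<gamma> * s powr p"
begin

text \<open>Division by \<open>frac_const\<close> matches the missing factor in \<open>lap\<close>.
  Being independent of the point, \<open>F\<close> also makes sense outside the ring, and
  \<open>F 0 = 0\<close> keeps right-hand sides compactly supported.\<close>

definition F :: "real \<Rightarrow> real" where
  "F s = (\<beta> * s - \<gamma> * s powr p) / frac_const DIM('a) \<alpha>"

lemma const_pos: "0 < frac_const DIM('a) \<alpha>"
  using frac_const_pos \<alpha> by blast

lemma F_0: "F 0 = 0"
  by (simp add: F_def)

lemma F_continuous: "continuous_on {0..1} F"
  unfolding F_def[abs_def] using const_pos p
  by (intro continuous_intros continuous_on_powr') auto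

lemma powr_p_le: "s powr p \<le> s" if "s \<in> {0..1}" for s
  using that p powr_mono'[of 1 p s] by (cases "s = 0") auto

lemma F_nonneg:
  assumes "\<gamma> \<le> \<beta>" "s \<in> {0..1}"
  shows "0 \<le> F s"
proof -
  have "\<gamma> * s powr p \<le> \<beta> * s"
  proof (cases "0 \<le> \<gamma>")
    case True
    then have "\<gamma> * s powr p \<le> \<gamma> * s" using powr_p_le[OF assms(2)] by (rule mult_left_mono[rotated])
    also have "\<dots> \<le> \<beta> * s" using assms by (auto intro: mult_right_mono)
    finally show ?thesis .
  next
    case False
    then have "\<gamma> * s powr p \<le> 0" by (simp add: mult_nonpos_nonneg)
    also have "0 \<le> \<beta> * s" using \<beta> assms by simp
    finally show ?thesis .
  qed
  then show ?thesis using const_pos by (simp add: F_def)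
qed

text \<open>By the mean value theorem, since the derivative \<open>p z^(p-1)\<close> is at most p on
  [0,1].\<close>

lemma pow_mono_diff:
  assumes "0 \<le> s" "s \<le> s'" "s' \<le> 1"
  shows "0 \<le> s' powr p - s powr p" "s' powr p - s powr p \<le> p * (s' - s)"
proof -
  show "0 \<le> s' powr p - s powr p" using assms p by (simp add: powr_mono2)
  show "s' powr p - s powr p \<le> p * (s' - s)"
  proof (cases "s = s'")
    case False
    then have ss: "s < s'" using assms by simp
    \<comment> \<open>Since \<open>s\<close> may be 0, only continuity is used at the left endpoint;
      the derivative is taken at positive points.\<close>
    have "\<exists>z. s < z \<and> z < s' \<and> s' powr p - s powr p = (s' - s) * (p * z powr (p - 1))"
    proof -
      have "continuous_on {s..s'} (\<lambda>x. x powr p)"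
        using p assms by (intro continuous_on_powr' continuous_intros) auto
      moreover have "((\<lambda>x. x powr p) has_real_derivative p * x powr (p - 1)) (at x)" if "s < x" for x
        using that assms by (auto intro!: derivative_eq_intros)
      ultimately have "\<exists>l z. s < z \<and> z < s' \<and> ((\<lambda>x. x powr p) has_real_derivative l) (at z) \<and> s' powr p - s powr p = (s' - s) * l"
        using ss by (intro MVT) (auto simp: real_differentiable_def)
      then obtain l z where z: "s < z" "z < s'" "((\<lambda>x. x powr p) has_real_derivative l) (at z)"
        "s' powr p - s powr p = (s' - s) * l" by blast
      moreover have "l = p * z powr (p - 1)"
        by (rule DERIV_unique[OF z(3)]) (use z assms in \<open>auto intro!: derivative_eq_intros\<close>)
      ultimately show ?thesis by blast
    qed
    then obtain z where z: "s < z" "z < s'" "s' powr p - s powr p = (s' - s) * (p * z powr (p - 1))" by blast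
    have "z powr (p - 1) \<le> 1" using z assms p by (intro powr_le1) auto
    then have "p * z powr (p - 1) \<le> p" using p by (simp add: mult_left_le)
    then have "(s' - s) * (p * z powr (p - 1)) \<le> (s' - s) * p" using ss by (intro mult_left_mono) auto
    then show ?thesis using z by (simp add: mult.commute)
  qed simp
qed

text \<open>For \<gamma> \<ge> 0 the slope of \<open>\<gamma> s^p\<close> is at most p \<gamma>,
  which \<beta> outweighs; for negative \<gamma> both terms are nondecreasing.\<close>

lemma F_mono:
  assumes "p * \<gamma> \<le> \<beta>" "0 \<le> s" "s \<le> s'" "s' \<le> 1"
  shows "F s \<le> F s'"
proof -
  have "\<gamma> * (s' powr p - s powr p) \<le> \<beta> * (s' - s)"
  proof (cases "0 \<le> \<gamma>")
    case True
    then have "\<gamma> * (s' powr p - s powr p) \<le> \<gamma> * (p * (s' - s))"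
      using pow_mono_diff[OF assms(2-4)] by (intro mult_left_mono) auto
    also have "\<dots> = (p * \<gamma>) * (s' - s)" by simp
    also have "\<dots> \<le> \<beta> * (s' - s)" using assms by (intro mult_right_mono) auto
    finally show ?thesis .
  next
    case False
    then have "\<gamma> * (s' powr p - s powr p) \<le> 0"
      using pow_mono_diff[OF assms(2-4)] by (simp add: mult_nonpos_nonneg)
    also have "0 \<le> \<beta> * (s' - s)" using \<beta> assms by simp
    finally show ?thesis .
  qed
  then have "\<beta> * s - \<gamma> * s powr p \<le> \<beta> * s' - \<gamma> * s' powr p" by (simp add: algebra_simps)
  then show ?thesis using const_pos by (simp add: F_def divide_right_mono)
qed

lemma \<gamma>_le_\<beta>: "p * \<gamma> \<le> \<beta> \<Longrightarrow> \<gamma> \<le> \<beta>"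
  using \<beta> p mult_right_mono[of 1 p \<gamma>] by (cases "0 \<le> \<gamma>") auto

lemma F_comp_continuous:
  assumes "continuous_on UNIV u" "range u \<subseteq> {0..1}"
  shows "continuous_on UNIV (\<lambda>x. F (u x))"
  using continuous_on_compose2[OF F_continuous assms] by simp

text \<open>The test function vanishes off the ring, so the integral extends to the whole space and
  \<open>f\<close> can be replaced by \<open>F\<close>; the positive constant then cancels.\<close>

lemma test_function_equation:
  assumes u: "continuous_on UNIV u" "range u \<subseteq> {0..1}" and \<phi>: "\<phi> \<in> test_functions (D0 - closure D1)"
  shows "(- frac_laplacian_distr \<alpha> u \<phi> = (LINT x:D0 - closure D1|lborel. f x (u x) * \<phi> x))
    \<longleftrightarrow> (LINT x|lborel. u x * lap \<alpha> \<phi> x) = (LINT x|lborel. F (u x) * \<phi> x)"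
proof -
  let ?c = "frac_const DIM('a) \<alpha>"
  obtain B K where B: "\<phi> \<in> borel_measurable borel" "\<And>x. \<bar>\<phi> x\<bar> \<le> B"
    "\<And>x z. \<bar>second_diff \<phi> x z\<bar> \<le> K * (norm z)\<^sup>2"
    by (rule test_function_bounds[OF \<phi>]) blast
  have "frac_laplacian \<alpha> \<phi> x = - ?c * lap \<alpha> \<phi> x" for x
    by (rule frac_laplacian_eq_lap[OF \<alpha> B])
  then have "- frac_laplacian_distr \<alpha> u \<phi> = ?c * (LINT x|lborel. u x * lap \<alpha> \<phi> x)"
  proof -
    have "(LINT x|lborel. u x * frac_laplacian \<alpha> \<phi> x) = (LINT x|lborel. - ?c * (u x * lap \<alpha> \<phi> x))"
      using \<open>\<And>x. frac_laplacian \<alpha> \<phi> x = _\<close> by (intro Bochner_Integration.integral_cong) auto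
    then show ?thesis unfolding frac_laplacian_distr_def by simp
  qed
  moreover have eq: "indicator (D0 - closure D1) x *\<^sub>R (f x (u x) * \<phi> x) = ?c * (F (u x) * \<phi> x)" for x
  proof (cases "x \<in> D0 - closure D1")
    case True
    moreover have "f x (u x) = ?c * F (u x)"
      using f[OF True, of "u x"] u(2) const_pos by (auto simp: F_def image_subset_iff)
    ultimately show ?thesis by simp
  next
    case False
    then have "\<phi> x = 0"
      using \<phi> closure_subset[of "{x. \<phi> x \<noteq> 0}"] by (auto simp: test_functions_def)
    then show ?thesis by simp
  qed
  have "(LINT x:D0 - closure D1|lborel. f x (u x) * \<phi> x) = ?c * (LINT x|lborel. F (u x) * \<phi> x)"
    unfolding set_lebesgue_integral_def eq by simp
  ultimately show ?thesis using const_pos by simp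
qed

end

section \<open>Dilated equations and strict bounds for a solution\<close>

locale ring_sol = ring_problem D0 D1 \<alpha> \<beta> \<gamma> p f
  for D0 D1 :: "'a::euclidean_space set" and \<alpha> \<beta> \<gamma> p f +
  fixes u :: "'a \<Rightarrow> real"
  assumes sol: "ring_solution \<alpha> D0 D1 f u"
begin

lemma u_cont: "continuous_on UNIV u"
  and u_range: "0 \<le> u x" "u x \<le> 1"
  and u_outside: "x \<notin> D0 \<Longrightarrow> u x = 0"
  and u_inside: "x \<in> closure D1 \<Longrightarrow> u x = 1"
  using sol by (auto simp: ring_solution_def image_subset_iff)

lemma Fu_cont: "continuous_on UNIV (\<lambda>x. F (u x))"
  using u_range by (intro F_comp_continuous[OF u_cont]) auto

lemma weak_bump:
  assumes "0 < d" "cball a d \<subseteq> D0 - closure D1"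
  shows "(LINT x|lborel. u x * lap \<alpha> (bump a d) x) = (LINT x|lborel. F (u x) * bump a d x)"
proof -
  note b = bump_test_function[OF assms]
  show ?thesis
    using test_function_equation[OF u_cont _ b] sol b u_range
    unfolding ring_solution_def by auto
qed

text \<open>The dilation is moved onto the test function, which remains a bump and is now supported
  in the ring itself; homogeneity of \<open>lap\<close> leaves the factor
  \<open>t powr \<alpha>\<close>.\<close>

lemma weak_bump_scaled:
  assumes d: "0 < d" and t: "0 < t" and "cball a d \<subseteq> {x. t *\<^sub>R x \<in> D0 - closure D1}"
  shows "(LINT x|lborel. u (t *\<^sub>R x) * lap \<alpha> (bump a d) x) = (LINT x|lborel. t powr \<alpha> * F (u (t *\<^sub>R x)) * bump a d x)"
proof -
  let ?b = "bump (t *\<^sub>R a) (t * d)"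
  have [measurable]: "u \<in> borel_measurable borel" "(\<lambda>x. F (u x)) \<in> borel_measurable borel"
    using u_cont Fu_cont by (auto intro: borel_measurable_continuous_onI)
  have "cball (t *\<^sub>R a) (t * d) \<subseteq> D0 - closure D1"
  proof
    fix y assume "y \<in> cball (t *\<^sub>R a) (t * d)"
    then have "dist (t *\<^sub>R a) (t *\<^sub>R ((1 / t) *\<^sub>R y)) \<le> t * d" using t by simp
    moreover have "dist (t *\<^sub>R a) (t *\<^sub>R x) = t * dist a x" for x
      using t by (simp add: dist_norm scaleR_diff_right[symmetric])
    ultimately have "(1 / t) *\<^sub>R y \<in> cball a d" using t by (simp only: mult_le_cancel_left_pos mem_cball)
    with assms(3) have "t *\<^sub>R ((1 / t) *\<^sub>R y) \<in> D0 - closure D1" by blast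
    then show "y \<in> D0 - closure D1" using t by simp
  qed
  then have w: "(LINT x|lborel. u x * lap \<alpha> ?b x) = (LINT x|lborel. F (u x) * ?b x)"
    using t d by (intro weak_bump) auto
  have "(LINT x|lborel. u (t *\<^sub>R x) * lap \<alpha> (bump a d) x)
      = t powr \<alpha> * (LINT x|lborel. u (t *\<^sub>R x) * lap \<alpha> ?b (t *\<^sub>R x))"
    unfolding lap_bump_scale[OF t, of \<alpha> a d] by (simp only: mult.left_commute[of _ "t powr \<alpha>"] integral_mult_right_zero)
  also have "(LINT x|lborel. u (t *\<^sub>R x) * lap \<alpha> ?b (t *\<^sub>R x)) = (LINT x|lborel. F (u (t *\<^sub>R x)) * ?b (t *\<^sub>R x))"
    using w t lborel_affine_integral[of t "\<lambda>x. u x * lap \<alpha> ?b x" 0]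
      lborel_affine_integral[of t "\<lambda>x. F (u x) * ?b x" 0] by simp
  finally show ?thesis using t by (simp add: bump_scale mult.assoc)
qed

lemma ring_open: "open (D0 - closure D1)"
  using D0 by auto

lemma frontier_D0_point: "\<exists>y. y \<in> frontier D0"
proof -
  obtain b :: 'a where "b \<in> Basis" using nonempty_Basis by blast
  then have "b \<noteq> 0" by auto
  then show ?thesis using D0(3) unfolding strictly_starshaped_def by blast
qed

lemma outer_ball: "\<exists>R>0. D0 \<subseteq> ball 0 R"
  using bounded_subset_ballD[OF D0(1)] by blast

text \<open>If the value 1 or 0 were attained in the ring, \<open>-u\<close> or \<open>u\<close>
  would have a global minimum there, with right-hand side of the sign that forces a constant. But
  \<open>u\<close> takes both values, in 0 and on the frontier of \<open>D0\<close>.\<close>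

lemma strict_interior:
  assumes "\<gamma> \<le> \<beta>" "x \<in> D0 - closure D1"
  shows "0 < u x" "u x < 1"
proof -
  obtain R where R: "R > 0" "D0 \<subseteq> ball 0 R" using outer_ball by blast
  have K: "compact (cball (0::'a) R)" "\<And>y. y \<notin> cball 0 R \<Longrightarrow> u y = 0"
    using R u_outside by (auto simp: subset_iff) (metis less_le_not_le mem_ball_0)
  have m: "- u y = - u x" if "u x = 1" for y
  proof (rule strong_min_principle[OF \<alpha> _ K(1) _ _ ring_open assms(2)])
    show "continuous_on UNIV (\<lambda>x. - u x)" "continuous_on UNIV (\<lambda>x. - F (u x))"
      using u_cont Fu_cont by (auto intro: continuous_intros)
    show "- F (u x) \<le> 0" using F_nonneg[OF assms(1)] that by simp
    show "(LINT x|lborel. - u x * lap \<alpha> (bump a d) x) = (LINT x|lborel. - F (u x) * bump a d x)"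
      if "0 < d" "cball a d \<subseteq> D0 - closure D1" for a d
      using weak_bump[OF that] by simp
  qed (use K that u_range in auto)
  have z: "u y = u x" if "u x = 0" for y
    by (rule strong_min_principle[OF \<alpha> u_cont K Fu_cont ring_open assms(2) _ _ weak_bump])
      (use that u_range F_0 in auto)
  have "u 0 = 1" using zero closure_subset[of D1] by (intro u_inside) auto
  with z[of 0] have "u x \<noteq> 0" by auto
  with u_range(1)[of x] show "0 < u x" by auto
  obtain y where "y \<in> frontier D0" using frontier_D0_point by blast
  then have "u y = 0" using D0 by (intro u_outside) (simp add: frontier_def interior_open)
  with m[of y] have "u x \<noteq> 1" by auto
  with u_range(2)[of x] show "u x < 1" by auto
qed

end

section \<open>Comparison of two solutions\<close>

context ring_problem
begin

text \<open>A negative minimum of \<open>u2 - u1\<close> lies in the ring, because the boundary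
  values agree. There \<open>F (u2) \<le> F (u1)\<close>, so the difference is constant, although it
  vanishes at 0.\<close>

lemma solution_le:
  assumes mono: "p * \<gamma> \<le> \<beta>" and 1: "ring_solution \<alpha> D0 D1 f u1" and 2: "ring_solution \<alpha> D0 D1 f u2"
  shows "u1 x \<le> u2 x"
proof (rule ccontr)
  interpret u1: ring_sol D0 D1 \<alpha> \<beta> \<gamma> p f u1 by unfold_locales (rule 1)
  interpret u2: ring_sol D0 D1 \<alpha> \<beta> \<gamma> p f u2 by unfold_locales (rule 2)
  assume x: "\<not> u1 x \<le> u2 x"
  define v where "v y = u2 y - u1 y" for y
  obtain R where R: "R > 0" "D0 \<subseteq> ball 0 R" using u1.outer_ball by blast
  have K: "compact (cball (0::'a) R)" "\<And>y. y \<notin> cball 0 R \<Longrightarrow> v y = 0"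
    using R u1.u_outside u2.u_outside unfolding v_def by (auto simp: subset_iff) (metis less_le_not_le mem_ball_0)
  have vc: "continuous_on UNIV v"
    unfolding v_def[abs_def] using u1.u_cont u2.u_cont by (auto intro: continuous_intros)
  obtain x0 where x0: "\<And>y. y \<in> cball 0 R \<Longrightarrow> v x0 \<le> v y"
    using continuous_attains_inf[OF K(1) _ continuous_on_subset[OF vc]] R by fastforce
  have "v x < 0" using x by (simp add: v_def)
  then have "x \<in> cball 0 R" using K(2)[of x] by force
  then have neg: "v x0 < 0" using x0[of x] \<open>v x < 0\<close> by simp
  have min: "v x0 \<le> v y" for y using x0[of y] K(2)[of y] neg by (cases "y \<in> cball 0 R") auto
  have mem: "x0 \<in> D0 - closure D1"
    using neg u1.u_outside[of x0] u2.u_outside[of x0] u1.u_inside[of x0] u2.u_inside[of x0]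
    by (cases "x0 \<in> D0"; cases "x0 \<in> closure D1") (simp_all add: v_def)
  have "v y = v x0" for y
  proof (rule strong_min_principle[OF \<alpha> vc K _ u1.ring_open mem min])
    show "continuous_on UNIV (\<lambda>x. F (u2 x) - F (u1 x))"
      using u1.Fu_cont u2.Fu_cont by (intro continuous_intros)
    show "F (u2 x0) - F (u1 x0) \<le> 0"
      using F_mono[OF mono, of "u2 x0" "u1 x0"] neg u1.u_range u2.u_range by (auto simp: v_def)
    show "(LINT x|lborel. v x * lap \<alpha> (bump a d) x) = (LINT x|lborel. (F (u2 x) - F (u1 x)) * bump a d x)"
      if c: "0 < d" "cball a d \<subseteq> D0 - closure D1" for a d
      unfolding v_def
    proof (rule weak_equation_diff[OF \<alpha> c(1) K(1) u2.u_cont u1.u_cont u2.Fu_cont u1.Fu_cont _ u2.weak_bump[OF c] u1.weak_bump[OF c]])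
      fix x assume "x \<notin> cball (0::'a) R"
      then have "x \<notin> D0" using R by (auto simp: subset_iff)
      then show "u2 x = 0 \<and> u1 x = 0 \<and> F (u2 x) = 0 \<and> F (u1 x) = 0"
        by (simp add: u1.u_outside u2.u_outside F_0)
    qed
  qed
  from this[of 0] neg have "v 0 < 0" by simp
  moreover have "0 \<in> closure D1" using zero closure_subset by blast
  ultimately show False using u1.u_inside[of 0] u2.u_inside[of 0] by (simp add: v_def)
qed

end

section \<open>Monotonicity along rays\<close>

context ring_sol
begin

text \<open>At a contact point the two values agree, so the difference has right-hand side
  \<open>(1 - t powr \<alpha>) * F (u x0) \<le> 0\<close> there and must be constant. Then
  \<open>u (y / t) = u y = 0\<close> for y on the frontier of \<open>D0\<close>, whereas
  \<open>y / t\<close> lies in \<open>D0\<close>, where \<open>u\<close> is positive.\<close>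

lemma scaled_contact:
  assumes \<gamma>: "\<gamma> \<le> \<beta>" and strict: "\<And>x. x \<in> D0 - closure D1 \<Longrightarrow> 0 < u x \<and> u x < 1"
    and t: "1 < t" and le: "\<And>x. u (t *\<^sub>R x) \<le> u x"
    and x0: "x0 \<in> D0 - closure D1" "t *\<^sub>R x0 \<in> D0 - closure D1"
  shows "u (t *\<^sub>R x0) < u x0"
proof (rule ccontr)
  assume "\<not> u (t *\<^sub>R x0) < u x0"
  with le[of x0] have eq: "u (t *\<^sub>R x0) = u x0" by simp
  define v where "v x = u x - u (t *\<^sub>R x)" for x
  define U where "U = (D0 - closure D1) \<inter> {x. t *\<^sub>R x \<in> D0 - closure D1}"
  obtain R where R: "R > 0" "D0 \<subseteq> ball 0 R" using outer_ball by blast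
  have out: "u y = 0" if "y \<notin> cball 0 R" for y
    using R that by (intro u_outside) (auto simp: subset_iff)
  have out': "u (t *\<^sub>R y) = 0" if "y \<notin> cball 0 R" for y
  proof (rule out)
    have "R < 1 * norm y" using that by simp
    also have "\<dots> \<le> t * norm y" using t by (intro mult_right_mono) auto
    finally show "t *\<^sub>R y \<notin> cball 0 R" using t by simp
  qed
  have sc: "continuous_on UNIV (\<lambda>x. t *\<^sub>R x :: 'a)" by (intro continuous_intros)
  have utc: "continuous_on UNIV (\<lambda>x. u (t *\<^sub>R x))"
    by (rule continuous_on_compose2[OF u_cont sc]) simp
  have Futc: "continuous_on UNIV (\<lambda>x. F (u (t *\<^sub>R x)))"
    by (rule continuous_on_compose2[OF Fu_cont sc]) simp
  have "open {x. t *\<^sub>R x \<in> D0 - closure D1}"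
    using continuous_open_vimage[OF ring_open, of "\<lambda>x. t *\<^sub>R x"] by (simp add: vimage_def)
  then have U: "open U" using ring_open by (simp add: U_def open_Int)
  have K: "compact (cball (0::'a) R)" "\<And>y. y \<notin> cball 0 R \<Longrightarrow> v y = 0"
    using out out' unfolding v_def by auto
  have "v x = v x0" for x
  proof (rule strong_min_principle[OF \<alpha> _ K _ U])
    show "continuous_on UNIV v" unfolding v_def[abs_def] using u_cont utc by (intro continuous_intros)
    show "continuous_on UNIV (\<lambda>x. F (u x) - t powr \<alpha> * F (u (t *\<^sub>R x)))"
      using Fu_cont Futc by (intro continuous_intros)
    show "x0 \<in> U" using x0 by (simp add: U_def)
    show "v x0 \<le> v x" for x using le[of x] eq by (simp add: v_def)
    have "1 \<le> t powr \<alpha>" using t \<alpha> by (simp add: ge_one_powr_ge_zero)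
    then have "1 * F (u x0) \<le> t powr \<alpha> * F (u x0)"
      using F_nonneg[OF \<gamma>, of "u x0"] u_range by (intro mult_right_mono) auto
    then show "F (u x0) - t powr \<alpha> * F (u (t *\<^sub>R x0)) \<le> 0" by (simp add: eq)
    show "(LINT x|lborel. v x * lap \<alpha> (bump a d) x)
        = (LINT x|lborel. (F (u x) - t powr \<alpha> * F (u (t *\<^sub>R x))) * bump a d x)"
      if d: "0 < d" and c: "cball a d \<subseteq> U" for a d
    proof -
      have c: "cball a d \<subseteq> D0 - closure D1" "cball a d \<subseteq> {x. t *\<^sub>R x \<in> D0 - closure D1}"
        using c by (auto simp: U_def)
      have "continuous_on UNIV (\<lambda>x. t powr \<alpha> * F (u (t *\<^sub>R x)))" using Futc by (intro continuous_intros)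
      then show ?thesis
        unfolding v_def
        by (rule weak_equation_diff[OF \<alpha> d K(1) u_cont utc Fu_cont])
          (use out out' F_0 weak_bump[OF d c(1)] weak_bump_scaled[OF d _ c(2)] t in auto)
    qed
  qed
  then have v0: "u x = u (t *\<^sub>R x)" for x using eq by (simp add: v_def)
  obtain y where y: "y \<in> frontier D0" using frontier_D0_point by blast
  have "(1 / t) *\<^sub>R y \<in> D0"
    using y t by (intro strictly_starshaped_scale_closure[OF D0(3,2,1)]) (auto simp: frontier_def)
  then have "0 < u ((1 / t) *\<^sub>R y)"
    using strict[of "(1 / t) *\<^sub>R y"] u_inside[of "(1 / t) *\<^sub>R y"] by (cases "(1 / t) *\<^sub>R y \<in> closure D1") auto
  moreover have "u y = 0" using y D0 by (intro u_outside) (simp add: frontier_def interior_open)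
  ultimately show False using v0[of "(1 / t) *\<^sub>R y"] t by simp
qed

text \<open>Equality of \<open>u (t x)\<close> and \<open>u x\<close> is trivial for every t, far
  out and near 0. The contact point at the last bad factor is therefore taken as a limit of points
  of strict violation, which forces it into the region where both equations are available.\<close>

lemma radially_decreasing:
  assumes \<gamma>: "\<gamma> \<le> \<beta>" and strict: "\<And>x. x \<in> D0 - closure D1 \<Longrightarrow> 0 < u x \<and> u x < 1"
    and "1 < t"
  shows "u (t *\<^sub>R x) \<le> u x"
proof (rule ccontr)
  assume n: "\<not> u (t *\<^sub>R x) \<le> u x"
  obtain R where R: "R > 0" "D0 \<subseteq> ball 0 R" using outer_ball by blast
  obtain r where r: "r > 0" "ball 0 r \<subseteq> D1" using zero D1(2) openE by blast
  define S where "S = {t. 1 < t \<and> (\<exists>x. u x < u (t *\<^sub>R x))}"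
  have tS: "t \<in> S" using assms n by (auto simp: S_def not_le)
  have pos_mem: "y \<in> D0" if "0 < u y" for y using that u_outside[of y] by fastforce
  have lt1_mem: "y \<notin> closure D1" if "u y < 1" for y using that u_inside[of y] by auto
  \<comment> \<open>For a larger factor, a point whose dilation lies in \<open>D0\<close> is in
    \<open>ball 0 r\<close>, where \<open>u\<close> already has its maximal value 1.\<close>
  have bdd: "s \<le> R / r" if "s \<in> S" for s
  proof (rule ccontr)
    assume s: "\<not> s \<le> R / r"
    obtain x where x: "1 < s" "u x < u (s *\<^sub>R x)" using \<open>s \<in> S\<close> by (auto simp: S_def)
    have "s *\<^sub>R x \<in> D0" using x u_range(1)[of x] by (intro pos_mem) linarith
    then have "s * norm x < R" using R x(1) by (auto simp: subset_iff)
    also have "R < s * r" using s r by (simp add: not_le field_simps)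
    finally have "x \<in> ball 0 r" using x(1) by simp
    then have "u x = 1" using r closure_subset[of D1] by (intro u_inside) auto
    with x u_range(2)[of "s *\<^sub>R x"] show False by simp
  qed
  then have bS: "bdd_above S" by (intro bdd_aboveI[of S "R / r"])
  define T where "T = Sup S"
  have T: "1 < T" using cSup_upper[OF tS bS] assms(3) by (simp add: T_def)
  have "\<exists>s\<in>S. T - 1 / Suc n < s" for n
    using less_cSup_iff[of S "T - 1 / Suc n"] tS bS by (auto simp: T_def[symmetric])
  then obtain s where s: "\<And>n. s n \<in> S" "\<And>n. T - 1 / Suc n < s n" by metis
  have sT: "s n \<le> T" for n using cSup_upper[OF s(1) bS] by (simp add: T_def)
  have slim: "s \<longlonglongrightarrow> T"
  proof (rule tendsto_sandwich[of "\<lambda>n. T - 1 / Suc n" s sequentially "\<lambda>n. T"])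
    show "(\<lambda>n. T - 1 / Suc n) \<longlonglongrightarrow> T"
      using tendsto_diff[OF tendsto_const LIMSEQ_inverse_real_of_nat, of T] by (simp add: inverse_eq_divide)
  qed (use s sT in \<open>auto intro!: always_eventually less_imp_le\<close>)
  have "\<exists>x. u x < u (s n *\<^sub>R x)" for n using s(1)[of n] by (auto simp: S_def)
  then obtain X where X: "\<And>n. u (X n) < u (s n *\<^sub>R X n)" by metis
  have sX: "s n *\<^sub>R X n \<in> D0" for n using X[of n] u_range(1)[of "X n"] by (intro pos_mem) linarith
  have Xc: "X n \<notin> closure D1" for n using X[of n] u_range(2)[of "s n *\<^sub>R X n"] by (intro lt1_mem) linarith
  have "X n \<in> cball 0 R" for n
  proof -
    have "1 * norm (X n) \<le> s n * norm (X n)" using s(1)[of n] by (intro mult_right_mono) (auto simp: S_def)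
    also have "\<dots> = norm (s n *\<^sub>R X n)" using s(1)[of n] by (simp add: S_def)
    also have "\<dots> < R" using sX[of n] R by (auto simp: subset_iff)
    finally show ?thesis by simp
  qed
  then obtain xs h where h: "strict_mono (h :: nat \<Rightarrow> nat)" "(X \<circ> h) \<longlonglongrightarrow> xs"
    using compact_cball[of "0::'a" R] unfolding compact_def by metis
  have sh: "(s \<circ> h) \<longlonglongrightarrow> T" using LIMSEQ_subseq_LIMSEQ[OF slim h(1)] .
  have sXl: "(\<lambda>n. (s \<circ> h) n *\<^sub>R (X \<circ> h) n) \<longlonglongrightarrow> T *\<^sub>R xs" using sh h(2) by (rule tendsto_scaleR)
  have uc: "isCont u y" for y using u_cont by (simp add: continuous_on_eq_continuous_at)
  have ge: "u xs \<le> u (T *\<^sub>R xs)"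
  proof (rule LIMSEQ_le[OF isCont_tendsto_compose[OF uc h(2)] isCont_tendsto_compose[OF uc sXl]])
    show "\<exists>N. \<forall>n\<ge>N. u ((X \<circ> h) n) \<le> u ((s \<circ> h) n *\<^sub>R (X \<circ> h) n)"
      using X by (auto intro!: exI[of _ 0] less_imp_le)
  qed
  \<comment> \<open>Factors beyond the supremum are good; the inequality at \<open>T\<close> follows
    from them by continuity.\<close>
  have le: "u (T *\<^sub>R y) \<le> u y" for y
  proof -
    have "(\<lambda>n. (T + 1 / Suc n) *\<^sub>R y) \<longlonglongrightarrow> T *\<^sub>R y"
      using tendsto_scaleR[OF tendsto_add[OF tendsto_const LIMSEQ_inverse_real_of_nat, of T] tendsto_const, of y]
      by (simp add: inverse_eq_divide)
    from isCont_tendsto_compose[OF uc this] show ?thesis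
    proof (rule LIMSEQ_le_const2)
      have "u ((T + 1 / Suc n) *\<^sub>R y) \<le> u y" for n
      proof -
        have "T + 1 / Suc n \<notin> S" using cSup_upper[OF _ bS, of "T + 1 / Suc n"] by (auto simp: T_def[symmetric])
        moreover have "0 < 1 / real (Suc n)" by simp
        with T have "1 < T + 1 / Suc n" by linarith
        ultimately show ?thesis by (auto simp: S_def not_less)
      qed
      then show "\<exists>N. \<forall>n\<ge>N. u ((T + 1 / Suc n) *\<^sub>R y) \<le> u y" by blast
    qed
  qed
  have eq: "u (T *\<^sub>R xs) = u xs" using ge le[of xs] by simp
  \<comment> \<open>In the limit only membership in closures survives. Strict starshapedness repairs
    this: shrinking \<open>T *\<^sub>R xs\<close> by \<open>1 / T\<close> leads from a closure into
    the open set.\<close>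
  have cl: "T *\<^sub>R xs \<in> closure D0"
    unfolding closure_sequential using sXl sX
    by (intro exI[of _ "\<lambda>n. (s \<circ> h) n *\<^sub>R (X \<circ> h) n"]) simp
  have "(1 / T) *\<^sub>R (T *\<^sub>R xs) \<in> D0"
    using T by (intro strictly_starshaped_scale_closure[OF D0(3,2,1) cl]) auto
  then have xD0: "xs \<in> D0" using T by simp
  have xD1: "xs \<notin> D1"
  proof
    assume "xs \<in> D1"
    with topological_tendstoD[OF h(2) D1(2)] have "\<forall>\<^sub>F n in sequentially. (X \<circ> h) n \<in> D1" by simp
    then obtain n where "(X \<circ> h) n \<in> D1" by (auto simp: eventually_sequentially)
    then show False using Xc[of "h n"] closure_subset[of D1] by auto
  qed
  have TD1: "T *\<^sub>R xs \<notin> closure D1"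
  proof
    assume "T *\<^sub>R xs \<in> closure D1"
    then have "(1 / T) *\<^sub>R (T *\<^sub>R xs) \<in> D1"
      using T by (intro strictly_starshaped_scale_closure[OF D1(3,2,1)]) auto
    then show False using xD1 T by simp
  qed
  \<comment> \<open>What remains is the frontier of \<open>D1\<close>: there \<open>u\<close> is 1,
    while \<open>T *\<^sub>R xs\<close> lies outside the closure and has a smaller value.\<close>
  have x1: "xs \<notin> closure D1"
  proof
    assume "xs \<in> closure D1"
    then have "u (T *\<^sub>R xs) = 1" using u_inside eq by simp
    then show False using strict[of "T *\<^sub>R xs"] TD1 pos_mem[of "T *\<^sub>R xs"] by auto
  qed
  have "0 < u xs" using strict[of xs] xD0 x1 by auto
  then have "T *\<^sub>R xs \<in> D0" using eq by (intro pos_mem) simp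
  then show False using scaled_contact[OF \<gamma> strict T le, of xs] xD0 x1 TD1 eq by auto
qed

lemma radially_strictly_decreasing:
  assumes \<gamma>: "\<gamma> \<le> \<beta>" and strict: "\<And>x. x \<in> D0 - closure D1 \<Longrightarrow> 0 < u x \<and> u x < 1"
    and t: "1 < t" and ut: "0 < u (t *\<^sub>R x)" "u (t *\<^sub>R x) < 1"
  shows "u (t *\<^sub>R x) < u x"
proof -
  have tx: "t *\<^sub>R x \<in> D0 - closure D1"
    using ut u_outside[of "t *\<^sub>R x"] u_inside[of "t *\<^sub>R x"] by fastforce
  then have "(1 / t) *\<^sub>R (t *\<^sub>R x) \<in> D0"
    using t closure_subset[of D0] by (intro strictly_starshaped_scale_closure[OF D0(3,2,1)]) auto
  then have x: "x \<in> D0" using t by simp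
  show ?thesis
  proof (cases "x \<in> closure D1")
    case True
    then show ?thesis using ut u_inside by simp
  next
    case False
    with x tx show ?thesis
      using scaled_contact[OF \<gamma> strict t radially_decreasing[OF \<gamma> strict t], of x] by auto
  qed
qed

text \<open>The frontier lies in the level set of l. A ray meets that set by the intermediate value
  theorem, and only once because \<open>u\<close> strictly decreases along the ray between the
  values 1 and 0.\<close>

lemma superlevel_strictly_starshaped:
  assumes \<gamma>: "\<gamma> \<le> \<beta>" and strict: "\<And>x. x \<in> D0 - closure D1 \<Longrightarrow> 0 < u x \<and> u x < 1"
    and l: "l \<in> {0<..<1}"
  shows "strictly_starshaped (superlevel u l)"
proof -
  let ?A = "superlevel u l"
  have dec: "u (t *\<^sub>R x) < u x" if "1 < t" "0 < u (t *\<^sub>R x)" "u (t *\<^sub>R x) < 1" for t x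
    using radially_strictly_decreasing[OF \<gamma> strict that] .
  have "closed ?A"
    using continuous_closed_vimage[of "{l..}" u] u_cont
    by (simp add: superlevel_def vimage_def continuous_on_eq_continuous_at)
  have front: "u x = l \<and> x \<notin> interior ?A" if "x \<in> frontier ?A" for x
  proof -
    have x: "x \<in> ?A" "x \<notin> interior ?A" using that \<open>closed ?A\<close> by (auto simp: frontier_def)
    have "open {x. l < u x}"
      using continuous_open_vimage[of "{l<..}" u] u_cont
      by (simp add: vimage_def continuous_on_eq_continuous_at)
    then have "{x. l < u x} \<subseteq> interior ?A" by (intro interior_maximal) (auto simp: superlevel_def)
    with x(2) have "\<not> l < u x" by blast
    with x show ?thesis by (simp add: superlevel_def)
  qed
  have u0: "u 0 = 1" using zero closure_subset[of D1] by (intro u_inside) auto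
  have "D1 \<subseteq> interior ?A"
    using D1 closure_subset[of D1] u_inside l by (intro interior_maximal) (auto simp: superlevel_def subset_iff)
  then have "0 \<in> interior ?A" using zero by auto
  moreover have "\<exists>!x. x \<in> ray v \<inter> frontier ?A" if v: "v \<noteq> 0" for v
  proof -
    obtain R where R: "R > 0" "D0 \<subseteq> ball 0 R" using outer_ball by blast
    define g where "g \<tau> = u (\<tau> *\<^sub>R v)" for \<tau>
    have "continuous_on UNIV g" unfolding g_def[abs_def]
      by (rule continuous_on_compose2[OF u_cont]) (auto intro: continuous_intros)
    moreover have "g (R / norm v) = 0" unfolding g_def using R v by (intro u_outside) auto
    moreover have "g 0 = 1" by (simp add: g_def u0)
    ultimately have "\<exists>\<tau>\<ge>0. \<tau> \<le> R / norm v \<and> g \<tau> = l"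
      using l R v by (intro IVT2') (auto intro: continuous_on_subset)
    then obtain \<tau> where \<tau>: "0 \<le> \<tau>" "u (\<tau> *\<^sub>R v) = l" by (auto simp: g_def)
    have "\<tau> \<noteq> 0" using \<tau> u0 l by auto
    \<comment> \<open>Slightly farther out on the ray \<open>u\<close> is below l, so the point
      cannot be interior.\<close>
    have "\<tau> *\<^sub>R v \<notin> interior ?A"
    proof
      assume "\<tau> *\<^sub>R v \<in> interior ?A"
      then obtain e where e: "e > 0" "cball (\<tau> *\<^sub>R v) e \<subseteq> ?A" unfolding mem_interior_cball by blast
      \<comment> \<open>The dilated point is at distance exactly \<open>e\<close>.\<close>
      define t where "t = 1 + e / (\<tau> * norm v)"
      have t: "1 < t" using e \<tau> \<open>\<tau> \<noteq> 0\<close> v by (simp add: t_def)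
      have "t *\<^sub>R (\<tau> *\<^sub>R v) - \<tau> *\<^sub>R v = (e / norm v) *\<^sub>R v"
        using \<open>\<tau> \<noteq> 0\<close> by (simp add: t_def algebra_simps)
      then have "dist (\<tau> *\<^sub>R v) (t *\<^sub>R (\<tau> *\<^sub>R v)) = e"
        using e v by (subst dist_commute) (simp add: dist_norm)
      then have "t *\<^sub>R (\<tau> *\<^sub>R v) \<in> cball (\<tau> *\<^sub>R v) e" by (simp only: mem_cball order_refl)
      then have "t *\<^sub>R (\<tau> *\<^sub>R v) \<in> ?A" using e(2) by blast
      then have "l \<le> u (t *\<^sub>R (\<tau> *\<^sub>R v))" by (simp only: superlevel_def mem_Collect_eq)
      moreover have "u (t *\<^sub>R (\<tau> *\<^sub>R v)) \<le> l"
        using radially_decreasing[OF \<gamma> strict t, of "\<tau> *\<^sub>R v"] \<tau> by simp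
      ultimately show False using dec[OF t, of "\<tau> *\<^sub>R v"] \<tau> l by auto
    qed
    then have ex: "\<tau> *\<^sub>R v \<in> ray v \<inter> frontier ?A"
      using \<tau> \<open>closed ?A\<close> by (auto simp: ray_def frontier_def superlevel_def)
    have less: False if "s *\<^sub>R v \<in> frontier ?A" "s' *\<^sub>R v \<in> frontier ?A" "0 \<le> s" "s < s'" for s s'
    proof -
      have us: "u (s *\<^sub>R v) = l" "u (s' *\<^sub>R v) = l" using front that by auto
      have "s \<noteq> 0" using us(1) u0 l by auto
      then have "1 < s' / s" "s' *\<^sub>R v = (s' / s) *\<^sub>R (s *\<^sub>R v)" using that by auto
      with dec[of "s' / s" "s *\<^sub>R v"] us l show False by auto
    qed
    show ?thesis
    proof (rule ex1I[where a = "\<tau> *\<^sub>R v"], rule ex)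
      fix y assume "y \<in> ray v \<inter> frontier ?A"
      then obtain s where s: "0 \<le> s" "y = s *\<^sub>R v" "s *\<^sub>R v \<in> frontier ?A" by (auto simp: ray_def)
      then show "y = \<tau> *\<^sub>R v"
        using less[of s \<tau>] less[of \<tau> s] ex \<tau> by (cases s \<tau> rule: linorder_cases) auto
    qed
  qed
  ultimately show ?thesis unfolding strictly_starshaped_def by blast
qed

end

section \<open>Existence\<close>

subsection \<open>Maximum principle and barriers for the truncated operator\<close>

text \<open>A measurable function need not attain its supremum \<open>M\<close>. At a point where it
  is within \<open>\<tau>\<close> of \<open>M\<close>, the increments gain at most
  \<open>\<tau>\<close> times the mass of the kernel, but lose a fixed multiple of \<open>M\<close>
  on a distant ball where \<open>v \<le> 0\<close>.\<close>

lemma trunc_max_principle: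
  fixes v :: "'a::euclidean_space \<Rightarrow> real"
  assumes \<alpha>: "0 < \<alpha>" and e: "0 < \<epsilon>" and v: "v \<in> borel_measurable borel" "\<And>x. \<bar>v x\<bar> \<le> B"
    and R: "\<And>x. 0 < v x \<Longrightarrow> norm x < R" and sub: "\<And>x. 0 < v x \<Longrightarrow> 0 \<le> trunc_lap \<alpha> \<epsilon> v x"
  shows "v x \<le> 0"
proof (rule ccontr)
  assume n: "\<not> v x \<le> 0"
  have R0: "R > 0" using R[of x] n norm_ge_zero[of x] by linarith
  have bdd: "bdd_above (range v)" using v(2) by (intro bdd_aboveI[of _ B]) (auto simp: abs_le_iff)
  define M where "M = Sup (range v)"
  have vM: "v y \<le> M" for y unfolding M_def by (rule cSup_upper[OF _ bdd]) simp
  have M: "M > 0" using vM[of x] n by linarith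
  let ?k = "LINT z::'a|lborel. tkern \<alpha> \<epsilon> z"
  have ki: "integrable lborel (tkern \<alpha> \<epsilon> :: 'a \<Rightarrow> real)" by (rule tkern_integrable[OF \<alpha> e])
  have k: "?k \<ge> 0" by (intro integral_nonneg_AE) (simp add: tkern_nonneg)
  obtain b :: 'a where b: "b \<in> Basis" using nonempty_Basis by blast
  \<comment> \<open>Far enough for the unit ball around \<open>a\<close> to avoid
    \<open>ball 0 R\<close> and to lie beyond the truncation length as seen from any point of that
    ball.\<close>
  define a where "a = (2 * R + \<epsilon> + 2) *\<^sub>R b"
  have a: "norm a = 2 * R + \<epsilon> + 2" using b R0 e by (simp add: a_def)
  define c where "c = measure lborel (ball a 1) * (3 * R + \<epsilon> + 3) powr - (real DIM('a) + \<alpha>)"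
  have "0 < measure lborel (ball a 1)" by (rule content_ball_pos) simp
  then have c: "c > 0" using R0 e by (simp add: c_def)
  \<comment> \<open>The first bound keeps \<open>v\<close> positive at the chosen point, the second
    limits the gain to half of the loss \<open>M * c\<close>.\<close>
  define \<tau> where "\<tau> = min (M / 2) (M * c / (2 * (?k + 1)))"
  have \<tau>: "\<tau> > 0" using M c k by (simp add: \<tau>_def)
  have \<tau>2: "\<tau> \<le> M / 2" unfolding \<tau>_def by (rule min.cobounded1)
  have "\<tau> * ?k \<le> M * c / (2 * (?k + 1)) * ?k" using k by (intro mult_right_mono) (auto simp: \<tau>_def)
  also have "\<dots> \<le> M * c / 2" using M c k by (simp add: field_simps)
  finally have \<tau>k: "\<tau> * ?k \<le> M * c / 2" .
  have "M - \<tau> < Sup (range v)" using \<tau> by (simp add: M_def)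
  then obtain y where y: "M - \<tau> < v y" using less_cSup_iff[OF _ bdd] by auto
  then have vy: "0 < v y" using \<tau>2 M by linarith
  let ?S = "ball a 1"
  have [measurable]: "?S \<in> sets borel" by simp
  have S: "\<epsilon> < norm (q - y) \<and> norm (q - y) \<le> 3 * R + \<epsilon> + 3 \<and> R \<le> norm q" if "q \<in> ?S" for q
  proof -
    have "norm a \<le> norm (a - q) + norm (q - y) + norm y" "norm a \<le> norm (a - q) + norm q"
      "norm (q - y) \<le> norm q + norm y" "norm q \<le> norm (a - q) + norm a"
      using norm_triangle_ineq[of "a - q" "q - y"] norm_triangle_ineq[of "a - y" y]
        norm_triangle_ineq[of "a - q" q] norm_triangle_ineq4[of q y] norm_triangle_ineq4[of a "a - q"] by auto
    then show ?thesis using that R[OF vy] a e by (auto simp: dist_norm)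
  qed
  have Si: "integrable lborel (\<lambda>z. indicator ?S (y + z) * tkern \<alpha> \<epsilon> z)"
    by (rule integrable_bounded_times_tkern[OF \<alpha> e, of _ 1]) auto
  have "trunc_lap \<alpha> \<epsilon> v y \<le> (LINT z|lborel. \<tau> * tkern \<alpha> \<epsilon> z - M * (indicator ?S (y + z) * tkern \<alpha> \<epsilon> z))"
    unfolding trunc_lap_def
  proof (rule integral_mono)
    show "integrable lborel (\<lambda>z. (v (y + z) - v y) * tkern \<alpha> \<epsilon> z)" by (rule trunc_lap_integrable[OF \<alpha> e v])
    show "integrable lborel (\<lambda>z. \<tau> * tkern \<alpha> \<epsilon> z - M * (indicator ?S (y + z) * tkern \<alpha> \<epsilon> z))"
      using ki Si by (intro Bochner_Integration.integrable_diff integrable_mult_right)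
    fix z
    have "v (y + z) - v y \<le> \<tau> - M * indicator ?S (y + z)"
    proof (cases "y + z \<in> ?S")
      case True
      then have "v (y + z) \<le> 0" using S[of "y + z"] R[of "y + z"] by linarith
      then show ?thesis using True y by simp
    qed (use vM[of "y + z"] y in simp)
    from mult_right_mono[OF this tkern_nonneg]
    show "(v (y + z) - v y) * tkern \<alpha> \<epsilon> z \<le> \<tau> * tkern \<alpha> \<epsilon> z - M * (indicator ?S (y + z) * tkern \<alpha> \<epsilon> z)"
      by (simp add: left_diff_distrib mult.assoc)
  qed
  also have "\<dots> = \<tau> * ?k - M * (LINT z|lborel. indicator ?S (y + z) * tkern \<alpha> \<epsilon> z)"
    using ki Si by simp
  also have "\<dots> \<le> \<tau> * ?k - M * c"
  proof -
    have "c \<le> (LINT z|lborel. indicator ?S (y + z) * tkern \<alpha> \<epsilon> z)"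
      unfolding c_def using S by (intro integral_tkern_ball_ge[OF \<alpha> e]) blast
    then show ?thesis using M by simp
  qed
  also have "\<dots> < 0" using \<tau>k M c by (smt (verit) mult_pos_pos field_sum_of_halves)
  finally show False using sub[OF vy] by simp
qed

text \<open>Young's inequality with second factor 1: the concave power lies below its tangent at
  1.\<close>

lemma powr_le_tangent:
  fixes b a :: real
  assumes "0 \<le> a" "a \<le> 1" "0 \<le> b"
  shows "b powr a \<le> 1 + a * (b - 1)"
proof (cases "b = 0")
  case False
  then show ?thesis using Youngs_inequality_0[of a "1 - a" b 1] assms by (simp add: algebra_simps)
qed (use assms in simp)

text \<open>The barrier is \<open>W = C (|x - \<xi>|\<^sup>2 + 4 \<epsilon>\<^sup>2)\<^bsup>q/2\<^esup>\<close> off the exterior set \<open>E\<close>, cut to zero on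
  \<open>E\<close>. As \<open>q\<close> tends to zero the positive contributions to the operator vanish, by concavity of
  \<open>t \<mapsto> t\<^bsup>q/2\<^esup>\<close>, while the mass missing in \<open>E\<close> contributes a fixed negative multiple of the same
  power of the scale \<open>R\<close>. The summand \<open>4 \<epsilon>\<^sup>2\<close> keeps \<open>R\<close> above the truncation length.\<close>

lemma boundary_barrier:
  fixes r0 \<kappa> M :: real
  assumes \<alpha>: "0 < \<alpha>" "\<alpha> < 2" and \<kappa>: "0 < \<kappa>" "\<kappa> \<le> 1 / 4" and r0: "0 < r0" and M: "0 \<le> M"
  shows "\<exists>C>0. \<exists>q>0. \<forall>\<epsilon>>0. \<forall>v \<xi> E.
    v \<in> borel_measurable borel \<longrightarrow> (\<forall>x. 0 \<le> v x \<and> v x \<le> 1) \<longrightarrow>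
    E \<in> sets borel \<longrightarrow> (\<forall>x\<in>E. v x = 0) \<longrightarrow>
    (\<forall>r\<in>{0<..r0}. \<exists>e. norm e = 1 \<and> ball (\<xi> + (r / 2) *\<^sub>R e) (\<kappa> * r) \<subseteq> E) \<longrightarrow>
    (\<forall>x. x \<notin> E \<longrightarrow> norm (x - \<xi>) < r0 / 8 \<longrightarrow> - M \<le> trunc_lap \<alpha> \<epsilon> v x) \<longrightarrow>
    (\<forall>x::'a::euclidean_space. v x \<le> C * sqrt ((norm (x - \<xi>))\<^sup>2 + 4 * \<epsilon>\<^sup>2) powr q)"
proof -
  \<comment> \<open>A fixed reference exponent below \<alpha>. Far away, growth of order q is
    estimated by \<open>q / \<sigma>\<close> times growth of order \<open>\<sigma>\<close>, so that
    smallness comes from q alone.\<close>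
  define \<sigma> where "\<sigma> = \<alpha> / 2"
  have \<sigma>: "0 < \<sigma>" "\<sigma> < \<alpha>" "\<sigma> < 1" using \<alpha> by (auto simp: \<sigma>_def)
  obtain A where A: "A \<ge> 0" "\<And>R. R > 0 \<Longrightarrow> integrable lborel (\<lambda>z::'a. indicator {z. norm z \<le> R} z * (norm z)\<^sup>2 * kern \<alpha> z)"
    "\<And>R. R > 0 \<Longrightarrow> (LINT z::'a|lborel. indicator {z. norm z \<le> R} z * (norm z)\<^sup>2 * kern \<alpha> z) \<le> A * R powr (2 - \<alpha>)"
    using kern_inner[OF \<alpha>, where 'a='a] by blast
  obtain A' where A': "A' \<ge> 0" "\<And>R. R > 0 \<Longrightarrow> integrable lborel (\<lambda>z::'a. indicator {z. R < norm z} z * norm z powr \<sigma> * kern \<alpha> z)"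
    "\<And>R. R > 0 \<Longrightarrow> (LINT z::'a|lborel. indicator {z. R < norm z} z * norm z powr \<sigma> * kern \<alpha> z) \<le> A' * R powr (\<sigma> - \<alpha>)"
    using kern_outer[of \<sigma> \<alpha>, where 'a='a] \<sigma> by auto
  \<comment> \<open>The volume of a ball of radius \<open>8 * \<kappa> * R\<close> times the kernel
    at distance \<open>9 * R\<close>, with the power \<open>R powr - \<alpha>\<close> taken
    out.\<close>
  define c0 where "c0 = unit_ball_vol DIM('a) * (8 * \<kappa>) ^ DIM('a) * 9 powr - (real DIM('a) + \<alpha>)"
  have c0: "c0 > 0" using \<kappa> by (simp add: c0_def)
  define Q where "Q = A / 2 + 2 powr \<sigma> / \<sigma> * A'"
  have Q: "Q \<ge> 0" using A A' \<sigma> by (simp add: Q_def)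
  \<comment> \<open>\<open>Q\<close> collects the coefficients of q in the near and far estimates;
    this q lets the gain use up at most half of the loss \<open>c0\<close>.\<close>
  define q where "q = min \<sigma> (c0 / (2 * (Q + 1)))"
  have q: "0 < q" "q \<le> \<sigma>" "q < 1" "q < \<alpha>" using \<sigma> c0 Q by (auto simp: q_def)
  have "q * Q \<le> c0 / (2 * (Q + 1)) * Q" using Q by (intro mult_right_mono) (auto simp: q_def)
  also have "\<dots> \<le> c0 / 2" using Q c0 by (simp add: field_simps)
  finally have qQ: "q * Q \<le> c0 / 2" .
  define r1 where "r1 = r0 / 8"
  have r1: "r1 > 0" using r0 by (simp add: r1_def)
  \<comment> \<open>The first entry makes the barrier at least 1 from distance \<open>r1\<close> on,
    where the claim is trivial; with the second, the remaining half of the loss absorbs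
    \<open>M\<close>.\<close>
  define C where "C = max (r1 powr - q) (2 * M / c0 * r1 powr (\<alpha> - q))"
  have C: "C > 0" "1 \<le> C * r1 powr q" "M \<le> C * (c0 / 2) * r1 powr (q - \<alpha>)"
  proof -
    show "C > 0" using r1 by (simp add: C_def less_max_iff_disj)
    have "1 = r1 powr - q * r1 powr q" using r1 by (simp add: powr_add[symmetric])
    also have "\<dots> \<le> C * r1 powr q" by (intro mult_right_mono) (auto simp: C_def)
    finally show "1 \<le> C * r1 powr q" .
    have "M = (2 * M / c0 * r1 powr (\<alpha> - q)) * (c0 / 2) * r1 powr (q - \<alpha>)"
      using r1 c0 by (simp add: powr_diff field_simps)
    also have "\<dots> \<le> C * (c0 / 2) * r1 powr (q - \<alpha>)"
      using c0 by (intro mult_right_mono) (auto simp: C_def)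
    finally show "M \<le> C * (c0 / 2) * r1 powr (q - \<alpha>)" .
  qed
  have main: "v x \<le> C * sqrt ((norm (x - \<xi>))\<^sup>2 + 4 * \<epsilon>\<^sup>2) powr q"
    if e: "0 < \<epsilon>" and v[measurable]: "v \<in> borel_measurable borel" and v01: "\<And>x. 0 \<le> v x \<and> v x \<le> 1"
      and E[measurable]: "E \<in> sets borel" and vE: "\<And>x. x \<in> E \<Longrightarrow> v x = 0"
      and balls: "\<And>r. 0 < r \<Longrightarrow> r \<le> r0 \<Longrightarrow> \<exists>e. norm e = 1 \<and> ball (\<xi> + (r / 2) *\<^sub>R e) (\<kappa> * r) \<subseteq> E"
      and sub: "\<And>x. x \<notin> E \<Longrightarrow> norm (x - \<xi>) < r0 / 8 \<Longrightarrow> - M \<le> trunc_lap \<alpha> \<epsilon> v x"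
    for \<epsilon> \<xi> E x and v :: "'a \<Rightarrow> real"
  proof -
    define \<rho> where "\<rho> y = sqrt ((norm (y - \<xi>))\<^sup>2 + 4 * \<epsilon>\<^sup>2)" for y
    have \<rho>e: "2 * \<epsilon> \<le> \<rho> y" "norm (y - \<xi>) \<le> \<rho> y" for y
      unfolding \<rho>_def using e by (auto intro!: real_le_rsqrt simp: power_mult_distrib)
    have \<rho>0: "0 < \<rho> y" for y using \<rho>e(1)[of y] e by linarith
    define W where "W y = C * \<rho> y powr q" for y
    \<comment> \<open>The cap keeps the comparison function bounded. As \<open>v \<le> 1\<close>,
      only points with \<open>W < 1\<close> have to be examined.\<close>
    define W' where "W' y = (if y \<in> E then 0 else min 1 (W y))" for y
    have [measurable]: "\<rho> \<in> borel_measurable borel" unfolding \<rho>_def[abs_def] by measurable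
    have [measurable]: "W' \<in> borel_measurable borel" unfolding W'_def[abs_def] W_def[abs_def] by measurable
    have W0: "0 \<le> W y" for y using C by (simp add: W_def)
    have W'1: "0 \<le> W' y" "W' y \<le> 1" "W' y \<le> W y" for y using W0[of y] by (auto simp: W'_def)
    have W'B: "\<bar>W' y\<bar> \<le> 1" for y using W'1[of y] by simp
    have vB: "\<bar>v y\<bar> \<le> 1" for y using v01[of y] by simp
    have W1: "\<rho> y < r1" if "W y < 1" for y
    proof (rule ccontr)
      assume "\<not> \<rho> y < r1"
      then have "r1 powr q \<le> \<rho> y powr q" using r1 q by (intro powr_mono2) auto
      then have "C * r1 powr q \<le> W y" using C by (simp add: W_def)
      then show False using C that by linarith
    qed
    have super: "trunc_lap \<alpha> \<epsilon> W' y \<le> - M" if yE: "y \<notin> E" and Wy: "W y < 1" for y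
    proof -
      define R where "R = \<rho> y"
      have R: "0 < R" "R < r1" "2 * \<epsilon> \<le> R" "norm (y - \<xi>) \<le> R"
        using \<rho>0 W1[OF Wy] \<rho>e[of y] by (auto simp: R_def)
      define w where "w = W y"
      have w: "w = C * R powr q" "0 < w" "W' y = w" using R C Wy yE by (auto simp: w_def W_def R_def W'_def)
      \<comment> \<open>At scale \<open>8 * R\<close> the exterior ball lies at distance between
        \<open>R\<close> and \<open>9 * R\<close> from \<open>y\<close>: in the far region, and
        beyond the truncation length because \<open>2 * \<epsilon> \<le> R\<close>.\<close>
      obtain e where en: "norm e = 1" and eb: "ball (\<xi> + (8 * R / 2) *\<^sub>R e) (\<kappa> * (8 * R)) \<subseteq> E"
        using balls[of "8 * R"] R r0 by (auto simp: r1_def)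
      define S where "S = ball (\<xi> + (8 * R / 2) *\<^sub>R e) (\<kappa> * (8 * R))"
      have [measurable]: "S \<in> sets borel" by (simp add: S_def)
      have S: "R < norm (a - y) \<and> norm (a - y) \<le> 9 * R" if "a \<in> S" for a
      proof -
        have d: "norm (\<xi> + (8 * R / 2) *\<^sub>R e - a) < 2 * R"
        proof -
          have "\<kappa> * (8 * R) \<le> 2 * R" using mult_right_mono[OF \<kappa>(2), of "8 * R"] R by simp
          moreover have "norm (\<xi> + (8 * R / 2) *\<^sub>R e - a) < \<kappa> * (8 * R)"
            using that by (simp only: S_def mem_ball dist_norm)
          ultimately show ?thesis by (rule less_le_trans[rotated])
        qed
        have n4: "norm ((8 * R / 2) *\<^sub>R e) = 4 * R" using en R by simp
        have "norm ((8 * R / 2) *\<^sub>R e) \<le> norm (\<xi> + (8 * R / 2) *\<^sub>R e - a) + norm (a - y) + norm (y - \<xi>)"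
          using norm_triangle_ineq[of "\<xi> + (8 * R / 2) *\<^sub>R e - a" "a - y"]
            norm_triangle_ineq[of "\<xi> + (8 * R / 2) *\<^sub>R e - y" "y - \<xi>"] by (simp add: algebra_simps)
        moreover have "norm (a - y) \<le> norm (\<xi> + (8 * R / 2) *\<^sub>R e - a) + norm ((8 * R / 2) *\<^sub>R e) + norm (y - \<xi>)"
          using norm_triangle_ineq4[of "(8 * R / 2) *\<^sub>R e" "\<xi> + (8 * R / 2) *\<^sub>R e - a"]
            norm_triangle_ineq4[of "a - \<xi>" "y - \<xi>"] by (simp add: algebra_simps)
        ultimately show ?thesis using d n4 R by linarith
      qed
      \<comment> \<open>The majorant consists of the linear term of the tangent, which is odd and
        integrates to 0, the quadratic remainder, the far growth and the loss on \<open>S\<close>.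
        \<open>H1\<close> keeps the truncated kernel because \<open>|z|\<close> times the full
        kernel is not integrable at 0 when \<alpha> \<ge> 1.\<close>
      define H1 where "H1 z = indicator {z. norm z \<le> R} z * ((y - \<xi>) \<bullet> z) * tkern \<alpha> \<epsilon> z" for z
      define H2 where "H2 z = indicator {z. norm z \<le> R} z * (norm z)\<^sup>2 * kern \<alpha> z" for z :: 'a
      define H3 where "H3 z = indicator {z. R < norm z} z * norm z powr \<sigma> * kern \<alpha> z" for z :: 'a
      define H4 where "H4 z = indicator S (y + z) * tkern \<alpha> \<epsilon> z" for z
      define H where "H z = q / R\<^sup>2 * H1 z + q / (2 * R\<^sup>2) * H2 z + q / \<sigma> * (2 powr \<sigma> * R powr - \<sigma>) * H3 z - H4 z" for z
      have [measurable]: "H1 \<in> borel_measurable borel" unfolding H1_def[abs_def] by measurable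
      have i1: "integrable lborel H1"
        unfolding H1_def[abs_def]
      proof (rule integrable_bounded_times_tkern[OF \<alpha>(1) e, of _ "norm (y - \<xi>) * R"])
        show "\<bar>indicator {z. norm z \<le> R} z * ((y - \<xi>) \<bullet> z)\<bar> \<le> norm (y - \<xi>) * R" for z
          using Cauchy_Schwarz_ineq2[of "y - \<xi>" z] mult_left_mono[of "norm z" R "norm (y - \<xi>)"] R
          by (auto simp: indicator_def)
      qed measurable
      have i2: "integrable lborel H2" and I2: "(LINT z|lborel. H2 z) \<le> A * R powr (2 - \<alpha>)"
        using A(2,3)[OF R(1)] unfolding H2_def by auto
      have i3: "integrable lborel H3" and I3: "(LINT z|lborel. H3 z) \<le> A' * R powr (\<sigma> - \<alpha>)"
        using A'(2,3)[OF R(1)] unfolding H3_def by auto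
      have i4: "integrable lborel H4" unfolding H4_def[abs_def]
        by (rule integrable_bounded_times_tkern[OF \<alpha>(1) e, of _ 1]) auto
      have iH: "integrable lborel (\<lambda>z. w * H z)" unfolding H_def using i1 i2 i3 i4 by simp
      have "(LINT z|lborel. H1 z) = (LINT z|lborel. H1 (- z))" by (rule lborel_reflect_integral) measurable
      also have "\<dots> = (LINT z|lborel. - H1 z)" by (simp add: H1_def tkern_minus indicator_def)
      finally have I1: "(LINT z|lborel. H1 z) = 0" by simp
      have I4: "c0 * R powr - \<alpha> \<le> (LINT z|lborel. H4 z)"
      proof -
        have "measure lborel S = unit_ball_vol DIM('a) * (8 * \<kappa>) ^ DIM('a) * R ^ DIM('a)"
          unfolding S_def using \<kappa> R by (subst content_ball) (auto simp: power_mult_distrib mult_ac)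
        moreover have "(9 * R) powr - (real DIM('a) + \<alpha>) = 9 powr - (real DIM('a) + \<alpha>) * (R powr - real DIM('a) * R powr - \<alpha>)"
          using R by (simp add: powr_mult powr_add[symmetric])
        moreover have "R ^ DIM('a) * R powr - real DIM('a) = 1"
          using R by (simp add: powr_realpow[symmetric] powr_add[symmetric])
        moreover have "m * x = V * K * n * a" if "m = V * K * P" "x = n * (B * a)" "P * B = 1" for m x V K n a P B :: real
          using that by algebra
        ultimately have "measure lborel S * (9 * R) powr - (real DIM('a) + \<alpha>) = c0 * R powr - \<alpha>"
          unfolding c0_def by blast
        moreover have "measure lborel S * (9 * R) powr - (real DIM('a) + \<alpha>) \<le> (LINT z|lborel. H4 z)"
          unfolding H4_def S_def
        proof (rule integral_tkern_ball_ge[OF \<alpha>(1) e])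
          show "\<epsilon> < norm (a - y) \<and> norm (a - y) \<le> 9 * R"
            if "a \<in> ball (\<xi> + (8 * R / 2) *\<^sub>R e) (\<kappa> * (8 * R))" for a
            using S[of a] that R \<open>0 < \<epsilon>\<close> by (auto simp: S_def)
        qed
        ultimately show ?thesis by simp
      qed
      have IH: "(LINT z|lborel. H z) \<le> - (c0 / 2) * R powr - \<alpha>"
      proof -
        have "(LINT z|lborel. H z) = q / (2 * R\<^sup>2) * (LINT z|lborel. H2 z)
            + q / \<sigma> * (2 powr \<sigma> * R powr - \<sigma>) * (LINT z|lborel. H3 z) - (LINT z|lborel. H4 z)"
          unfolding H_def using i1 i2 i3 i4 I1 by simp
        moreover have "q / (2 * R\<^sup>2) * (LINT z|lborel. H2 z) \<le> q / (2 * R\<^sup>2) * (A * R powr (2 - \<alpha>))"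
          using I2 q by (intro mult_left_mono) auto
        moreover have "q / (2 * R\<^sup>2) * (A * R powr (2 - \<alpha>)) = q * (A / 2) * R powr - \<alpha>"
          using R by (simp add: powr_diff powr_minus field_simps)
        moreover have "q / \<sigma> * (2 powr \<sigma> * R powr - \<sigma>) * (LINT z|lborel. H3 z)
            \<le> q / \<sigma> * (2 powr \<sigma> * R powr - \<sigma>) * (A' * R powr (\<sigma> - \<alpha>))"
          using I3 q \<sigma> by (intro mult_left_mono) auto
        moreover have "q / \<sigma> * (2 powr \<sigma> * R powr - \<sigma>) * (A' * R powr (\<sigma> - \<alpha>)) = q * (2 powr \<sigma> / \<sigma> * A') * R powr - \<alpha>"
          using R \<sigma> by (simp add: powr_diff powr_minus field_simps)
        moreover have "q * (A / 2) * R powr - \<alpha> + q * (2 powr \<sigma> / \<sigma> * A') * R powr - \<alpha> = q * Q * R powr - \<alpha>"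
          unfolding Q_def distrib_left distrib_right ..
        moreover have "q * Q * R powr - \<alpha> \<le> c0 / 2 * R powr - \<alpha>"
          using qQ by (intro mult_right_mono) auto
        ultimately show ?thesis using I4 by linarith
      qed
      have "trunc_lap \<alpha> \<epsilon> W' y \<le> (LINT z|lborel. w * H z)"
        unfolding trunc_lap_def
      proof (rule integral_mono[OF trunc_lap_integrable[OF \<alpha>(1) e _ W'B] iH])
        fix z
        have WR: "W (y + z) = w * ((\<rho> (y + z))\<^sup>2 / R\<^sup>2) powr (q / 2)"
        proof -
          have "((\<rho> (y + z))\<^sup>2 / R\<^sup>2) powr (q / 2) = (\<rho> (y + z) / R) powr q"
          proof -
            have "X\<^sup>2 powr (q / 2) = X powr q" if "0 < X" for X :: real
            proof -
              have "X\<^sup>2 = X powr 2" using that by simp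
              then show ?thesis by (simp only: powr_powr) simp
            qed
            from this[of "\<rho> (y + z) / R"] show ?thesis
              using \<rho>0[of "y + z"] R by (simp only: power_divide) simp
          qed
          then show ?thesis using R \<rho>0[of "y + z"] by (simp add: W_def w powr_divide)
        qed
        have \<rho>sq: "(\<rho> (y + z))\<^sup>2 = R\<^sup>2 + 2 * ((y - \<xi>) \<bullet> z) + (norm z)\<^sup>2"
        proof -
          have "(norm (y + z - \<xi>))\<^sup>2 = (norm (y - \<xi>))\<^sup>2 + 2 * ((y - \<xi>) \<bullet> z) + (norm z)\<^sup>2"
            using dot_norm[of "y - \<xi>" z] by (simp add: add_diff_eq diff_add_eq add.commute field_simps)
          moreover have "(\<rho> a)\<^sup>2 = (norm (a - \<xi>))\<^sup>2 + 4 * \<epsilon>\<^sup>2" for a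
            unfolding \<rho>_def by (rule real_sqrt_pow2) simp
          ultimately show ?thesis by (simp add: R_def)
        qed
        show "(W' (y + z) - W' y) * tkern \<alpha> \<epsilon> z \<le> w * H z"
        proof (cases "norm z \<le> R")
          case True
          \<comment> \<open>Near \<open>y\<close>: the tangent at 1 of the power
            \<open>q / 2\<close>, applied to the ratio of squared scales.\<close>
          have "W (y + z) \<le> w * (1 + q / 2 * ((\<rho> (y + z))\<^sup>2 / R\<^sup>2 - 1))"
            unfolding WR using q w R by (intro mult_left_mono powr_le_tangent) auto
          also have "(\<rho> (y + z))\<^sup>2 / R\<^sup>2 - 1 = (2 * ((y - \<xi>) \<bullet> z) + (norm z)\<^sup>2) / R\<^sup>2"
            unfolding \<rho>sq using R by (simp add: field_simps)
          finally have Wle: "W (y + z) \<le> w * (1 + q / 2 * ((2 * ((y - \<xi>) \<bullet> z) + (norm z)\<^sup>2) / R\<^sup>2))" .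
          have le: "W' (y + z) - W' y \<le> w * (q / R\<^sup>2 * ((y - \<xi>) \<bullet> z) + q / (2 * R\<^sup>2) * (norm z)\<^sup>2)"
          proof -
            have "w * (1 + q / 2 * ((2 * s + n) / R\<^sup>2)) = w + w * (q / R\<^sup>2 * s + q / (2 * R\<^sup>2) * n)" for s n
              using R by (simp add: field_simps)
            then show ?thesis using W'1(3)[of "y + z"] w(3) Wle by simp
          qed
          have "(W' (y + z) - W' y) * tkern \<alpha> \<epsilon> z \<le> w * (q / R\<^sup>2 * H1 z + q / (2 * R\<^sup>2) * ((norm z)\<^sup>2 * tkern \<alpha> \<epsilon> z))"
          proof -
            have "H1 z = ((y - \<xi>) \<bullet> z) * tkern \<alpha> \<epsilon> z" using True by (simp add: H1_def)
            moreover have "w * (a * s + b * n) * k = w * (a * (s * k) + b * (n * k))" for a b s n k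
              by (simp only: distrib_right distrib_left mult.assoc)
            ultimately show ?thesis
              using mult_right_mono[OF le tkern_nonneg[of \<alpha> \<epsilon> z]] by (simp only:)
          qed
          also have "\<dots> \<le> w * (q / R\<^sup>2 * H1 z + q / (2 * R\<^sup>2) * H2 z)"
          proof -
            have "(norm z)\<^sup>2 * tkern \<alpha> \<epsilon> z \<le> H2 z"
              using True by (auto simp: H2_def tkern_def indicator_def kern_nonneg)
            then show ?thesis using w q by (intro mult_left_mono add_left_mono) auto
          qed
          also have "\<dots> = w * H z"
          proof -
            have "y + z \<notin> S" using S[of "y + z"] True by auto
            then show ?thesis using True by (simp add: H_def H3_def H4_def)
          qed
          finally show ?thesis .
        next
          case False
          then have zR: "R < norm z" by simp
          have tk: "tkern \<alpha> \<epsilon> z = kern \<alpha> z" using zR R \<open>0 < \<epsilon>\<close> by (simp add: tkern_def)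
          have Hz: "H z = (q / \<sigma> * (2 powr \<sigma> * R powr - \<sigma>) * norm z powr \<sigma> - indicator S (y + z)) * tkern \<alpha> \<epsilon> z"
            using zR by (simp add: H_def H1_def H2_def H3_def H4_def tk left_diff_distrib)
          let ?g = "q / \<sigma> * (2 powr \<sigma> * R powr - \<sigma>) * norm z powr \<sigma>"
          have g0: "?g \<ge> 0" using q \<sigma> by simp
          have "W' (y + z) - W' y \<le> w * (?g - indicator S (y + z))"
          proof (cases "y + z \<in> S")
            case True
            then have "W' (y + z) = 0" using eb by (auto simp: W'_def S_def)
            moreover have "0 \<le> w * ?g" using mult_nonneg_nonneg[OF less_imp_le[OF w(2)] g0] .
            ultimately show ?thesis using True w(3) by (simp add: right_diff_distrib)
          next
            case False
            have \<rho>le: "\<rho> (y + z) \<le> R + norm z"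
            proof (rule power2_le_imp_le)
              have "(y - \<xi>) \<bullet> z \<le> norm (y - \<xi>) * norm z" by (rule norm_cauchy_schwarz)
              also have "\<dots> \<le> R * norm z" using R by (intro mult_right_mono) auto
              finally show "(\<rho> (y + z))\<^sup>2 \<le> (R + norm z)\<^sup>2" unfolding \<rho>sq by (simp add: power2_sum)
            qed (use R in auto)
            \<comment> \<open>Writing \<open>(1 + |z|/R)^q\<close> as \<open>b^(q/\<sigma>)\<close>
              lets the tangent inequality produce the small factor
              \<open>q / \<sigma>\<close>.\<close>
            define b where "b = (1 + norm z / R) powr \<sigma>"
            have "W (y + z) \<le> C * (R + norm z) powr q"
              unfolding W_def using C \<rho>le \<rho>0[of "y + z"] q by (intro mult_left_mono powr_mono2) auto
            also have "\<dots> = w * (1 + norm z / R) powr q"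
            proof -
              have "R + norm z = R * (1 + norm z / R)" using R by (simp add: field_simps)
              then show ?thesis using R by (simp add: w powr_mult)
            qed
            also have "(1 + norm z / R) powr q = b powr (q / \<sigma>)"
              using \<sigma> by (simp add: b_def powr_powr)
            finally have "W (y + z) \<le> w * b powr (q / \<sigma>)" .
            also have "\<dots> \<le> w * (1 + q / \<sigma> * (b - 1))"
              using w q \<sigma> by (intro mult_left_mono powr_le_tangent) (auto simp: b_def)
            also have "\<dots> \<le> w * (1 + q / \<sigma> * (2 powr \<sigma> * R powr - \<sigma> * norm z powr \<sigma>))"
            proof -
              have "b \<le> (2 * norm z / R) powr \<sigma>"
                unfolding b_def using zR R \<sigma> by (intro powr_mono2) (auto simp: field_simps)
              also have "\<dots> = 2 powr \<sigma> * R powr - \<sigma> * norm z powr \<sigma>"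
                using R by (simp add: powr_mult powr_divide powr_minus field_simps)
              finally have "b - 1 \<le> 2 powr \<sigma> * R powr - \<sigma> * norm z powr \<sigma>" by simp
              then show ?thesis using w q \<sigma> by (intro mult_left_mono add_left_mono) auto
            qed
            finally have Wle: "W (y + z) \<le> w * (1 + q / \<sigma> * (2 powr \<sigma> * R powr - \<sigma> * norm z powr \<sigma>))" .
            show ?thesis
            proof -
              from Wle have "W (y + z) \<le> w + w * ?g" by (simp only: distrib_left mult.assoc mult_1_right)
              then show ?thesis using W'1(3)[of "y + z"] w(3) False by simp
            qed
          qed
          from mult_right_mono[OF this tkern_nonneg[of \<alpha> \<epsilon> z]] show ?thesis
            unfolding Hz by (simp add: mult.assoc)
        qed
      qed measurable
      also have "\<dots> = w * (LINT z|lborel. H z)" by simp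
      also have "\<dots> \<le> w * (- (c0 / 2) * R powr - \<alpha>)" using IH w by (intro mult_left_mono) auto
      also have "\<dots> = - (C * (c0 / 2) * R powr (q - \<alpha>))"
        using R by (simp add: w powr_diff powr_minus field_simps)
      also have "\<dots> \<le> - (C * (c0 / 2) * r1 powr (q - \<alpha>))"
        using R q C c0 by (intro le_imp_neg_le mult_left_mono powr_mono2') auto
      also have "\<dots> \<le> - M" using C by simp
      finally show ?thesis .
    qed
    \<comment> \<open>Where \<open>v\<close> exceeds \<open>W'\<close>, the point is off
      \<open>E\<close> and satisfies \<open>W < 1\<close>, hence lies within \<open>r1\<close> of
      \<open>\<xi>\<close>, where the bounds on both operators hold.\<close>
    have "v x - W' x \<le> 0"
    proof (rule trunc_max_principle[OF \<alpha>(1) e, where v = "\<lambda>y. v y - W' y"])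
      show "\<bar>v y - W' y\<bar> \<le> 2" for y using vB[of y] W'B[of y] by linarith
      fix y assume pos: "0 < v y - W' y"
      have yE: "y \<notin> E" using pos vE[of y] by (auto simp: W'_def)
      then have Wy: "W y < 1" using pos v01[of y] by (auto simp: W'_def min_def split: if_splits)
      then have n: "norm (y - \<xi>) < r1" using W1 \<rho>e(2)[of y] by fastforce
      then show "norm y < norm \<xi> + r1" using norm_triangle_sub[of y \<xi>] by linarith
      show "0 \<le> trunc_lap \<alpha> \<epsilon> (\<lambda>y. v y - W' y) y"
        using sub[OF yE] n super[OF yE Wy]
        by (subst trunc_lap_diff[OF \<alpha>(1) e v vB _ W'B]) (auto simp: r1_def)
    qed measurable
    then show ?thesis using W'1(3)[of x] by (simp add: W_def \<rho>_def)
  qed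
  show ?thesis
    using C(1) q(1) by (intro exI[of _ C] exI[of _ q] conjI allI impI main) auto
qed

context ring_problem
begin

subsection \<open>The truncated problem\<close>

text \<open>The truncated operator acts on bounded measurable functions, so the equation is imposed
  pointwise and no continuity is demanded.\<close>

definition trunc_sol :: "real \<Rightarrow> ('a \<Rightarrow> real) \<Rightarrow> bool" where
  "trunc_sol \<epsilon> u \<longleftrightarrow> u \<in> borel_measurable borel \<and> (\<forall>x. 0 \<le> u x \<and> u x \<le> 1) \<and>
     (\<forall>x. x \<notin> D0 \<longrightarrow> u x = 0) \<and> (\<forall>x\<in>closure D1. u x = 1) \<and>
     (\<forall>x\<in>D0 - closure D1. trunc_lap \<alpha> \<epsilon> u x = F (u x))"

lemma F_measurable [measurable]: "F \<in> borel_measurable borel"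
  unfolding F_def[abs_def] by measurable

text \<open>The one-sided bound is what makes \<open>\<Lambda> * s - F s\<close> nondecreasing. The
  added 1 keeps \<open>\<Lambda>\<close> positive, as it enters a denominator.\<close>

lemma F_Lipschitz: "\<exists>\<Lambda>>0. \<forall>s s'. 0 \<le> s \<longrightarrow> s \<le> s' \<longrightarrow> s' \<le> 1 \<longrightarrow> F s' - F s \<le> \<Lambda> * (s' - s)"
proof -
  let ?c = "frac_const DIM('a) \<alpha>" and ?L = "\<beta> + \<bar>\<gamma>\<bar> * p"
  have "F s' - F s \<le> (?L / ?c + 1) * (s' - s)" if "0 \<le> s" "s \<le> s'" "s' \<le> 1" for s s'
  proof -
    have "- \<gamma> * (s' powr p - s powr p) \<le> \<bar>\<gamma>\<bar> * (s' powr p - s powr p)"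
      using pow_mono_diff(1)[OF that] by (intro mult_right_mono) auto
    also have "\<dots> \<le> \<bar>\<gamma>\<bar> * (p * (s' - s))"
      using pow_mono_diff(2)[OF that] by (intro mult_left_mono) auto
    finally have "(\<beta> * s' - \<gamma> * s' powr p) - (\<beta> * s - \<gamma> * s powr p) \<le> ?L * (s' - s)"
      by (simp add: algebra_simps)
    then have "F s' - F s \<le> ?L * (s' - s) / ?c"
      unfolding F_def diff_divide_distrib[symmetric] using const_pos by (intro divide_right_mono) auto
    also have "\<dots> \<le> (?L / ?c + 1) * (s' - s)" using that by (simp add: algebra_simps)
    finally show ?thesis .
  qed
  moreover have "?L / ?c + 1 > 0" using \<beta> p const_pos by (intro add_nonneg_pos divide_nonneg_pos) auto
  ultimately show ?thesis by blast
qed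

text \<open>In the ring the equation is solved for \<open>u x\<close> after adding
  \<open>\<Lambda> * u x\<close> on both sides. The resulting map \<open>T\<close> is monotone, so
  its iterates from 0 increase, and their pointwise limit is a fixed point by dominated
  convergence.\<close>

lemma trunc_sol_exists:
  assumes mono: "p * \<gamma> \<le> \<beta>" and e: "0 < \<epsilon>"
  shows "\<exists>u. trunc_sol \<epsilon> u"
proof -
  let ?t = "tkern \<alpha> \<epsilon> :: 'a \<Rightarrow> real"
  let ?k = "LINT z|lborel. ?t z"
  obtain \<Lambda> where \<Lambda>: "\<Lambda> > 0" "\<And>s s'. 0 \<le> s \<Longrightarrow> s \<le> s' \<Longrightarrow> s' \<le> 1 \<Longrightarrow> F s' - F s \<le> \<Lambda> * (s' - s)"
    using F_Lipschitz by blast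
  have ki: "integrable lborel ?t" by (rule tkern_integrable[OF \<alpha>(1) e])
  have k: "?k \<ge> 0" by (intro integral_nonneg_AE) (simp add: tkern_nonneg)
  define good where "good u \<longleftrightarrow> u \<in> borel_measurable borel \<and> (\<forall>x. 0 \<le> u x \<and> u x \<le> 1)" for u :: "'a \<Rightarrow> real"
  define T where "T u x = (if x \<in> closure D1 then 1 else if x \<in> D0 then
      ((LINT z|lborel. u (x + z) * ?t z) + (\<Lambda> * u x - F (u x))) / (?k + \<Lambda>) else 0)" for u x
  have i: "integrable lborel (\<lambda>z. u (x + z) * ?t z)" if "good u" for u x
  proof (rule integrable_bounded_times_tkern[OF \<alpha>(1) e, of _ 1])
    have [measurable]: "u \<in> borel_measurable borel" using that by (simp add: good_def)
    show "(\<lambda>z. u (x + z)) \<in> borel_measurable borel" by measurable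
  qed (use that in \<open>auto simp: good_def\<close>)
  have F1: "0 \<le> F 1" using F_nonneg[OF \<gamma>_le_\<beta>[OF mono]] by simp
  have Tmono: "T u x \<le> T v x" if "good u" "good v" "\<And>x. u x \<le> v x" for u v x
  proof -
    have "(LINT z|lborel. u (x + z) * ?t z) \<le> (LINT z|lborel. v (x + z) * ?t z)"
      using i that by (intro integral_mono) (auto intro!: mult_right_mono tkern_nonneg)
    moreover have "\<Lambda> * u x - F (u x) \<le> \<Lambda> * v x - F (v x)"
      using \<Lambda>(2)[of "u x" "v x"] that by (auto simp: good_def algebra_simps)
    ultimately show ?thesis
      unfolding T_def using k \<Lambda> by (auto intro!: divide_right_mono add_mono)
  qed
  have g0: "good (\<lambda>x. 0)" and g1: "good (\<lambda>x. 1)" by (auto simp: good_def)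
  \<comment> \<open>The constants 0 and 1 are a sub- and a supersolution, because
    \<open>F 0 = 0\<close> and \<open>F 1 \<ge> 0\<close>.\<close>
  have T0: "0 \<le> T (\<lambda>x. 0) x" and T1: "T (\<lambda>x. 1) x \<le> 1" for x
    using k \<Lambda> F1 by (auto simp: T_def F_0 divide_le_eq_1)
  have Tgood: "good (T u)" if u: "good u" for u
    unfolding good_def
  proof safe
    have [measurable]: "u \<in> borel_measurable borel" "closure D1 \<in> sets borel" "D0 \<in> sets borel"
      using u D0 by (auto simp: good_def)
    show "T u \<in> borel_measurable borel" unfolding T_def[abs_def] by measurable
    show "0 \<le> T u x" for x using T0[of x] Tmono[OF g0 u, of x] u by (auto simp: good_def intro: order_trans)
    show "T u x \<le> 1" for x using T1[of x] Tmono[OF u g1, of x] u by (auto simp: good_def intro: order_trans)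
  qed
  define U where "U n = (T ^^ n) (\<lambda>x. 0)" for n
  have US: "U (Suc n) = T (U n)" for n by (simp add: U_def)
  have Ug: "good (U n)" for n by (induction n) (simp_all add: US Tgood, simp add: U_def g0)
  have Um: "U n x \<le> U (Suc n) x" for n x
  proof (induction n arbitrary: x)
    case 0
    then show ?case using T0[of x] by (simp add: U_def)
  next
    case (Suc n)
    then show ?case unfolding US[of "Suc n"] US[of n] by (metis Tmono Ug US)
  qed
  define u where "u x = (SUP n. U n x)" for x
  have lim: "(\<lambda>n. U n x) \<longlonglongrightarrow> u x" for x
    unfolding u_def using Ug Um by (intro LIMSEQ_incseq_SUP incseq_SucI bdd_aboveI2[of _ _ 1]) (auto simp: good_def)
  have um[measurable]: "u \<in> borel_measurable borel"
    using Ug by (intro borel_measurable_LIMSEQ_real[OF lim]) (simp add: good_def)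
  have u01: "0 \<le> u x \<and> u x \<le> 1" for x
    using Ug by (intro conjI LIMSEQ_le_const[OF lim] LIMSEQ_le_const2[OF lim]) (auto simp: good_def)
  then have ug: "good u" using um by (simp add: good_def)
  have Tu: "T u x = u x" for x
  proof -
    have "(\<lambda>n. LINT z|lborel. U n (x + z) * ?t z) \<longlonglongrightarrow> (LINT z|lborel. u (x + z) * ?t z)"
    proof (rule integral_dominated_convergence[of _ _ _ ?t])
      have [measurable]: "U n \<in> borel_measurable borel" for n using Ug by (simp add: good_def)
      show "(\<lambda>z. u (x + z) * ?t z) \<in> borel_measurable lborel" "(\<lambda>z. U n (x + z) * ?t z) \<in> borel_measurable lborel" for n
        by measurable
      show "AE z in lborel. (\<lambda>n. U n (x + z) * ?t z) \<longlonglongrightarrow> u (x + z) * ?t z"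
        by (intro AE_I2 tendsto_mult lim tendsto_const)
      show "AE z in lborel. norm (U n (x + z) * ?t z) \<le> ?t z" for n
        using Ug[of n] by (intro AE_I2) (auto simp: good_def abs_mult tkern_nonneg intro: mult_left_le_one_le)
    qed (rule ki)
    moreover have "(\<lambda>n. F (U n x)) \<longlonglongrightarrow> F (u x)"
      using Ug u01 by (intro continuous_on_tendsto_compose[OF F_continuous lim]) (auto simp: good_def)
    ultimately have "(\<lambda>n. T (U n) x) \<longlonglongrightarrow> T u x"
      unfolding T_def using lim k \<Lambda> by (auto intro!: tendsto_intros)
    moreover have "(\<lambda>n. T (U n) x) \<longlonglongrightarrow> u x" using LIMSEQ_Suc[OF lim[of x]] by (simp add: US)
    ultimately show ?thesis by (rule LIMSEQ_unique)
  qed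
  have "trunc_lap \<alpha> \<epsilon> u x = F (u x)" if x: "x \<in> D0 - closure D1" for x
  proof -
    have "trunc_lap \<alpha> \<epsilon> u x = (LINT z|lborel. u (x + z) * ?t z) - u x * ?k"
      unfolding trunc_lap_def left_diff_distrib using i[OF ug] ki by simp
    moreover have "(LINT z|lborel. u (x + z) * ?t z) + (\<Lambda> * u x - F (u x)) = u x * (?k + \<Lambda>)"
      using Tu[of x] x k \<Lambda> by (simp add: T_def divide_eq_eq)
    ultimately show ?thesis by (simp add: algebra_simps)
  qed
  moreover have "u x = 0" if "x \<notin> D0" for x
  proof -
    have "x \<notin> closure D1" using that sub by blast
    then show ?thesis using Tu[of x] that by (simp add: T_def)
  qed
  moreover have "u x = 1" if "x \<in> closure D1" for x using Tu[of x] that by (simp add: T_def)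
  ultimately show ?thesis using um u01 unfolding trunc_sol_def by blast
qed

subsection \<open>Exterior balls\<close>

text \<open>A ball on the axis whose radius is proportional to the distance from the vertex: it
  provides exterior mass at every scale r, the only consequence of the cone condition that the
  barrier uses.\<close>

lemma cone_contains_ball:
  fixes \<xi> e :: "'a::euclidean_space"
  assumes e: "norm e = 1" and r: "0 < r" "r \<le> h" and \<kappa>: "\<kappa> = (1 - cos \<theta>) / 4" "0 < \<kappa>" "0 \<le> cos \<theta>"
  shows "ball (\<xi> + (r / 2) *\<^sub>R e) (\<kappa> * r) \<subseteq> finite_cone h \<theta> e \<xi> - {\<xi>}"
proof
  fix y assume y: "y \<in> ball (\<xi> + (r / 2) *\<^sub>R e) (\<kappa> * r)"
  define w where "w = y - \<xi> - (r / 2) *\<^sub>R e"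
  have w: "norm w < \<kappa> * r" using y by (simp add: w_def dist_norm norm_minus_commute algebra_simps)
  have yw: "y - \<xi> = (r / 2) *\<^sub>R e + w" by (simp add: w_def)
  have we: "\<bar>w \<bullet> e\<bar> \<le> norm w" using Cauchy_Schwarz_ineq2[of w e] e by simp
  have ye: "(y - \<xi>) \<bullet> e = r / 2 + w \<bullet> e" using e by (simp add: yw inner_left_distrib dot_square_norm)
  have \<kappa>4: "\<kappa> \<le> 1 / 4" using \<kappa> by simp
  then have \<kappa>r: "\<kappa> * r \<le> r / 4" using r by (simp add: mult_right_mono[of \<kappa> "1/4" r, simplified])
  have "norm (y - \<xi>) \<le> r / 2 + norm w" using norm_triangle_ineq[of "(r / 2) *\<^sub>R e" w] e r by (simp add: yw)
  then have "cos \<theta> * norm (y - \<xi>) \<le> cos \<theta> * (r / 2 + \<kappa> * r)" using \<kappa> w by (intro mult_left_mono) auto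
  also have "\<dots> \<le> r / 2 - \<kappa> * r"
  proof -
    \<comment> \<open>The value of \<open>\<kappa>\<close> is chosen so that the required inequality
      reduces to this square.\<close>
    have "0 \<le> (1 - cos \<theta>)\<^sup>2" by simp
    then have "cos \<theta> * (1 / 2 + \<kappa>) \<le> 1 / 2 - \<kappa>" unfolding \<kappa>(1) by (simp add: field_simps power2_eq_square)
    from mult_right_mono[OF this, of r] r show ?thesis by (simp add: algebra_simps)
  qed
  also have "\<dots> \<le> (y - \<xi>) \<bullet> e" unfolding ye using we w by linarith
  finally have "cos \<theta> * norm (y - \<xi>) \<le> (y - \<xi>) \<bullet> e" .
  moreover have "(y - \<xi>) \<bullet> e \<le> h" unfolding ye using we w \<kappa>r r by linarith
  moreover have "0 < (y - \<xi>) \<bullet> e" unfolding ye using we w \<kappa>r r by linarith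
  ultimately show "y \<in> finite_cone h \<theta> e \<xi> - {\<xi>}" by (auto simp: finite_cone_def)
qed

text \<open>The cones only avoid the ring, whereas the barriers need balls in one specified part of
  its complement. The two parts, outside \<open>D0\<close> and \<open>closure D1\<close>, have
  positive distance, so a small ball near one of them cannot reach the other.\<close>

lemma exterior_balls:
  assumes cone: "uniform_exterior_cone_condition (D0 - closure D1)"
  shows "\<exists>\<kappa> r0. 0 < \<kappa> \<and> \<kappa> \<le> 1 / 4 \<and> 0 < r0 \<and>
    (\<forall>\<xi>\<in>frontier D0. (\<forall>x. norm (x - \<xi>) < r0 \<longrightarrow> x \<notin> closure D1) \<and>
      (\<forall>r\<in>{0<..r0}. \<exists>e. norm e = 1 \<and> ball (\<xi> + (r / 2) *\<^sub>R e) (\<kappa> * r) \<subseteq> - D0)) \<and>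
    (\<forall>\<xi>\<in>frontier D1. (\<forall>x. norm (x - \<xi>) < r0 \<longrightarrow> x \<in> D0) \<and>
      (\<forall>r\<in>{0<..r0}. \<exists>e. norm e = 1 \<and> ball (\<xi> + (r / 2) *\<^sub>R e) (\<kappa> * r) \<subseteq> closure D1))"
proof -
  let ?D = "D0 - closure D1"
  obtain h \<theta> where h: "h > 0" and \<theta>: "0 < \<theta>" "\<theta> < pi / 2" and
    c: "\<And>\<xi>. \<xi> \<in> frontier ?D \<Longrightarrow> \<exists>e. norm e = 1 \<and> finite_cone h \<theta> e \<xi> \<inter> closure ?D = {\<xi>}"
    using cone unfolding uniform_exterior_cone_condition_def by (metis greaterThanLessThan_iff)
  define \<kappa> where "\<kappa> = (1 - cos \<theta>) / 4"
  have c0: "0 \<le> cos \<theta>" using \<theta> by (intro cos_ge_zero) auto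
  have "cos \<theta> < cos 0" using \<theta> pi_gt_zero by (intro cos_monotone_0_pi) auto
  then have \<kappa>: "0 < \<kappa>" "\<kappa> \<le> 1 / 4" using c0 by (auto simp: \<kappa>_def)
  have "compact (closure D1)" using D1(1) by simp
  moreover have "closed (- D0)" using D0(2) by (simp add: closed_def)
  moreover have "closure D1 \<inter> - D0 = {}" using sub by auto
  ultimately obtain \<rho> where \<rho>: "\<rho> > 0" "\<And>x y. x \<in> closure D1 \<Longrightarrow> y \<in> - D0 \<Longrightarrow> \<rho> \<le> dist x y"
    using separate_compact_closed by metis
  define r0 where "r0 = min h \<rho>"
  have r0: "r0 > 0" "r0 \<le> h" "r0 \<le> \<rho>" using h \<rho> by (auto simp: r0_def)
  have opn: "open ?D" using D0 by auto
  have free: "\<exists>e. norm e = 1 \<and> ball (\<xi> + (r / 2) *\<^sub>R e) (\<kappa> * r) \<inter> ?D = {} \<and> ball (\<xi> + (r / 2) *\<^sub>R e) (\<kappa> * r) \<subseteq> ball \<xi> r"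
    if \<xi>: "\<xi> \<in> closure ?D" "\<xi> \<notin> ?D" and r: "r \<in> {0<..r0}" for \<xi> r
  proof -
    have "\<xi> \<in> frontier ?D" using \<xi> opn by (simp add: frontier_def interior_open)
    from c[OF this] obtain e where e: "norm e = 1" "finite_cone h \<theta> e \<xi> \<inter> closure ?D = {\<xi>}" by blast
    have "ball (\<xi> + (r / 2) *\<^sub>R e) (\<kappa> * r) \<subseteq> finite_cone h \<theta> e \<xi> - {\<xi>}"
      using r r0 \<kappa> c0 by (intro cone_contains_ball[OF e(1)]) (auto simp: \<kappa>_def)
    then have "ball (\<xi> + (r / 2) *\<^sub>R e) (\<kappa> * r) \<inter> ?D = {}" using e(2) closure_subset[of ?D] by blast
    moreover have "ball (\<xi> + (r / 2) *\<^sub>R e) (\<kappa> * r) \<subseteq> ball \<xi> r"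
    proof
      fix y assume "y \<in> ball (\<xi> + (r / 2) *\<^sub>R e) (\<kappa> * r)"
      moreover have "\<kappa> * r \<le> r / 4" using mult_right_mono[OF \<kappa>(2), of r] r by simp
      moreover have "dist \<xi> (\<xi> + (r / 2) *\<^sub>R e) = r / 2" using e r by (simp add: dist_norm)
      moreover have "dist \<xi> y \<le> dist \<xi> (\<xi> + (r / 2) *\<^sub>R e) + dist (\<xi> + (r / 2) *\<^sub>R e) y" by (rule dist_triangle)
      ultimately have "dist \<xi> y < r" using r by (simp only: mem_ball greaterThanAtMost_iff) linarith
      then show "y \<in> ball \<xi> r" by simp
    qed
    ultimately show ?thesis using e(1) by blast
  qed
  have out: "x \<notin> closure D1" if "\<xi> \<in> frontier D0" "norm (x - \<xi>) < r0" for \<xi> x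
    using \<rho>(2)[of x \<xi>] that r0 D0(2) by (auto simp: frontier_def interior_open dist_norm)
  have inn: "x \<in> D0" if "\<xi> \<in> frontier D1" "norm (x - \<xi>) < r0" for \<xi> x
    using \<rho>(2)[of \<xi> x] that r0 by (auto simp: frontier_def dist_norm norm_minus_commute)
  have b0: "\<exists>e. norm e = 1 \<and> ball (\<xi> + (r / 2) *\<^sub>R e) (\<kappa> * r) \<subseteq> - D0"
    if \<xi>: "\<xi> \<in> frontier D0" and r: "r \<in> {0<..r0}" for \<xi> r
  proof -
    have x: "\<xi> \<in> closure D0" "\<xi> \<notin> D0" using \<xi> D0(2) by (auto simp: frontier_def interior_open)
    have "\<xi> \<in> closure ?D"
      unfolding closure_approachable
    proof safe
      fix d :: real assume "0 < d"
      then obtain y where "y \<in> D0" "dist y \<xi> < min d r0" using x(1) r0 unfolding closure_approachable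
        by (metis min_less_iff_conj)
      then show "\<exists>y\<in>?D. dist y \<xi> < d" using out[OF \<xi>, of y] by (auto simp: dist_norm)
    qed
    then obtain e where "norm e = 1" "ball (\<xi> + (r / 2) *\<^sub>R e) (\<kappa> * r) \<inter> ?D = {}"
      "ball (\<xi> + (r / 2) *\<^sub>R e) (\<kappa> * r) \<subseteq> ball \<xi> r" using free[of \<xi> r] x r by blast
    moreover have "ball \<xi> r \<inter> closure D1 = {}"
      using out[OF \<xi>] r by (auto simp: dist_norm norm_minus_commute)
    ultimately show ?thesis by blast
  qed
  have b1: "\<exists>e. norm e = 1 \<and> ball (\<xi> + (r / 2) *\<^sub>R e) (\<kappa> * r) \<subseteq> closure D1"
    if \<xi>: "\<xi> \<in> frontier D1" and r: "r \<in> {0<..r0}" for \<xi> r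
  proof -
    have x: "\<xi> \<in> closure D1" "\<xi> \<notin> D1" using \<xi> D1(2) by (auto simp: frontier_def interior_open)
    have "\<xi> \<in> closure ?D"
      unfolding closure_approachable
    proof safe
      fix d :: real assume d: "0 < d"
      \<comment> \<open>That a frontier point of \<open>D1\<close> is a limit of ring points relies
        on starshapedness: dilation by \<open>t > 1\<close> moves it out of
        \<open>closure D1\<close>, and the fraction keeps the displacement below \<open>d\<close>
        and \<open>r0\<close>.\<close>
      define t where "t = 1 + min d r0 / (2 * (norm \<xi> + 1))"
      have t: "1 < t" using d r0 by (simp add: t_def add_nonneg_pos)
      have "t *\<^sub>R \<xi> - \<xi> = (min d r0 / (2 * (norm \<xi> + 1))) *\<^sub>R \<xi>" by (simp add: t_def algebra_simps)
      then have "norm (t *\<^sub>R \<xi> - \<xi>) = min d r0 * (norm \<xi> / (2 * (norm \<xi> + 1)))" using d r0 by simp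
      also have "\<dots> < min d r0 * 1"
        using d r0 by (intro mult_strict_left_mono) (auto simp: divide_less_eq add_nonneg_pos)
      finally have n: "norm (t *\<^sub>R \<xi> - \<xi>) < min d r0" by simp
      have "t *\<^sub>R \<xi> \<notin> closure D1"
      proof
        assume "t *\<^sub>R \<xi> \<in> closure D1"
        then have "(1 / t) *\<^sub>R (t *\<^sub>R \<xi>) \<in> D1"
          using t by (intro strictly_starshaped_scale_closure[OF D1(3,2,1)]) auto
        then show False using x(2) t by simp
      qed
      moreover have "t *\<^sub>R \<xi> \<in> D0" using n by (intro inn[OF \<xi>]) auto
      ultimately show "\<exists>y\<in>?D. dist y \<xi> < d" using n by (auto simp: dist_norm)
    qed
    then obtain e where "norm e = 1" "ball (\<xi> + (r / 2) *\<^sub>R e) (\<kappa> * r) \<inter> ?D = {}"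
      "ball (\<xi> + (r / 2) *\<^sub>R e) (\<kappa> * r) \<subseteq> ball \<xi> r" using free[of \<xi> r] x r by blast
    moreover have "ball \<xi> r \<subseteq> D0"
      using inn[OF \<xi>] r by (auto simp: dist_norm norm_minus_commute)
    ultimately show ?thesis by blast
  qed
  show ?thesis using \<kappa> r0(1) out inn b0 b1 by blast
qed

subsection \<open>A uniform modulus of continuity\<close>

text \<open>The maximum principle is applied to \<open>u (y + h) - u y\<close> minus the claimed
  bound. If both points are in the ring, monotonicity of \<open>F\<close> gives the required sign;
  otherwise the segment between them crosses a boundary, and the barrier there already gives the
  bound.\<close>

lemma trunc_sol_modulus:
  assumes mono: "p * \<gamma> \<le> \<beta>" and cone: "uniform_exterior_cone_condition (D0 - closure D1)"
  shows "\<exists>C>0. \<exists>q>0. \<forall>\<epsilon>>0. \<forall>u. trunc_sol \<epsilon> u \<longrightarrow>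
    (\<forall>x h. u (x + h) - u x \<le> C * sqrt ((norm h)\<^sup>2 + 4 * \<epsilon>\<^sup>2) powr q)"
proof -
  obtain \<kappa> r0 where \<kappa>: "0 < \<kappa>" "\<kappa> \<le> 1 / 4" and r0: "0 < r0"
    and f0: "\<And>\<xi> x. \<xi> \<in> frontier D0 \<Longrightarrow> norm (x - \<xi>) < r0 \<Longrightarrow> x \<notin> closure D1"
      "\<And>\<xi>. \<xi> \<in> frontier D0 \<Longrightarrow> \<forall>r\<in>{0<..r0}. \<exists>e. norm e = 1 \<and> ball (\<xi> + (r / 2) *\<^sub>R e) (\<kappa> * r) \<subseteq> - D0"
    and f1: "\<And>\<xi> x. \<xi> \<in> frontier D1 \<Longrightarrow> norm (x - \<xi>) < r0 \<Longrightarrow> x \<in> D0"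
      "\<And>\<xi>. \<xi> \<in> frontier D1 \<Longrightarrow> \<forall>r\<in>{0<..r0}. \<exists>e. norm e = 1 \<and> ball (\<xi> + (r / 2) *\<^sub>R e) (\<kappa> * r) \<subseteq> closure D1"
    using exterior_balls[OF cone] by blast
  have F1: "0 \<le> F 1" using F_nonneg[OF \<gamma>_le_\<beta>[OF mono]] by simp
  obtain C q where C: "C > 0" "q > 0" and bar: "\<And>\<epsilon> v \<xi> E x. 0 < \<epsilon> \<Longrightarrow>
    v \<in> borel_measurable borel \<Longrightarrow> \<forall>x. 0 \<le> v x \<and> v x \<le> 1 \<Longrightarrow>
    E \<in> sets borel \<Longrightarrow> \<forall>x\<in>E. v x = 0 \<Longrightarrow>
    \<forall>r\<in>{0<..r0}. \<exists>e. norm e = 1 \<and> ball (\<xi> + (r / 2) *\<^sub>R e) (\<kappa> * r) \<subseteq> E \<Longrightarrow>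
    \<forall>x. x \<notin> E \<longrightarrow> norm (x - \<xi>) < r0 / 8 \<longrightarrow> - F 1 \<le> trunc_lap \<alpha> \<epsilon> v x \<Longrightarrow>
    v (x::'a) \<le> C * sqrt ((norm (x - \<xi>))\<^sup>2 + 4 * \<epsilon>\<^sup>2) powr q"
    using boundary_barrier[OF \<alpha> \<kappa> r0 F1, where 'a='a] by (elim exE conjE) metis
  have "u (x + h) - u x \<le> C * sqrt ((norm h)\<^sup>2 + 4 * \<epsilon>\<^sup>2) powr q"
    if e: "0 < \<epsilon>" and u: "trunc_sol \<epsilon> u" for \<epsilon> u x h
  proof -
    have um[measurable]: "u \<in> borel_measurable borel" and u01: "\<And>x. 0 \<le> u x \<and> u x \<le> 1"
      and uout: "\<And>x. x \<notin> D0 \<Longrightarrow> u x = 0" and uin: "\<And>x. x \<in> closure D1 \<Longrightarrow> u x = 1"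
      and ueq: "\<And>x. x \<in> D0 - closure D1 \<Longrightarrow> trunc_lap \<alpha> \<epsilon> u x = F (u x)"
      using u unfolding trunc_sol_def by auto
    have uB: "\<bar>u x\<bar> \<le> 1" for x using u01[of x] by simp
    have const0: "trunc_lap \<alpha> \<epsilon> (\<lambda>x. c) y = 0" for c and y :: 'a by (simp add: trunc_lap_def)
    define \<Phi> where "\<Phi> t = C * sqrt (t\<^sup>2 + 4 * \<epsilon>\<^sup>2) powr q" for t
    have \<Phi>mono: "\<Phi> s \<le> \<Phi> t" if "0 \<le> s" "s \<le> t" for s t
      unfolding \<Phi>_def using that C by (intro mult_left_mono powr_mono2 real_sqrt_le_mono add_right_mono power_mono) auto
    have \<Phi>0: "0 \<le> \<Phi> t" for t using C by (simp add: \<Phi>_def)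
    have at0: "u y \<le> \<Phi> (norm (y - \<xi>))" if \<xi>: "\<xi> \<in> frontier D0" for \<xi> y
      unfolding \<Phi>_def
    proof (rule bar[OF e um _ _ _ f0(2)[OF \<xi>]])
      show "- D0 \<in> sets borel" using D0(2) by auto
      show "\<forall>x. x \<notin> - D0 \<longrightarrow> norm (x - \<xi>) < r0 / 8 \<longrightarrow> - F 1 \<le> trunc_lap \<alpha> \<epsilon> u x"
      proof (intro allI impI)
        fix x assume x: "x \<notin> - D0" "norm (x - \<xi>) < r0 / 8"
        then have "x \<notin> closure D1" using f0(1)[OF \<xi>, of x] r0 by simp
        then have "trunc_lap \<alpha> \<epsilon> u x = F (u x)" using x ueq by simp
        then show "- F 1 \<le> trunc_lap \<alpha> \<epsilon> u x" using F_nonneg[OF \<gamma>_le_\<beta>[OF mono], of "u x"] u01[of x] F1 by simp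
      qed
    qed (use u01 uout in auto)
    \<comment> \<open>At the inner boundary the barrier is used for \<open>1 - u\<close>, which
      vanishes on \<open>closure D1\<close> and whose operator equals \<open>- F (u x)\<close>, at
      least \<open>- F 1\<close>.\<close>
    have at1: "1 - u y \<le> \<Phi> (norm (y - \<xi>))" if \<xi>: "\<xi> \<in> frontier D1" for \<xi> y
      unfolding \<Phi>_def
    proof (rule bar[OF e _ _ _ _ f1(2)[OF \<xi>], where v = "\<lambda>x. 1 - u x"])
      show "\<forall>x. x \<notin> closure D1 \<longrightarrow> norm (x - \<xi>) < r0 / 8 \<longrightarrow> - F 1 \<le> trunc_lap \<alpha> \<epsilon> (\<lambda>x. 1 - u x) x"
      proof (intro allI impI)
        fix x assume x: "x \<notin> closure D1" "norm (x - \<xi>) < r0 / 8"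
        then have "x \<in> D0" using f1(1)[OF \<xi>, of x] r0 by simp
        then have "trunc_lap \<alpha> \<epsilon> (\<lambda>x. 1 - u x) x = - F (u x)"
          using trunc_lap_diff[OF \<alpha>(1) e _ _ um uB, of "\<lambda>x. 1" 1 x] x ueq const0 by simp
        then show "- F 1 \<le> trunc_lap \<alpha> \<epsilon> (\<lambda>x. 1 - u x) x" using F_mono[OF mono, of "u x" 1] u01[of x] by simp
      qed
    qed (use u01 uin in auto)
    define w where "w y = u (y + h) - u y" for y
    have [measurable]: "w \<in> borel_measurable borel" unfolding w_def[abs_def] by measurable
    have wB: "\<bar>w y\<bar> \<le> 2" for y using u01[of y] u01[of "y + h"] unfolding w_def by linarith
    have pos: "y \<in> D0 - closure D1 \<and> y + h \<in> D0 - closure D1 \<and> u y \<le> u (y + h)" if "0 < w y - \<Phi> (norm h)" for y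
    proof -
      have lt: "u y < u (y + h)" and lt': "\<Phi> (norm h) < u (y + h) - u y"
        using that \<Phi>0[of "norm h"] by (auto simp: w_def)
      have yh: "y + h \<in> D0" using uout[of "y + h"] lt u01[of y] by fastforce
      have y1: "y \<notin> closure D1" using uin[of y] lt u01[of "y + h"] by fastforce
      have seg: "\<exists>\<xi>\<in>frontier S. norm (y + h - \<xi>) \<le> norm h \<and> norm (y - \<xi>) \<le> norm h" if S: "y + h \<in> S" "y \<notin> S" for S
      proof -
        obtain t where t: "t \<in> {0..1}" "y + h + t *\<^sub>R (y - (y + h)) \<in> frontier S"
          using segment_meets_frontier[OF S] by blast
        let ?z = "y + h + t *\<^sub>R (y - (y + h))"
        have "y + h - ?z = t *\<^sub>R h" "y - ?z = (t - 1) *\<^sub>R h" by (simp_all add: algebra_simps)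
        then have "norm (y + h - ?z) = t * norm h" "norm (y - ?z) = (1 - t) * norm h" using t(1) by auto
        then have "norm (y + h - ?z) \<le> norm h" "norm (y - ?z) \<le> norm h"
          using t(1) by (auto simp: mult_left_le_one_le)
        with t(2) show ?thesis by blast
      qed
      have "y \<in> D0"
      proof (rule ccontr)
        assume "y \<notin> D0"
        from seg[OF yh this] obtain \<xi> where "\<xi> \<in> frontier D0" "norm (y + h - \<xi>) \<le> norm h" by blast
        then have "u (y + h) \<le> \<Phi> (norm h)" using at0[of \<xi> "y + h"] \<Phi>mono[of "norm (y + h - \<xi>)" "norm h"] by simp
        then show False using lt' u01[of y] by linarith
      qed
      moreover have "y + h \<notin> closure D1"
      proof
        assume "y + h \<in> closure D1"
        \<comment> \<open>The segment crosses the frontier of the closure, while the barrier is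
          available on the frontier of \<open>D1\<close>.\<close>
        have fD1: "frontier (closure D1) \<subseteq> frontier D1"
          using interior_mono[OF closure_subset[of D1]] by (auto simp: frontier_def)
        from seg[OF \<open>y + h \<in> closure D1\<close> y1] obtain \<xi> where "\<xi> \<in> frontier (closure D1)" "norm (y - \<xi>) \<le> norm h" by blast
        then have "1 - u y \<le> \<Phi> (norm h)"
          using at1[of \<xi> y] \<Phi>mono[of "norm (y - \<xi>)" "norm h"] fD1 by auto
        then show False using lt' u01[of "y + h"] by linarith
      qed
      ultimately show ?thesis using yh y1 lt by auto
    qed
    obtain R where R: "D0 \<subseteq> ball 0 R" using bounded_subset_ballD[OF D0(1)] by blast
    have "w x - \<Phi> (norm h) \<le> 0"
    proof (rule trunc_max_principle[OF \<alpha>(1) e, where v = "\<lambda>y. w y - \<Phi> (norm h)"])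
      show "\<bar>w y - \<Phi> (norm h)\<bar> \<le> 2 + \<Phi> (norm h)" for y using wB[of y] \<Phi>0[of "norm h"] by linarith
      fix y assume "0 < w y - \<Phi> (norm h)"
      note y = pos[OF this]
      show "norm y < R" using y R by (auto simp: subset_iff)
      have "trunc_lap \<alpha> \<epsilon> (\<lambda>y. w y - \<Phi> (norm h)) y = trunc_lap \<alpha> \<epsilon> w y"
        by (subst trunc_lap_diff[OF \<alpha>(1) e _ wB, where v = "\<lambda>y. \<Phi> (norm h)" and C = "\<bar>\<Phi> (norm h)\<bar>"])
          (auto simp: const0)
      also have "\<dots> = trunc_lap \<alpha> \<epsilon> (\<lambda>y. u (y + h)) y - trunc_lap \<alpha> \<epsilon> u y"
        unfolding w_def by (rule trunc_lap_diff[OF \<alpha>(1) e _ _ um uB, where B = 1]) (auto simp: uB)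
      also have "trunc_lap \<alpha> \<epsilon> (\<lambda>y. u (y + h)) y = trunc_lap \<alpha> \<epsilon> u (y + h)"
        by (simp add: trunc_lap_def ac_simps)
      finally show "0 \<le> trunc_lap \<alpha> \<epsilon> (\<lambda>y. w y - \<Phi> (norm h)) y"
        using y ueq F_mono[OF mono, of "u y" "u (y + h)"] u01[of y] u01[of "y + h"] by simp
    qed measurable
    then show ?thesis by (simp add: w_def \<Phi>_def)
  qed
  with C show ?thesis by blast
qed

end

context ring_problem
begin

subsection \<open>Passage to the limit\<close>

text \<open>The approximations need not be continuous, so Arzela-Ascoli does not apply as such.
  Convergence on a countable dense set is spread to all points by the modulus, whose defect
  disappears with \<epsilon>.\<close>

lemma solution_exists:
  assumes mono: "p * \<gamma> \<le> \<beta>" and cone: "uniform_exterior_cone_condition (D0 - closure D1)"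
  shows "\<exists>u. ring_solution \<alpha> D0 D1 f u"
proof -
  define \<epsilon> where "\<epsilon> n = 1 / real (Suc n)" for n
  have \<epsilon>: "0 < \<epsilon> n" "\<epsilon> n \<le> 1" for n by (auto simp: \<epsilon>_def)
  have \<epsilon>0: "\<epsilon> \<longlonglongrightarrow> 0" unfolding \<epsilon>_def[abs_def] by (rule lim_1_over_n[THEN LIMSEQ_Suc])
  have "\<exists>U. trunc_sol (\<epsilon> n) U" for n by (rule trunc_sol_exists[OF mono \<epsilon>(1)])
  then obtain U where U: "\<And>n. trunc_sol (\<epsilon> n) (U n)" by metis
  have Um[measurable]: "U n \<in> borel_measurable borel" and U01: "0 \<le> U n x" "U n x \<le> 1"
    and Uout: "x \<notin> D0 \<Longrightarrow> U n x = 0" and Uin: "x \<in> closure D1 \<Longrightarrow> U n x = 1"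
    and Ueq: "x \<in> D0 - closure D1 \<Longrightarrow> trunc_lap \<alpha> (\<epsilon> n) (U n) x = F (U n x)" for n x
    using U[of n] unfolding trunc_sol_def by auto
  obtain C q where C: "C > 0" "q > 0" and modu: "\<And>e u x h. 0 < e \<Longrightarrow> trunc_sol e u \<Longrightarrow>
      u (x + h) - u x \<le> C * sqrt ((norm h)\<^sup>2 + 4 * e\<^sup>2) powr q"
    using trunc_sol_modulus[OF mono cone] by metis
  define \<Phi> where "\<Phi> n t = C * sqrt (t\<^sup>2 + 4 * (\<epsilon> n)\<^sup>2) powr q" for n t
  have Umod: "\<bar>U n x - U n y\<bar> \<le> \<Phi> n (norm (x - y))" for n x y
    using modu[OF \<epsilon>(1) U, of n y "x - y"] modu[OF \<epsilon>(1) U, of n x "y - x"]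
    by (simp add: \<Phi>_def norm_minus_commute abs_le_iff)
  have \<Phi>lim: "(\<lambda>n. \<Phi> n t) \<longlonglongrightarrow> C * \<bar>t\<bar> powr q" for t
  proof -
    have "(\<lambda>n. C * sqrt (t\<^sup>2 + 4 * (\<epsilon> n)\<^sup>2) powr q) \<longlonglongrightarrow> C * sqrt (t\<^sup>2 + 4 * 0\<^sup>2) powr q"
      using \<epsilon>0 C by (intro tendsto_intros tendsto_powr') (auto intro!: always_eventually)
    then show ?thesis by (simp add: \<Phi>_def)
  qed
  obtain S :: "'a set" where S: "countable S" "\<And>X. open X \<Longrightarrow> X \<noteq> {} \<Longrightarrow> \<exists>s\<in>S. s \<in> X"
    using countable_dense_setE by metis
  have "norm (U n x) \<le> 1" for n x using U01[where n = n and x = x] by simp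
  then obtain k where k: "strict_mono (k :: nat \<Rightarrow> nat)" "\<And>x. x \<in> S \<Longrightarrow> \<exists>l. (\<lambda>n. U (k n) x) \<longlonglongrightarrow> l"
    using function_convergent_subsequence[OF S(1), of U 1] by metis
  define V where "V n = U (k n)" for n
  have \<Phi>k: "(\<lambda>n. \<Phi> (k n) t) \<longlonglongrightarrow> C * \<bar>t\<bar> powr q" for t
    using LIMSEQ_subseq_LIMSEQ[OF \<Phi>lim k(1)] by (simp add: o_def)
  have \<epsilon>k: "(\<lambda>n. \<epsilon> (k n)) \<longlonglongrightarrow> 0"
    using LIMSEQ_subseq_LIMSEQ[OF \<epsilon>0 k(1)] by (simp add: o_def)
  have powr0: "\<exists>d>0. \<forall>t. \<bar>t\<bar> < d \<longrightarrow> C * \<bar>t\<bar> powr q < e" if "0 < e" for e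
  proof -
    define d where "d = (e / C) powr (1 / q)"
    have d: "d > 0" using that C by (simp add: d_def)
    have "C * \<bar>t\<bar> powr q < e" if "\<bar>t\<bar> < d" for t
    proof -
      have "\<bar>t\<bar> powr q < d powr q" using that C by (intro powr_less_mono2) auto
      also have "d powr q = e / C" using C \<open>0 < e\<close> by (simp add: d_def powr_powr)
      finally show ?thesis using C by (simp add: field_simps)
    qed
    with d show ?thesis by blast
  qed
  \<comment> \<open>The usual three-term estimate; the comparison with the nearby point
    \<open>s\<close> is only valid for large indices, once the truncation length has become
    small.\<close>
  have "Cauchy (\<lambda>n. V n x)" for x
  proof (rule metric_CauchyI)
    fix e :: real assume e: "0 < e"
    obtain d where d: "d > 0" "\<And>t. \<bar>t\<bar> < d \<Longrightarrow> C * \<bar>t\<bar> powr q < e / 3" using powr0[of "e / 3"] e by auto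
    obtain s where s: "s \<in> S" "dist x s < d" using S(2)[of "ball x d"] d by auto
    have "C * \<bar>norm (x - s)\<bar> powr q < e / 3" using s by (intro d(2)) (simp add: dist_norm)
    from order_tendstoD(2)[OF \<Phi>k this] obtain N1 where N1: "\<And>n. n \<ge> N1 \<Longrightarrow> \<Phi> (k n) (norm (x - s)) < e / 3"
      by (auto simp: eventually_sequentially)
    have "Cauchy (\<lambda>n. V n s)" using k(2)[OF s(1)] unfolding V_def by (metis convergent_def convergent_Cauchy)
    then obtain N2 where N2: "\<And>m n. m \<ge> N2 \<Longrightarrow> n \<ge> N2 \<Longrightarrow> dist (V m s) (V n s) < e / 3"
      using e by (metis metric_CauchyD zero_less_divide_iff zero_less_numeral)
    have "dist (V m x) (V n x) < e" if "m \<ge> max N1 N2" "n \<ge> max N1 N2" for m n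
    proof -
      have "\<bar>V m x - V m s\<bar> < e / 3" "\<bar>V n x - V n s\<bar> < e / 3"
        using Umod[of "k m" x s] Umod[of "k n" x s] N1[of m] N1[of n] that by (auto simp: V_def)
      moreover have "\<bar>V m s - V n s\<bar> < e / 3" using N2[of m n] that by (simp add: dist_real_def)
      ultimately show ?thesis unfolding dist_real_def by linarith
    qed
    then show "\<exists>M. \<forall>m\<ge>M. \<forall>n\<ge>M. dist (V m x) (V n x) < e" by blast
  qed
  then have "\<exists>l. (\<lambda>n. V n x) \<longlonglongrightarrow> l" for x by (metis Cauchy_convergent_iff convergent_def)
  then obtain u where lim: "\<And>x. (\<lambda>n. V n x) \<longlonglongrightarrow> u x" by metis
  have u01: "0 \<le> u x" "u x \<le> 1" for x
    using U01 by (auto simp: V_def intro!: LIMSEQ_le_const[OF lim] LIMSEQ_le_const2[OF lim])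
  have uout: "u x = 0" if "x \<notin> D0" for x
    using LIMSEQ_unique[OF lim, of x 0] Uout[OF that] by (simp add: V_def)
  have uin: "u x = 1" if "x \<in> closure D1" for x
    using LIMSEQ_unique[OF lim, of x 1] Uin[OF that] by (simp add: V_def)
  have umod: "\<bar>u x - u y\<bar> \<le> C * \<bar>norm (x - y)\<bar> powr q" for x y
    using Umod by (intro LIMSEQ_le[OF tendsto_rabs[OF tendsto_diff[OF lim lim]] \<Phi>k]) (auto simp: V_def)
  have uc: "continuous_on UNIV u"
    unfolding continuous_on_iff
  proof (intro ballI allI impI)
    fix x and e :: real assume "0 < e"
    then obtain d where d: "d > 0" "\<And>t. \<bar>t\<bar> < d \<Longrightarrow> C * \<bar>t\<bar> powr q < e" using powr0 by blast
    have "dist (u y) (u x) < e" if "dist y x < d" for y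
      using umod[of y x] d(2)[of "norm (y - x)"] that by (simp add: dist_norm)
    with d(1) show "\<exists>d>0. \<forall>y\<in>UNIV. dist y x < d \<longrightarrow> dist (u y) (u x) < e" by blast
  qed
  have urange: "range u \<subseteq> {0..1}" using u01 by auto
  obtain R where R: "D0 \<subseteq> ball 0 R" using bounded_subset_ballD[OF D0(1)] by blast
  define B where "B = ball (0::'a) R"
  have Bi: "integrable lborel (indicator B :: 'a \<Rightarrow> real)"
    unfolding B_def using emeasure_lborel_ball_finite[of "0::'a" R]
    by (intro integrable_real_indicator) auto
  have Vm[measurable]: "V n \<in> borel_measurable borel" for n unfolding V_def by measurable
  have um[measurable]: "u \<in> borel_measurable borel" using uc by (rule borel_measurable_continuous_onI)
  have V01: "0 \<le> V n x" "V n x \<le> 1" for n x using U01 by (auto simp: V_def)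
  have VB: "\<bar>V n x\<bar> \<le> indicator B x" for n x
    using Uout[of x "k n"] V01[of n x] R by (cases "x \<in> D0") (auto simp: V_def B_def indicator_def)
  have Vi: "integrable lborel (V n)" for n
    by (rule Bochner_Integration.integrable_bound[OF Bi]) (use VB in auto)
  have "(LINT x|lborel. u x * lap \<alpha> \<phi> x) = (LINT x|lborel. F (u x) * \<phi> x)"
    if \<phi>: "\<phi> \<in> test_functions (D0 - closure D1)" for \<phi>
  proof -
    obtain P K where P: "\<phi> \<in> borel_measurable borel" "\<And>x. \<bar>\<phi> x\<bar> \<le> P"
      "\<And>x z. \<bar>second_diff \<phi> x z\<bar> \<le> K * (norm z)\<^sup>2" and \<phi>i: "integrable lborel \<phi>"
      by (rule test_function_bounds[OF \<phi>]) blast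
    note [measurable] = P(1)
    obtain L where L: "\<And>x. \<bar>lap \<alpha> \<phi> x\<bar> \<le> L" using lap_bounded[OF \<alpha> P] by blast
    obtain A where A: "A \<ge> 0" "\<And>v e. integrable lborel v \<Longrightarrow> 0 < e \<Longrightarrow> e \<le> 1 \<Longrightarrow>
      \<bar>(LINT x|lborel. v x * trunc_lap \<alpha> e \<phi> x) - (LINT x|lborel. v x * lap \<alpha> \<phi> x)\<bar>
        \<le> A * e powr (2 - \<alpha>) * (LINT x|lborel. \<bar>v x\<bar>)"
      using weak_trunc_lap_near_lap[OF \<alpha> P] by blast
    have \<phi>0: "\<phi> x = 0" if "x \<notin> D0 - closure D1" for x
      using \<phi> that closure_subset[of "{x. \<phi> x \<noteq> 0}"] by (auto simp: test_functions_def)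
    \<comment> \<open>Symmetry moves the truncated operator from the test function onto
      \<open>V n\<close>, where the equation holds pointwise on the ring; elsewhere
      \<open>\<phi>\<close> vanishes.\<close>
    have eq: "(LINT x|lborel. V n x * trunc_lap \<alpha> (\<epsilon> (k n)) \<phi> x) = (LINT x|lborel. F (V n x) * \<phi> x)" for n
    proof -
      have "(LINT x|lborel. V n x * trunc_lap \<alpha> (\<epsilon> (k n)) \<phi> x)
          = (LINT x|lborel. \<phi> x * trunc_lap \<alpha> (\<epsilon> (k n)) (V n) x)"
        using V01 by (intro trunc_lap_symmetric[OF \<alpha>(1) \<epsilon>(1) Vi _ \<phi>i P(2), of _ 1]) auto
      also have "(\<lambda>x. \<phi> x * trunc_lap \<alpha> (\<epsilon> (k n)) (V n) x) = (\<lambda>x. F (V n x) * \<phi> x)"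
      proof
        show "\<phi> x * trunc_lap \<alpha> (\<epsilon> (k n)) (V n) x = F (V n x) * \<phi> x" for x
          using Ueq[of x "k n"] \<phi>0[of x] by (cases "x \<in> D0 - closure D1") (simp_all add: V_def)
      qed
      finally show ?thesis .
    qed
    \<comment> \<open>Function and truncation length vary together; the constant \<open>A\<close> is
      common to all n, and the integrals of \<open>V n\<close> are bounded by the volume of a
      ball.\<close>
    have l1: "(\<lambda>n. (LINT x|lborel. V n x * trunc_lap \<alpha> (\<epsilon> (k n)) \<phi> x) - (LINT x|lborel. V n x * lap \<alpha> \<phi> x)) \<longlonglongrightarrow> 0"
    proof (rule Lim_null_comparison)
      let ?m = "LINT x::'a|lborel. indicator B x"
      have "(\<lambda>n. A * \<epsilon> (k n) powr (2 - \<alpha>) * ?m) \<longlonglongrightarrow> A * 0 * ?m"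
        using \<epsilon>k \<alpha> \<epsilon> by (intro tendsto_mult tendsto_const tendsto_zero_powrI[of _ _ _ "2 - \<alpha>"])
          (auto intro!: always_eventually less_imp_le)
      then show "(\<lambda>n. A * \<epsilon> (k n) powr (2 - \<alpha>) * ?m) \<longlonglongrightarrow> 0" by simp
      show "\<forall>\<^sub>F n in sequentially. norm ((LINT x|lborel. V n x * trunc_lap \<alpha> (\<epsilon> (k n)) \<phi> x) - (LINT x|lborel. V n x * lap \<alpha> \<phi> x))
          \<le> A * \<epsilon> (k n) powr (2 - \<alpha>) * ?m"
      proof (intro always_eventually allI)
        fix n
        have "(LINT x|lborel. \<bar>V n x\<bar>) \<le> ?m"
          using Vi Bi VB by (intro integral_mono) auto
        then have "A * \<epsilon> (k n) powr (2 - \<alpha>) * (LINT x|lborel. \<bar>V n x\<bar>) \<le> A * \<epsilon> (k n) powr (2 - \<alpha>) * ?m"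
          using A by (intro mult_left_mono) auto
        with A(2)[OF Vi \<epsilon>, of n "k n"] show "norm ((LINT x|lborel. V n x * trunc_lap \<alpha> (\<epsilon> (k n)) \<phi> x) - (LINT x|lborel. V n x * lap \<alpha> \<phi> x))
          \<le> A * \<epsilon> (k n) powr (2 - \<alpha>) * ?m" by simp
      qed
    qed
    have l2: "(\<lambda>n. LINT x|lborel. V n x * lap \<alpha> \<phi> x) \<longlonglongrightarrow> (LINT x|lborel. u x * lap \<alpha> \<phi> x)"
    proof (rule integral_dominated_convergence[of _ _ _ "\<lambda>x. indicator B x * L"])
      show "integrable lborel (\<lambda>x. indicator B x * L)" using Bi by (intro integrable_mult_left)
      show "AE x in lborel. (\<lambda>n. V n x * lap \<alpha> \<phi> x) \<longlonglongrightarrow> u x * lap \<alpha> \<phi> x"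
        by (intro AE_I2 tendsto_mult lim tendsto_const)
      show "AE x in lborel. norm (V n x * lap \<alpha> \<phi> x) \<le> indicator B x * L" for n
        using VB[of n] L by (intro AE_I2) (auto simp: abs_mult intro!: mult_mono)
    qed measurable
    have l3: "(\<lambda>n. LINT x|lborel. F (V n x) * \<phi> x) \<longlonglongrightarrow> (LINT x|lborel. F (u x) * \<phi> x)"
    proof (rule integral_dominated_convergence[of _ _ _ "\<lambda>x. F 1 * \<bar>\<phi> x\<bar>"])
      show "integrable lborel (\<lambda>x. F 1 * \<bar>\<phi> x\<bar>)" using \<phi>i by (intro integrable_mult_right integrable_abs)
      show "AE x in lborel. (\<lambda>n. F (V n x) * \<phi> x) \<longlonglongrightarrow> F (u x) * \<phi> x"
        using V01 u01 by (intro AE_I2 tendsto_mult tendsto_const continuous_on_tendsto_compose[OF F_continuous lim]) auto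
      show "AE x in lborel. norm (F (V n x) * \<phi> x) \<le> F 1 * \<bar>\<phi> x\<bar>" for n
        using F_mono[OF mono, of "V n _" 1] F_nonneg[OF \<gamma>_le_\<beta>[OF mono], of "V n _"] V01
        by (intro AE_I2) (auto simp: abs_mult intro!: mult_right_mono)
    qed measurable
    have "(\<lambda>n. LINT x|lborel. V n x * lap \<alpha> \<phi> x) \<longlonglongrightarrow> (LINT x|lborel. F (u x) * \<phi> x) - 0"
      using tendsto_diff[OF l3 l1] by (simp add: eq)
    with l2 show ?thesis using LIMSEQ_unique by force
  qed
  then have "ring_solution \<alpha> D0 D1 f u"
    unfolding ring_solution_def
    using uc urange uout uin test_function_equation[OF uc urange] bounded_subset[OF bounded_closed_interval urange]
    by auto
  then show ?thesis by blast
qed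

end

theorem corollary1p7:
  fixes D0 D1 :: "(real ^ 'n) set" and \<alpha> \<beta> \<gamma> p :: real and f :: "real ^ 'n \<Rightarrow> real \<Rightarrow> real"
  assumes "0 < \<alpha>" and "\<alpha> < 2"
    and "bounded D0" and "open D0" and "strictly_starshaped D0"
    and "bounded D1" and "open D1" and "strictly_starshaped D1"
    and "0 \<in> D1" and "closure D1 \<subseteq> D0"
    and "uniform_exterior_cone_condition (D0 - closure D1)"
    and "\<beta> \<ge> 0" and "p \<ge> 1"
    and "\<And>x s. x \<in> D0 - closure D1 \<Longrightarrow> s \<in> {0..1} \<Longrightarrow> f x s = \<beta> * s - \<gamma> * s powr p"
  shows
    "(\<beta> \<ge> \<gamma> \<longrightarrow>
        (\<forall>u. ring_solution \<alpha> D0 D1 f u \<and> (\<forall>x\<in>D0 - closure D1. 0 < u x \<and> u x < 1) \<longrightarrow>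
           (\<forall>l\<in>{0<..<1}. strictly_starshaped (superlevel u l)))) \<and>
     (\<beta> \<ge> p * \<gamma> \<and> C11_domain (D0 - closure D1) \<longrightarrow>
        (\<exists>!u. ring_solution \<alpha> D0 D1 f u) \<and>
        (\<forall>u. ring_solution \<alpha> D0 D1 f u \<longrightarrow>
           (\<forall>x\<in>D0 - closure D1. 0 < u x \<and> u x < 1) \<and>
           (\<forall>l\<in>{0<..<1}. strictly_starshaped (superlevel u l))))"
proof -
  interpret ring_problem D0 D1 \<alpha> \<beta> \<gamma> p f
    by unfold_locales (use assms in auto)
  have rs: "ring_sol D0 D1 \<alpha> \<beta> \<gamma> p f u" if "ring_solution \<alpha> D0 D1 f u" for u
    by unfold_locales (rule that)
  have level: "strictly_starshaped (superlevel u l)"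
    if "\<gamma> \<le> \<beta>" "ring_solution \<alpha> D0 D1 f u" "\<forall>x\<in>D0 - closure D1. 0 < u x \<and> u x < 1" "l \<in> {0<..<1}" for u l
    using ring_sol.superlevel_strictly_starshaped[OF rs[OF that(2)] that(1) _ that(4)] that(3) by blast
  have strict: "0 < u x \<and> u x < 1"
    if "\<gamma> \<le> \<beta>" "ring_solution \<alpha> D0 D1 f u" "x \<in> D0 - closure D1" for u x
    using ring_sol.strict_interior[OF rs[OF that(2)] that(1,3)] by blast
  show ?thesis
  proof (intro conjI impI allI ballI)
    assume "p * \<gamma> \<le> \<beta> \<and> C11_domain (D0 - closure D1)"
    then have mono: "p * \<gamma> \<le> \<beta>" ..
    obtain u where u: "ring_solution \<alpha> D0 D1 f u"
      using solution_exists[OF mono assms(11)] by blast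
    \<comment> \<open>Uniqueness is the comparison of two solutions in both directions.\<close>
    show "\<exists>!u. ring_solution \<alpha> D0 D1 f u"
      using u solution_le[OF mono] by (auto intro!: ext antisym)
  qed (use level strict \<gamma>_le_\<beta> in blast)+
qed

end
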